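(* Let $\Omega$ be a domain in $\mathbb R^n$, let $q\in(1,\infty)$, and let $L=-\operatorname{div}A\nabla$ be a $q$-elliptic operator on $\Omega$. For any ball $B\subset\mathbb R^n$ of radius $r$ that satisfies $2B\subset\Omega$ and any weak solution $u\in W^{1,2}_{loc}(\Omega)$ to $Lu=0$, we have $$\int_B|\nabla u|^2|u|^{q-2}\,dX\le\frac C{r^2}\int_{2B}|u|^q\,dX.$$ Moreover, the following reverse Hölder estimates hold. (i) If $q>2$, $\displaystyle\Big(\frac1{|B|}\int_B|u|^q\,dX\Big)^{1/q}\le C\Big(\frac1{|2B|}\int_{2B}|u|^2\,dX\Big)^{1/2}.$ (ii) If $q<2$, $\displaystyle\Big(\frac1{|B|}\int_B|u|^2\,dX\Big)^{1/2}\le C\Big(\frac1{|2B|}\int_{2B}|u|^q\,dX\Big)^{1/q}.$ In all three inequalities, $C>0$ depends only on $n$, $q$, a lower bound on the $q$-ellipticity constant $\lambda_q$, and $\|A\|_\infty$.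
   Context: Here $L=-\operatorname{div}A\nabla$ is $q$-elliptic if $A\in L^\infty(\Omega)$ is a complex $n\times n$ matrix function and there is $\lambda_q>0$ with $\operatorname{Re}(A(X)\xi\cdot\overline{\mathcal J_q\xi})\ge\lambda_q|\xi|^2$ for a.e. $X\in\Omega$ and all $\xi\in\mathbb C^n$, where $\mathcal J_q(\alpha+i\beta)=\frac1q\alpha+\frac i{q'}\beta$ ($\alpha,\beta\in\mathbb R^n$, $\frac1q+\frac1{q'}=1$). $u\in W^{1,2}_{loc}(\Omega)$ is a weak solution to $Lu=0$ if $\int_\Omega A\nabla u\cdot\nabla\bar\Psi\,dX=0$ for all $\Psi\in C_0^\infty(\Omega)$. $2B$ is the concentric ball of double radius. $|\nabla u|^2|u|^{q-2}$ is understood to be $0$ where $u=0$. *)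

theory Defs
  imports "HOL-Analysis.Analysis" "HOL-Probability.Essential_Supremum"
begin

definition gradient :: "(real^'n \<Rightarrow> complex) \<Rightarrow> real^'n \<Rightarrow> complex^'n" where
  "gradient f X = (\<chi> i. frechet_derivative f (at X) (axis i 1))"

fun C_times :: "nat \<Rightarrow> (real^'n \<Rightarrow> complex) \<Rightarrow> bool" where
  "C_times 0 f \<longleftrightarrow> continuous_on UNIV f"
| "C_times (Suc k) f \<longleftrightarrow>
     (\<forall>X. f differentiable (at X)) \<and> (\<forall>i. C_times k (\<lambda>X. gradient f X $ i))"

definition test_functions :: "(real^'n) set \<Rightarrow> (real^'n \<Rightarrow> complex) set" where
  "test_functions \<Omega> =
     {\<psi>. (\<forall>k. C_times k \<psi>) \<and> compact (closure {X. \<psi> X \<noteq> 0}) \<and> closure {X. \<psi> X \<noteq> 0} \<subseteq> \<Omega>}"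

definition L2_loc :: "(real^'n) set \<Rightarrow> (real^'n \<Rightarrow> 'b::real_normed_vector) \<Rightarrow> bool" where
  "L2_loc \<Omega> f \<longleftrightarrow> f \<in> borel_measurable (lebesgue_on \<Omega>) \<and>
     (\<forall>K. compact K \<and> K \<subseteq> \<Omega> \<longrightarrow> set_integrable lebesgue K (\<lambda>X. (norm (f X))\<^sup>2))"

definition has_weak_gradient ::
    "(real^'n) set \<Rightarrow> (real^'n \<Rightarrow> complex) \<Rightarrow> (real^'n \<Rightarrow> complex^'n) \<Rightarrow> bool" where
  "has_weak_gradient \<Omega> u G \<longleftrightarrow> L2_loc \<Omega> u \<and> L2_loc \<Omega> G \<and>
     (\<forall>\<phi>\<in>test_functions \<Omega>. \<forall>i.
        (LINT X:\<Omega>|lebesgue. u X * gradient \<phi> X $ i) = - (LINT X:\<Omega>|lebesgue. G X $ i * \<phi> X))"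

definition W12_loc :: "(real^'n) set \<Rightarrow> (real^'n \<Rightarrow> complex) set" where
  "W12_loc \<Omega> = {u. \<exists>G. has_weak_gradient \<Omega> u G}"

text \<open>The weak gradient is unique up to null sets, so the choice of representative is immaterial.\<close>

definition weak_gradient ::
    "(real^'n) set \<Rightarrow> (real^'n \<Rightarrow> complex) \<Rightarrow> real^'n \<Rightarrow> complex^'n" where
  "weak_gradient \<Omega> u = (SOME G. has_weak_gradient \<Omega> u G)"

text \<open>The bilinear (not sesquilinear) product; conjugations are written explicitly.\<close>

definition cdot :: "complex^'n \<Rightarrow> complex^'n \<Rightarrow> complex" where
  "cdot v w = (\<Sum>i\<in>UNIV. v $ i * w $ i)"

definition cnj_vec :: "complex^'n \<Rightarrow> complex^'n" where
  "cnj_vec v = (\<chi> i. cnj (v $ i))"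

definition J :: "real \<Rightarrow> complex^'n \<Rightarrow> complex^'n" where
  "J q \<xi> = (let q' = q / (q - 1) in \<chi> i. Complex (Re (\<xi> $ i) / q) (Im (\<xi> $ i) / q'))"

text \<open>The norm on matrices is the Euclidean norm of the entries. It differs from the operator
  norm by factors depending only on the dimension.\<close>

definition Linf_norm :: "(real^'n) set \<Rightarrow> (real^'n \<Rightarrow> complex^'n^'n) \<Rightarrow> ennreal" where
  "Linf_norm \<Omega> A = esssup (lebesgue_on \<Omega>) (\<lambda>X. ennreal (norm (A X)))"

definition Linf :: "(real^'n) set \<Rightarrow> (real^'n \<Rightarrow> complex^'n^'n) set" where
  "Linf \<Omega> = {A. A \<in> borel_measurable (lebesgue_on \<Omega>) \<and> Linf_norm \<Omega> A < \<infinity>}"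

text \<open>\<open>lamq\<close> is an admissible constant \<open>\<lambda>\<^sub>q\<close> in the \<open>q\<close>-ellipticity condition.\<close>

definition q_elliptic ::
    "(real^'n) set \<Rightarrow> (real^'n \<Rightarrow> complex^'n^'n) \<Rightarrow> real \<Rightarrow> real \<Rightarrow> bool" where
  "q_elliptic \<Omega> A q lamq \<longleftrightarrow> A \<in> Linf \<Omega> \<and> 0 < lamq \<and>
     (AE X in lebesgue_on \<Omega>. \<forall>\<xi>. Re (cdot (A X *v \<xi>) (cnj_vec (J q \<xi>))) \<ge> lamq * (norm \<xi>)\<^sup>2)"

definition weak_solution ::
    "(real^'n) set \<Rightarrow> (real^'n \<Rightarrow> complex^'n^'n) \<Rightarrow> (real^'n \<Rightarrow> complex) \<Rightarrow> bool" where
  "weak_solution \<Omega> A u \<longleftrightarrow> u \<in> W12_loc \<Omega> \<and>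
     (\<forall>\<Psi>\<in>test_functions \<Omega>.
        (LINT X:\<Omega>|lebesgue. cdot (A X *v weak_gradient \<Omega> u X) (gradient (\<lambda>Y. cnj (\<Psi> Y)) X)) = 0)"

text \<open>Integrals of nonnegative functions are taken in \<open>[0,\<infinity>]\<close>, so an estimate with a finite
  right-hand side includes the finiteness of the left-hand side.\<close>

text \<open>The definition is only meant for exponents \<open>a > 0\<close>, where the power of \<open>\<infinity>\<close> is \<open>\<infinity>\<close>.\<close>

definition enn_powr :: "ennreal \<Rightarrow> real \<Rightarrow> ennreal" where
  "enn_powr x a = (if x = \<infinity> then \<infinity> else ennreal (enn2real x powr a))"

definition mean_norm :: "(real^'n) set \<Rightarrow> real \<Rightarrow> (real^'n \<Rightarrow> complex) \<Rightarrow> ennreal" where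
  "mean_norm S p u =
     enn_powr ((\<integral>\<^sup>+X\<in>S. ennreal (norm (u X) powr p) \<partial>lebesgue) / emeasure lebesgue S) (1 / p)"

text \<open>Since \<open>0 powr a = 0\<close> for every \<open>a\<close>, this vanishes where \<open>u = 0\<close>, also if \<open>q \<le> 2\<close>.\<close>

definition grad_density ::
    "(real^'n) set \<Rightarrow> real \<Rightarrow> (real^'n \<Rightarrow> complex) \<Rightarrow> real^'n \<Rightarrow> real" where
  "grad_density \<Omega> q u X = (norm (weak_gradient \<Omega> u X))\<^sup>2 * norm (u X) powr (q - 2)"

end

theory Submission
  imports Defs
begin

text \<open>
  Since \<open>J q (i \<xi>) = i J q' \<xi>\<close>, \<open>q\<close>-ellipticity is the same as \<open>q'\<close>-ellipticity, and convex combination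
  gives coercivity for every exponent between \<open>2\<close> and \<open>q\<close>. Testing the equation with
  \<open>\<psi>(u) u \<zeta>\<^sup>2\<close>, where \<open>\<psi>(u)\<close> is a regularization of \<open>\<bar>u\<bar>\<^sup>p\<^sup>-\<^sup>2\<close> and \<open>p\<close> lies between \<open>2\<close> and \<open>q\<close>, yields
  \<open>\<integral> \<psi>(u) \<bar>\<nabla>u\<bar>\<^sup>2 \<zeta>\<^sup>2 \<le> C \<integral> \<psi>(u) \<bar>u\<bar>\<^sup>2 \<bar>\<nabla>\<zeta>\<bar>\<^sup>2\<close>; for \<open>p = q\<close> this is the first estimate in the limit.
  Instead of a Sobolev embedding, the reverse Hoelder estimates use the Nash type inequality
  \<open>\<parallel>f\<parallel>\<^sub>2\<^sup>2 \<le> \<parallel>f\<parallel>\<^sub>1\<^sup>2 / \<bar>B\<^sub>t\<bar> + (t\<^sup>2 / 2) \<parallel>\<nabla>f\<parallel>\<^sub>2\<^sup>2\<close> for \<open>f = \<psi>(u)\<^sup>1\<^sup>/\<^sup>2 u \<zeta>\<close>. With \<open>t\<close> a small multiple of the width of the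
  cutoff, the gradient term is absorbed over a sequence of radii, so that \<open>\<integral> \<bar>u\<bar>\<^sup>p\<close> is bounded by
  \<open>(\<integral> \<bar>u\<bar>\<^sup>p\<^sup>/\<^sup>2)\<^sup>2\<close> on a larger ball. For \<open>q < 2\<close> take \<open>p = 2\<close> and Jensen's inequality; for \<open>q > 2\<close> run
  through \<open>p = q / 2\<^sup>j\<close> until \<open>p \<le> 2\<close>.
\<close>

section \<open>Smooth functions and bump functions\<close>

text \<open>The weight \<open>norm (u X) powr (p - 2)\<close> blows up at zeros of \<open>u\<close>
  if p < 2 and at large values if p > 2, while \<open>u\<close> and its weak gradient are only
  locally square integrable; the natural test function need not be admissible. For fixed \<epsilon>
  the regularized weight is bounded above and below, so the test function is a \<open>C^1\<close>
  function of \<open>u\<close> with bounded derivative and the chain rule follows by mollification.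
  Fixed \<epsilon> also supplies the finiteness that absorption requires, while the constants do not
  depend on \<epsilon>. In the limit Fatou's lemma acts on the left and dominated convergence on the
  right, so integrability of the p-th power of \<open>norm u\<close> is a conclusion, drawn from
  that of the power p / 2. This is why the exponents double and why the chain starts at an exponent
  in (1, 2], where integrability is known. The doubling itself comes from comparing the
  \<open>L^2\<close> and \<open>L^1\<close> norms of one function whose modulus tends to the power p
  / 2 of \<open>norm u\<close> times a cutoff. The Nash type inequality uses only translations, so
  no dimension has to be singled out.\<close>

lemma gradient_nth:
  assumes "(f has_derivative D) (at X)"
  shows "gradient f X $ i = D (axis i 1)"
  using frechet_derivative_at[OF assms] by (simp add: gradient_def)

lemma has_derivative_gradient:
  fixes f :: "real^'n \<Rightarrow> complex"
  assumes "f differentiable (at X)"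
  shows "(f has_derivative (\<lambda>h. \<Sum>i\<in>UNIV. (h $ i) *\<^sub>R gradient f X $ i)) (at X)"
proof -
  let ?D = "frechet_derivative f (at X)"
  have D: "(f has_derivative ?D) (at X)"
    using assms frechet_derivative_works by blast
  then interpret bounded_linear ?D
    by (rule has_derivative_bounded_linear)
  have "?D h = (\<Sum>i\<in>UNIV. (h $ i) *\<^sub>R gradient f X $ i)" for h
  proof -
    have "h = (\<Sum>i\<in>UNIV. (h $ i) *\<^sub>R axis i 1)"
      using basis_expansion[of h] by (simp add: scalar_mult_eq_scaleR)
    then have "?D h = ?D (\<Sum>i\<in>UNIV. (h $ i) *\<^sub>R axis i 1)"
      by simp
    then show ?thesis
      by (simp add: sum scaleR gradient_def)
  qed
  then have "?D = (\<lambda>h. \<Sum>i\<in>UNIV. (h $ i) *\<^sub>R gradient f X $ i)"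
    by blast
  with D show ?thesis
    by simp
qed

text \<open>Cauchy-Schwarz. It bounds the operator norm of the derivative of a complex function by
  the Euclidean norm of its gradient.\<close>

lemma norm_gradient_apply_le:
  "norm (\<Sum>i\<in>UNIV. (h $ i) *\<^sub>R (v :: complex^'n) $ i) \<le> norm h * norm v"
proof -
  have "norm (\<Sum>i\<in>UNIV. (h $ i) *\<^sub>R v $ i) \<le> (\<Sum>i\<in>UNIV. \<bar>h $ i\<bar> * \<bar>norm (v $ i)\<bar>)"
    by (rule order_trans[OF norm_sum]) simp
  also have "\<dots> \<le> L2_set (\<lambda>i. h $ i) UNIV * L2_set (\<lambda>i. norm (v $ i)) UNIV"
    by (rule L2_set_mult_ineq)
  also have "\<dots> = norm h * norm v"
    by (simp add: norm_vec_def L2_set_def)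
  finally show ?thesis .
qed

text \<open>Since a derivative at a point is unique, smoothness can be checked on any explicit
  formula for it instead of on \<open>frechet_derivative\<close>.\<close>

lemma C_times_SucI:
  assumes "\<And>X. (f has_derivative D X) (at X)" and "\<And>i. C_times k (\<lambda>X. D X (axis i 1))"
  shows "C_times (Suc k) f"
  using assms by (auto simp: gradient_nth[OF assms(1)] differentiable_def)

lemma C_times_Suc_imp: "C_times (Suc k) f \<Longrightarrow> C_times k f"
proof (induction k arbitrary: f)
  case 0
  then show ?case
    by (auto intro!: continuous_at_imp_continuous_on differentiable_imp_continuous_within)
next
  case (Suc k)
  then show ?case
    by auto
qed

lemma C_times_le: "C_times k f \<Longrightarrow> j \<le> k \<Longrightarrow> C_times j f"
  by (induction k) (auto simp: le_Suc_eq simp del: C_times.simps dest: C_times_Suc_imp)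

lemma C_times_continuous: "C_times k f \<Longrightarrow> continuous_on UNIV f"
  using C_times_le[of k f 0] by simp

lemma C_times_const: "C_times k (\<lambda>X. c)"
proof (induction k arbitrary: c)
  case (Suc k)
  show ?case
    by (rule C_times_SucI[where D = "\<lambda>X h. 0"]) (use Suc in \<open>auto simp del: C_times.simps\<close>)
qed simp

lemma C_times_add: "C_times k f \<Longrightarrow> C_times k g \<Longrightarrow> C_times k (\<lambda>X. f X + g X)"
proof (induction k arbitrary: f g)
  case 0
  then show ?case
    by (auto intro: continuous_intros)
next
  case (Suc k)
  from Suc.prems have "(f has_derivative frechet_derivative f (at X)) (at X)"
    "(g has_derivative frechet_derivative g (at X)) (at X)" for X
    by (auto simp: frechet_derivative_works[symmetric])
  then have "((\<lambda>X. f X + g X) has_derivative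
      (\<lambda>h. frechet_derivative f (at X) h + frechet_derivative g (at X) h)) (at X)" for X
    by (auto intro!: derivative_eq_intros)
  then show ?case
    by (rule C_times_SucI) (use Suc in \<open>auto simp: gradient_def\<close>)
qed

lemma C_times_mult: "C_times k f \<Longrightarrow> C_times k g \<Longrightarrow> C_times k (\<lambda>X. f X * g X)"
proof (induction k arbitrary: f g)
  case 0
  then show ?case
    by (auto intro: continuous_intros)
next
  case (Suc k)
  from Suc.prems have "(f has_derivative frechet_derivative f (at X)) (at X)"
    "(g has_derivative frechet_derivative g (at X)) (at X)" for X
    by (auto simp: frechet_derivative_works[symmetric])
  then have *: "((\<lambda>X. f X * g X) has_derivative
      (\<lambda>h. f X * frechet_derivative g (at X) h + frechet_derivative f (at X) h * g X)) (at X)" for X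
    by (auto intro!: derivative_eq_intros)
  \<comment> \<open>The product rule keeps one factor undifferentiated, so the factors themselves
    must also be available in class \<open>k\<close>.\<close>
  have "C_times k f" "C_times k g"
    using Suc.prems by (auto simp del: C_times.simps dest: C_times_Suc_imp)
  moreover have "C_times k (\<lambda>X. frechet_derivative f (at X) (axis i 1))"
    "C_times k (\<lambda>X. frechet_derivative g (at X) (axis i 1))" for i
    using Suc.prems by (auto simp: gradient_def)
  ultimately show ?case
    by (intro C_times_SucI[OF *] C_times_add Suc.IH)
qed

lemma C_times_affine: "C_times k (\<lambda>X :: real^'n. complex_of_real (a * X $ i + b))"
proof (cases k)
  case 0
  then show ?thesis
    by (auto intro!: continuous_intros)
next
  case (Suc k)
  have "((\<lambda>X :: real^'n. complex_of_real (a * X $ i + b)) has_derivative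
      (\<lambda>h. complex_of_real (a * h $ i))) (at X)" for X
    by (auto intro!: derivative_eq_intros
        bounded_linear.has_derivative[OF bounded_linear_vec_nth])
  then show ?thesis
    unfolding Suc by (rule C_times_SucI) (rule C_times_const)
qed

section \<open>Flat functions and smooth bumps\<close>

text \<open>Handles the gluing point of functions defined piecewise: it serves both the flat
  exponentials and the squared positive part.\<close>

lemma has_derivative_zero_of_quadratic_bound:
  fixes f :: "real \<Rightarrow> real"
  assumes "\<And>t. \<bar>f t\<bar> \<le> C * t\<^sup>2"
  shows "(f has_real_derivative 0) (at 0)"
proof -
  have f0: "f 0 = 0"
    using assms[of 0] by simp
  have "((\<lambda>h. f h / h) \<longlongrightarrow> 0) (at 0)"
  proof (rule Lim_null_comparison)
    show "eventually (\<lambda>h. norm (f h / h) \<le> C * \<bar>h\<bar>) (at 0)"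
    proof (rule eventually_at_filter[THEN iffD2, OF always_eventually], intro allI impI)
      fix h :: real
      assume "h \<noteq> 0"
      then show "norm (f h / h) \<le> C * \<bar>h\<bar>"
        using assms[of h] by (simp add: divide_simps power2_eq_square abs_mult[symmetric] mult.assoc)
    qed
    show "((\<lambda>h :: real. C * \<bar>h\<bar>) \<longlongrightarrow> 0) (at 0)"
      by (auto intro!: tendsto_eq_intros)
  qed
  then show ?thesis
    by (simp add: DERIV_def f0)
qed

text \<open>The classical \<open>exp (- (1 / t))\<close>, extended by zero. The additional power in
  the denominator closes the family under differentiation, since the derivative of
  \<open>flat m\<close> is a combination of \<open>flat (m + 2)\<close> and
  \<open>flat (m + 1)\<close>.\<close>

definition flat :: "nat \<Rightarrow> real \<Rightarrow> real" where
  "flat m t = (if t \<le> 0 then 0 else exp (- (1 / t)) / t ^ m)"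

lemma flat_nonneg: "0 \<le> flat m t"
  by (simp add: flat_def)

text \<open>A single term of the exponential series already suffices: \<open>exp (1 / t)\<close>
  dominates \<open>(1 / t) ^ (m + 2) / fact (m + 2)\<close>, and two of these powers survive the
  division by \<open>t ^ m\<close>.\<close>

lemma flat_quadratic_bound: "\<bar>flat m t\<bar> \<le> fact (m + 2) * t\<^sup>2"
proof (cases "t \<le> 0")
  case False
  then have t: "0 < t"
    by simp
  define F :: real where "F = fact (m + 2)"
  have "0 < F"
    by (simp add: F_def)
  have "(1 / t) ^ (m + 2) / F \<le> exp (1 / t)"
  proof -
    have "(1 / t) ^ (m + 2) / F = (\<Sum>n\<in>{m+2}. (1 / t) ^ n /\<^sub>R fact n)"
      by (simp add: F_def divide_inverse del: fact_Suc)
    also have "\<dots> \<le> (\<Sum>n. (1 / t) ^ n /\<^sub>R fact n)"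
      using t by (intro sum_le_suminf summable_exp_generic) auto
    finally show ?thesis
      by (simp add: exp_def)
  qed
  then have "exp (- (1 / t)) \<le> F * t ^ (m + 2)"
    using t \<open>0 < F\<close> by (simp add: exp_minus field_simps)
  then have "exp (- (1 / t)) / t ^ m \<le> F * t ^ (m + 2) / t ^ m"
    using t by (intro divide_right_mono) auto
  also have "\<dots> = F * t\<^sup>2"
    using t by (simp add: power_add power2_eq_square)
  finally show ?thesis
    using t by (simp add: flat_def F_def del: fact_Suc)
qed (simp add: flat_def)

lemma flat_has_derivative:
  "(flat m has_real_derivative (flat (m + 2) t - of_nat m * flat (m + 1) t)) (at t)"
proof -
  consider "t = 0" | "t < 0" | "0 < t"
    by linarith
  then show ?thesis
  proof cases
    case 1
    have "flat (m + 2) 0 - of_nat m * flat (m + 1) 0 = 0"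
      by (simp add: flat_def)
    then show ?thesis
      unfolding 1 by (simp only: has_derivative_zero_of_quadratic_bound[OF flat_quadratic_bound])
  next
    case 2
    have "((\<lambda>t. 0) has_real_derivative 0) (at t)"
      by simp
    then have "(flat m has_real_derivative 0) (at t)"
      by (rule has_field_derivative_transform_within_open[where S = "{..<0}"])
        (use 2 in \<open>auto simp: flat_def\<close>)
    with 2 show ?thesis
      by (simp add: flat_def)
  next
    case 3
    have inv: "((\<lambda>t. 1 / t) has_real_derivative - ((1 / t) ^ 2)) (at t)"
      using 3 by (auto intro!: derivative_eq_intros simp: power2_eq_square)
    have "((\<lambda>t. exp (- (1 / t)) * (1 / t) ^ m) has_real_derivative
        exp (- (1 / t)) * (1 / t) ^ 2 * (1 / t) ^ m
        + exp (- (1 / t)) * (of_nat m * (- ((1 / t) ^ 2) * (1 / t) ^ (m - 1)))) (at t)"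
      by (rule derivative_eq_intros inv refl | simp)+
    \<comment> \<open>For \<open>m = 0\<close> the truncated exponent \<open>m - 1\<close> does no
      damage because the factor \<open>m\<close> vanishes.\<close>
    moreover have "of_nat m * (- ((1 / t) ^ 2) * (1 / t) ^ (m - 1)) = - (of_nat m * (1 / t) ^ (m + 1))"
      by (cases m) (simp_all add: power2_eq_square)
    moreover have "flat j t = exp (- (1 / t)) * (1 / t) ^ j" for j
      using 3 by (simp add: flat_def power_one_over divide_inverse power_inverse)
    moreover have "exp (- (1 / t)) * (1 / t) ^ 2 * (1 / t) ^ m = exp (- (1 / t)) * (1 / t) ^ (m + 2)"
      by (simp only: power_add mult.assoc mult.left_commute mult.commute)
    ultimately have "((\<lambda>t. exp (- (1 / t)) * (1 / t) ^ m) has_real_derivative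
        flat (m + 2) t - of_nat m * flat (m + 1) t) (at t)"
      by (simp only: mult_minus_right mult.left_commute[of "exp (- (1 / t))"] diff_conv_add_uminus)
    then show ?thesis
      by (rule has_field_derivative_transform_within_open[where S = "{0<..}"])
        (use 3 in \<open>auto simp: flat_def divide_inverse power_inverse\<close>)
  qed
qed

text \<open>The argument contains the squared norm, which is a polynomial, so nothing has to be
  differentiated at the centre where the norm is not smooth.\<close>

definition bump :: "nat \<Rightarrow> real \<Rightarrow> real^'n \<Rightarrow> complex" where
  "bump m e X = complex_of_real (flat m (e\<^sup>2 - (norm X)\<^sup>2))"

lemma has_derivative_of_real_radial:
  fixes g :: "real \<Rightarrow> real" and X :: "real^'n"
  assumes "(g has_real_derivative g') (at (a - (norm (X - c))\<^sup>2))"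
  shows "((\<lambda>X. complex_of_real (g (a - (norm (X - c))\<^sup>2))) has_derivative
    (\<lambda>h. complex_of_real (g' * (- 2 * ((X - c) \<bullet> h))))) (at X)"
proof -
  have "((\<lambda>X. a - (norm (X - c))\<^sup>2) has_derivative (\<lambda>h. - 2 * ((X - c) \<bullet> h))) (at X)"
    unfolding power2_norm_eq_inner
    by (auto intro!: derivative_eq_intros simp: inner_commute algebra_simps)
  from has_derivative_compose[OF this has_field_derivative_imp_has_derivative[OF assms]]
  have "((\<lambda>X. g (a - (norm (X - c))\<^sup>2)) has_derivative (\<lambda>h. g' * (- 2 * ((X - c) \<bullet> h)))) (at X)"
    .
  then show ?thesis
    by (rule has_derivative_of_real)
qed

text \<open>Induction on \<open>k\<close> with \<open>m\<close> arbitrary: each partial derivative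
  is a coordinate times a combination of bumps with \<open>m + 1\<close> and
  \<open>m + 2\<close>.\<close>

lemma C_times_bump: "C_times k (bump m e :: real^'n \<Rightarrow> complex)"
proof (induction k arbitrary: m)
  case 0
  have "continuous_on UNIV (flat m)"
    using flat_has_derivative DERIV_isCont by (fast intro: continuous_at_imp_continuous_on)
  then have "continuous_on UNIV (\<lambda>X :: real^'n. flat m (e\<^sup>2 - (norm X)\<^sup>2))"
    by (rule continuous_on_compose2) (auto intro!: continuous_intros)
  then show ?case
    by (auto simp: bump_def intro!: continuous_intros)
next
  case (Suc k)
  let ?d = "\<lambda>t. flat (m + 2) t - of_nat m * flat (m + 1) t"
  have D: "(bump m e has_derivative
      (\<lambda>h. complex_of_real (?d (e\<^sup>2 - (norm X)\<^sup>2) * (- 2 * (X \<bullet> h))))) (at X)" for X :: "real^'n"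
    using has_derivative_of_real_radial[OF flat_has_derivative, where c = 0 and X = X]
    by (simp add: bump_def[abs_def])
  have eq: "(\<lambda>X :: real^'n. complex_of_real (?d (e\<^sup>2 - (norm X)\<^sup>2) * (- 2 * (X \<bullet> axis i 1)))) =
      (\<lambda>X. (bump (m + 2) e X + complex_of_real (- real m) * bump (m + 1) e X)
        * complex_of_real (- 2 * X $ i + 0))" for i
    by (rule ext) (simp add: bump_def inner_axis)
  have Ck: "C_times k (\<lambda>X :: real^'n. (bump (m + 2) e X + complex_of_real (- real m) * bump (m + 1) e X)
        * complex_of_real (- 2 * X $ i + 0))" for i
    by (intro C_times_mult C_times_add Suc.IH C_times_const C_times_affine)
  then show ?case
    by (intro C_times_SucI[OF D]) (simp only: eq)
qed

section \<open>Convolution and mollification\<close>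

lemma distr_lborel_reflect: "distr lborel borel (\<lambda>Y. X - Y) = (lborel :: 'a::euclidean_space measure)"
  using lborel_affine[of "- 1" X] by (simp add: density_1)

lemma nn_integral_lborel_reflect:
  fixes f :: "'a::euclidean_space \<Rightarrow> ennreal"
  assumes "f \<in> borel_measurable borel"
  shows "(\<integral>\<^sup>+Y. f (X - Y) \<partial>lborel) = (\<integral>\<^sup>+Y. f Y \<partial>lborel)"
  using assms by (subst (2) distr_lborel_reflect[of X, symmetric]) (simp add: nn_integral_distr)

lemma integral_lborel_reflect:
  fixes f :: "'a::euclidean_space \<Rightarrow> 'b::{banach, second_countable_topology}"
  assumes "f \<in> borel_measurable borel"
  shows "(\<integral>Y. f (X - Y) \<partial>lborel) = (\<integral>Y. f Y \<partial>lborel)"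
  using assms by (subst (2) distr_lborel_reflect[of X, symmetric]) (simp add: integral_distr)

text \<open>Heine-Cantor on a ball enlarged by 1. Two points at distance less than 1 either both lie
  in the enlarged ball or both lie outside the support.\<close>

lemma uniformly_continuous_compact_support:
  fixes f :: "'a::euclidean_space \<Rightarrow> 'b::real_normed_vector"
  assumes f: "continuous_on UNIV f" and zero: "\<And>X. X \<notin> cball 0 e \<Longrightarrow> f X = 0" and "0 < \<epsilon>"
  obtains \<delta> where "0 < \<delta>" "\<And>X Y. dist X Y < \<delta> \<Longrightarrow> dist (f X) (f Y) < \<epsilon>"
proof -
  have "uniformly_continuous_on (cball 0 (e + 1)) f"
    by (intro compact_uniformly_continuous continuous_on_subset[OF f]) auto
  then obtain \<delta> where \<delta>: "0 < \<delta>"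
    "\<And>X Y. X \<in> cball 0 (e + 1) \<Longrightarrow> Y \<in> cball 0 (e + 1) \<Longrightarrow> dist X Y < \<delta> \<Longrightarrow> dist (f X) (f Y) < \<epsilon>"
    using \<open>0 < \<epsilon>\<close> unfolding uniformly_continuous_on_def by metis
  have "dist (f X) (f Y) < \<epsilon>" if "dist X Y < min 1 \<delta>" for X Y
  proof (cases "X \<in> cball 0 (e + 1) \<and> Y \<in> cball 0 (e + 1)")
    case True
    with \<delta> that show ?thesis
      by auto
  next
    case False
    have "\<bar>norm X - norm Y\<bar> < 1"
      using that norm_triangle_ineq3[of X Y] by (simp add: dist_norm)
    with False have "X \<notin> cball 0 e" "Y \<notin> cball 0 e"
      by auto
    with zero \<open>0 < \<epsilon>\<close> show ?thesis
      by simp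
  qed
  with \<delta>(1) show ?thesis
    by (intro that[of "min 1 \<delta>"]) auto
qed

lemma bounded_compact_support:
  fixes f :: "'a::euclidean_space \<Rightarrow> 'b::real_normed_vector"
  assumes f: "continuous_on UNIV f" and zero: "\<And>X. X \<notin> cball x e \<Longrightarrow> f X = 0"
  obtains C where "0 \<le> C" "\<And>X. norm (f X) \<le> C"
proof -
  have "bounded (f ` cball x e)"
    by (intro compact_imp_bounded compact_continuous_image continuous_on_subset[OF f]) auto
  then obtain C where "\<And>X. X \<in> cball x e \<Longrightarrow> norm (f X) \<le> C"
    unfolding bounded_iff by (metis imageI)
  with zero show ?thesis
    by (intro that[of "max 0 C"]) (force simp: le_max_iff_disj)+
qed

lemma integrable_compact_support:
  fixes f :: "'a::euclidean_space \<Rightarrow> 'b::{banach, second_countable_topology}"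
  assumes f: "continuous_on UNIV f" and zero: "\<And>X. X \<notin> cball x e \<Longrightarrow> f X = 0"
  shows "integrable lborel f"
proof -
  have "integrable lborel (\<lambda>X. indicator (cball x e) X *\<^sub>R f X)"
    by (intro borel_integrable_compact continuous_on_subset[OF f]) auto
  moreover have "(\<lambda>X. indicator (cball x e) X *\<^sub>R f X) = f"
    using zero by (auto simp: indicator_def)
  ultimately show ?thesis
    by simp
qed

lemma integrable_mult_bounded_continuous:
  fixes f g :: "'a::euclidean_space \<Rightarrow> complex"
  assumes f: "integrable lborel f" and g: "continuous_on UNIV g" and bound: "\<And>X. norm (g X) \<le> C"
  shows "integrable lborel (\<lambda>Y. f Y * g (X - Y))"
proof (rule Bochner_Integration.integrable_bound)
  show "integrable lborel (\<lambda>Y. C *\<^sub>R f Y)"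
    using f by simp
  have "(\<lambda>Y. g (X - Y)) \<in> borel_measurable borel"
    by (intro borel_measurable_continuous_onI continuous_on_compose2[OF g] continuous_intros) auto
  then show "(\<lambda>Y. f Y * g (X - Y)) \<in> borel_measurable lborel"
    using f by (intro borel_measurable_times) auto
  show "AE Y in lborel. norm (f Y * g (X - Y)) \<le> norm (C *\<^sub>R f Y)"
  proof (rule AE_I2)
    fix Y
    have "norm (g (X - Y)) \<le> \<bar>C\<bar>"
      using bound[of "X - Y"] by linarith
    then show "norm (f Y * g (X - Y)) \<le> norm (C *\<^sub>R f Y)"
      by (simp add: norm_mult mult.commute[of "cmod (f Y)"] mult_right_mono)
  qed
qed

definition conv :: "(real^'n \<Rightarrow> complex) \<Rightarrow> (real^'n \<Rightarrow> complex) \<Rightarrow> real^'n \<Rightarrow> complex" where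
  "conv f g X = (\<integral>Y. f Y * g (X - Y) \<partial>lborel)"

lemma conv_commute:
  assumes "f \<in> borel_measurable borel" "g \<in> borel_measurable borel"
  shows "conv f g = conv g f"
proof
  fix X
  have "(\<lambda>Y. f (X - Y) * g Y) \<in> borel_measurable borel"
    using assms by measurable
  then have "conv g f X = (\<integral>Y. g (X - Y) * f (X - (X - Y)) \<partial>lborel)"
    unfolding conv_def by (subst integral_lborel_reflect[symmetric, of _ X]) (auto simp: mult.commute)
  then show "conv f g X = conv g f X"
    by (simp add: conv_def mult.commute)
qed

lemma gradient_zero_outside:
  assumes "closed K" and zero: "\<And>X. X \<notin> K \<Longrightarrow> f X = 0" and "X \<notin> K"
  shows "gradient f X = 0"
proof -
  have "(f has_derivative (\<lambda>h. 0)) (at X)"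
    by (rule has_derivative_transform_within_open[where f = "\<lambda>X. 0" and s = "- K"])
      (use assms in auto)
  then show ?thesis
    by (simp add: vec_eq_iff gradient_nth)
qed

lemma continuous_gradient:
  assumes "C_times (Suc 0) f"
  shows "continuous_on UNIV (gradient f)"
proof -
  have "continuous_on UNIV (\<lambda>X. \<chi> i. gradient f X $ i)"
    using assms by (intro continuous_on_vec_lambda) auto
  then show ?thesis
    by simp
qed

lemma norm_integral_mult_le:
  fixes f :: "real^'n \<Rightarrow> complex"
  assumes f: "integrable lborel f" and "\<And>Y. norm (\<phi> Y) \<le> C"
    and "\<phi> \<in> borel_measurable borel"
  shows "norm (\<integral>Y. f Y * \<phi> Y \<partial>lborel) \<le> C * (\<integral>Y. norm (f Y) \<partial>lborel)"
proof -
  have "integrable lborel (\<lambda>Y. C * norm (f Y))"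
    using f by simp
  moreover have le: "norm (f Y * \<phi> Y) \<le> C * norm (f Y)" for Y
    using assms(2)[of Y] by (simp add: norm_mult mult.commute mult_right_mono)
  moreover have "(\<lambda>Y. f Y * \<phi> Y) \<in> borel_measurable lborel"
    using f assms(3) by (intro borel_measurable_times) auto
  moreover have "AE Y in lborel. norm (f Y * \<phi> Y) \<le> norm (C * norm (f Y))"
    using order_trans[OF le abs_ge_self] by (intro AE_I2) (simp only: real_norm_def)
  ultimately have "integrable lborel (\<lambda>Y. f Y * \<phi> Y)"
    by (rule_tac Bochner_Integration.integrable_bound)
  then have "norm (\<integral>Y. f Y * \<phi> Y \<partial>lborel) \<le> (\<integral>Y. norm (f Y * \<phi> Y) \<partial>lborel)"
    by (intro integral_norm_bound)
  also have "\<dots> \<le> (\<integral>Y. C * norm (f Y) \<partial>lborel)"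
    using \<open>integrable lborel (\<lambda>Y. f Y * \<phi> Y)\<close> f le by (intro integral_mono) auto
  finally show ?thesis
    by simp
qed

lemma continuous_conv:
  assumes f: "integrable lborel f" and g: "continuous_on UNIV g"
    and zero: "\<And>X. X \<notin> cball 0 e \<Longrightarrow> g X = 0"
  shows "continuous_on UNIV (conv f g)"
  unfolding continuous_on_iff
proof (intro ballI allI impI)
  fix X and \<epsilon> :: real
  assume "0 < \<epsilon>"
  define N where "N = (\<integral>Y. norm (f Y) \<partial>lborel)"
  have I: "0 \<le> N"
    by (simp add: N_def)
  obtain C where C: "\<And>X. norm (g X) \<le> C"
    using bounded_compact_support[OF g zero] by blast
  \<comment> \<open>The denominator \<open>N + 1\<close> gives
    \<open>\<eta> * N < \<epsilon>\<close> and also covers \<open>N = 0\<close>.\<close>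
  define \<eta> where "\<eta> = \<epsilon> / (N + 1)"
  have "0 < \<eta>"
    unfolding \<eta>_def using \<open>0 < \<epsilon>\<close> I by (intro divide_pos_pos add_nonneg_pos) auto
  then obtain \<delta> where \<delta>: "0 < \<delta>" "\<And>X Y. dist X Y < \<delta> \<Longrightarrow> dist (g X) (g Y) < \<eta>"
    using uniformly_continuous_compact_support[OF g zero] by blast
  have int: "integrable lborel (\<lambda>Y. f Y * g (X - Y))" for X
    using integrable_mult_bounded_continuous[OF f g C] .
  have "dist (conv f g Z) (conv f g X) < \<epsilon>" if "dist Z X < \<delta>" for Z
  proof -
    have "conv f g Z - conv f g X = (\<integral>Y. f Y * (g (Z - Y) - g (X - Y)) \<partial>lborel)"
      unfolding conv_def by (subst Bochner_Integration.integral_diff[symmetric])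
        (use int in \<open>auto simp: right_diff_distrib\<close>)
    also have "norm \<dots> \<le> \<eta> * N"
    proof (rule norm_integral_mult_le[OF f, folded N_def])
      show "norm (g (Z - Y) - g (X - Y)) \<le> \<eta>" for Y
        using \<delta>(2)[of "Z - Y" "X - Y"] that by (simp add: dist_norm)
      show "(\<lambda>Y. g (Z - Y) - g (X - Y)) \<in> borel_measurable borel"
        by (intro borel_measurable_continuous_onI continuous_intros continuous_on_compose2[OF g]) auto
    qed
    also have "\<dots> < \<epsilon>"
      using I \<open>0 < \<epsilon>\<close> by (simp add: \<eta>_def field_simps)
    finally show ?thesis
      by (simp add: dist_norm)
  qed
  with \<delta>(1) show "\<exists>d>0. \<forall>X'\<in>UNIV. dist X' X < d \<longrightarrow> dist (conv f g X') (conv f g X) < \<epsilon>"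
    by blast
qed

text \<open>The first-order Taylor remainder of \<open>g\<close> is at most
  \<open>\<eta> * norm h\<close> uniformly in the base point, because the gradient is uniformly
  continuous. Integrating this against \<open>norm (f Y)\<close> gives the remainder of the
  convolution, so no differentiation theorem under the integral is used.\<close>

lemma conv_has_derivative:
  fixes g :: "real^'n \<Rightarrow> complex"
  assumes f: "integrable lborel f" and g: "C_times (Suc 0) g"
    and zero: "\<And>X. X \<notin> cball 0 e \<Longrightarrow> g X = 0"
  shows "(conv f g has_derivative (\<lambda>h. \<Sum>i\<in>UNIV. (h $ i) *\<^sub>R conv f (\<lambda>X. gradient g X $ i) X)) (at X)"
  unfolding has_derivative_at_alt
proof (intro conjI allI impI)
  show "bounded_linear (\<lambda>h :: real^'n. \<Sum>i\<in>UNIV. (h $ i) *\<^sub>R conv f (\<lambda>X. gradient g X $ i) X)"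
    by (intro bounded_linear_sum bounded_linear_scaleR_left[THEN bounded_linear_compose]
        bounded_linear_vec_nth)
  fix \<epsilon> :: real
  assume "0 < \<epsilon>"
  define N where "N = (\<integral>Y. norm (f Y) \<partial>lborel)"
  let ?G = "\<lambda>X h. \<Sum>i\<in>UNIV. (h $ i) *\<^sub>R gradient g X $ i"
  have I: "0 \<le> N"
    by (simp add: N_def)
  have g0: "continuous_on UNIV g"
    using C_times_continuous[OF g] .
  obtain C where C: "\<And>X. norm (g X) \<le> C"
    using bounded_compact_support[OF g0 zero] by blast
  have Gc: "continuous_on UNIV (gradient g)"
    using continuous_gradient[OF g] .
  then have Gci: "continuous_on UNIV (\<lambda>X. gradient g X $ i)" for i
    by (intro continuous_intros)
  have Gz: "gradient g X = 0" if "X \<notin> cball 0 e" for X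
    using gradient_zero_outside[of "cball 0 e" g X] zero that by auto
  obtain C' where C': "\<And>X. norm (gradient g X) \<le> C'"
    using bounded_compact_support[OF Gc Gz] by blast
  have C'i: "norm (gradient g X $ i) \<le> C'" for X i
    using C'[of X] Finite_Cartesian_Product.norm_nth_le[of "gradient g X" i] by linarith
  define \<eta> where "\<eta> = \<epsilon> / (N + 1)"
  have "0 < \<eta>"
    unfolding \<eta>_def using \<open>0 < \<epsilon>\<close> I by (intro divide_pos_pos add_nonneg_pos) auto
  then obtain \<delta> where \<delta>: "0 < \<delta>" "\<And>X Y. dist X Y < \<delta> \<Longrightarrow> dist (gradient g X) (gradient g Y) < \<eta>"
    using uniformly_continuous_compact_support[OF Gc Gz] by blast
  have int: "integrable lborel (\<lambda>Y. f Y * g (X - Y))" for X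
    using integrable_mult_bounded_continuous[OF f g0 C] .
  have inti: "integrable lborel (\<lambda>Y. f Y * gradient g (X - Y) $ i)" for X i
    using integrable_mult_bounded_continuous[OF f Gci C'i] .
  \<comment> \<open>Mean value inequality for \<open>g\<close> minus its linearization at
    \<open>Z\<close>. On \<open>ball Z \<delta>\<close> the gradient differs from its value at
    \<open>Z\<close> by less than \<eta>, and \<delta> is the same for all \<open>Z\<close>.\<close>
  have Taylor: "norm (g (Z + h) - g Z - ?G Z h) \<le> \<eta> * norm h" if "norm h < \<delta>" for Z h
  proof -
    define D where "D Y k = ?G Y k" for Y k
    have seg: "Z + t *\<^sub>R (Z + h - Z) \<in> ball Z \<delta>" if "t \<in> {0..1}" for t
    proof -
      have "norm (t *\<^sub>R h) \<le> 1 * norm h"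
        using that by (simp add: mult_left_le_one_le)
      with \<open>norm h < \<delta>\<close> show ?thesis
        by (simp add: dist_norm)
    qed
    have D: "(g has_derivative D Y) (at Y within ball Z \<delta>)" for Y
      unfolding D_def[abs_def] using g
      by (rule_tac has_derivative_at_withinI[OF has_derivative_gradient]) simp
    have onorm: "onorm (D Y - D Z) \<le> \<eta>" if "Y \<in> ball Z \<delta>" for Y
    proof (rule onorm_bound)
      fix k :: "real^'n"
      have "(D Y - D Z) k = (\<Sum>i\<in>UNIV. (k $ i) *\<^sub>R (gradient g Y - gradient g Z) $ i)"
        by (simp add: D_def scaleR_diff_right sum_subtractf)
      also have "norm \<dots> \<le> norm k * norm (gradient g Y - gradient g Z)"
        by (rule norm_gradient_apply_le)
      also have "\<dots> \<le> norm k * \<eta>"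
        using \<delta>(2)[of Y Z] that by (intro mult_left_mono) (auto simp: dist_norm norm_minus_commute)
      finally show "norm ((D Y - D Z) k) \<le> \<eta> * norm k"
        by (simp add: mult.commute)
    qed (use \<open>0 < \<eta>\<close> in simp)
    have "norm (g (Z + h) - g Z - D Z ((Z + h) - Z)) \<le> norm ((Z + h) - Z) * \<eta>"
      by (rule differentiable_bound_linearization[OF seg D onorm]) (use \<delta>(1) in simp_all)
    then show ?thesis
      by (simp add: D_def mult.commute)
  qed
  have "norm (conv f g Z - conv f g X - (\<Sum>i\<in>UNIV. ((Z - X) $ i) *\<^sub>R conv f (\<lambda>X. gradient g X $ i) X))
      \<le> \<epsilon> * norm (Z - X)" if "norm (Z - X) < \<delta>" for Z
  proof -
    define h where "h = Z - X"
    have "conv f g Z - conv f g X - (\<Sum>i\<in>UNIV. (h $ i) *\<^sub>R conv f (\<lambda>X. gradient g X $ i) X)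
        = (\<integral>Y. f Y * (g (Z - Y) - g (X - Y) - ?G (X - Y) h) \<partial>lborel)"
    proof -
      have "(\<integral>Y. f Y * (g (Z - Y) - g (X - Y) - ?G (X - Y) h) \<partial>lborel)
          = (\<integral>Y. f Y * g (Z - Y) - f Y * g (X - Y)
              - (\<Sum>i\<in>UNIV. (h $ i) *\<^sub>R (f Y * gradient g (X - Y) $ i)) \<partial>lborel)"
        by (intro Bochner_Integration.integral_cong refl)
          (simp add: right_diff_distrib sum_distrib_left)
      also have "\<dots> = conv f g Z - conv f g X - (\<Sum>i\<in>UNIV. (h $ i) *\<^sub>R conv f (\<lambda>X. gradient g X $ i) X)"
        using int inti by (simp add: conv_def)
      finally show ?thesis
        by simp
    qed
    also have "norm \<dots> \<le> (\<eta> * norm h) * N"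
    proof (rule norm_integral_mult_le[OF f, folded N_def])
      show "norm (g (Z - Y) - g (X - Y) - ?G (X - Y) h) \<le> \<eta> * norm h" for Y
        using Taylor[of h "X - Y"] that by (simp add: h_def)
      show "(\<lambda>Y. g (Z - Y) - g (X - Y) - ?G (X - Y) h) \<in> borel_measurable borel"
        by (intro borel_measurable_continuous_onI continuous_intros continuous_on_compose2[OF g0]
            continuous_on_compose2[OF Gci]) auto
    qed
    also have "\<dots> = (\<eta> * N) * norm h"
      by simp
    also have "\<dots> \<le> \<epsilon> * norm h"
      using I \<open>0 < \<epsilon>\<close> by (intro mult_right_mono) (simp_all add: \<eta>_def field_simps)
    finally show ?thesis
      by (simp add: h_def)
  qed
  with \<delta>(1) show "\<exists>d>0. \<forall>Z. norm (Z - X) < d \<longrightarrow>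
      norm (conv f g Z - conv f g X - (\<Sum>i\<in>UNIV. ((Z - X) $ i) *\<^sub>R conv f (\<lambda>X. gradient g X $ i) X))
        \<le> \<epsilon> * norm (Z - X)"
    by blast
qed

lemma gradient_conv:
  assumes "integrable lborel f" and "C_times (Suc 0) g"
    and "\<And>X. X \<notin> cball 0 e \<Longrightarrow> g X = 0"
  shows "gradient (conv f g) X $ i = conv f (\<lambda>X. gradient g X $ i) X"
proof -
  have "gradient (conv f g) X $ i = (\<Sum>j\<in>UNIV. (axis i 1 $ j) *\<^sub>R conv f (\<lambda>X. gradient g X $ j) X)"
    by (rule gradient_nth[OF conv_has_derivative[OF assms]])
  also have "\<dots> = (\<Sum>j\<in>UNIV. if j = i then conv f (\<lambda>X. gradient g X $ j) X else 0)"
    by (intro sum.cong) (auto simp: axis_def)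
  finally show ?thesis
    by simp
qed

text \<open>All derivatives fall on \<open>g\<close>, so the convolution inherits its smoothness
  although \<open>f\<close> is merely integrable.\<close>

lemma C_times_conv:
  assumes f: "integrable lborel f"
  shows "C_times k g \<Longrightarrow> (\<And>X. X \<notin> cball 0 e \<Longrightarrow> g X = 0) \<Longrightarrow> C_times k (conv f g)"
proof (induction k arbitrary: g)
  case 0
  then have "continuous_on UNIV g"
    by simp
  then have "continuous_on UNIV (conv f g)"
    using 0(2) by (rule continuous_conv[OF f])
  then show ?case
    by simp
next
  case (Suc k)
  have 1: "C_times (Suc 0) g"
    using Suc.prems(1) by (rule C_times_le) simp
  have "conv f g differentiable (at X)" for X
    using conv_has_derivative[OF f 1 Suc.prems(2)] by (auto simp: differentiable_def)
  moreover have "C_times k (conv f (\<lambda>X. gradient g X $ i))" for i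
    using Suc gradient_zero_outside[of "cball 0 e" g] by (intro Suc.IH) auto
  moreover have "(\<lambda>X. gradient (conv f g) X $ i) = conv f (\<lambda>X. gradient g X $ i)" for i
    by (rule ext) (rule gradient_conv[OF f 1 Suc.prems(2)])
  ultimately show ?case
    by simp
qed

section \<open>Mollifiers and approximation in the square mean\<close>

definition mollifier :: "real \<Rightarrow> real^'n \<Rightarrow> real" where
  "mollifier e X = flat 0 (e\<^sup>2 - (norm X)\<^sup>2) / (\<integral>Y. flat 0 (e\<^sup>2 - (norm (Y :: real^'n))\<^sup>2) \<partial>lborel)"

abbreviation cmollifier :: "real \<Rightarrow> real^'n \<Rightarrow> complex" where
  "cmollifier e \<equiv> (\<lambda>X. complex_of_real (mollifier e X))"

lemma mollifier_nonneg: "0 \<le> mollifier e X"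
  by (simp add: mollifier_def flat_nonneg)

lemma C_times_cmollifier: "C_times k (cmollifier e :: real^'n \<Rightarrow> complex)"
proof -
  have "(cmollifier e :: real^'n \<Rightarrow> complex) =
      (\<lambda>X. bump 0 e X * complex_of_real (1 / (\<integral>Y. flat 0 (e\<^sup>2 - (norm (Y :: real^'n))\<^sup>2) \<partial>lborel)))"
    by (simp add: mollifier_def bump_def fun_eq_iff)
  then show ?thesis
    by (simp only: C_times_mult C_times_bump C_times_const)
qed

lemma continuous_cmollifier: "continuous_on UNIV (cmollifier e)"
  by (rule C_times_continuous[OF C_times_cmollifier])

lemma continuous_mollifier: "continuous_on UNIV (mollifier e)"
  using continuous_on_Re[OF continuous_cmollifier] by simp

lemma borel_measurable_mollifier [measurable]: "mollifier e \<in> borel_measurable borel"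
  by (rule borel_measurable_continuous_onI[OF continuous_mollifier])

lemma mollifier_zero:
  assumes "0 < e" "X \<notin> cball 0 e"
  shows "mollifier e X = 0"
proof -
  have "e\<^sup>2 \<le> (norm X)\<^sup>2"
    using assms by (intro power_mono) auto
  then show ?thesis
    by (simp add: mollifier_def flat_def)
qed

lemma integrable_mollifier: "0 < e \<Longrightarrow> integrable lborel (mollifier e)"
  by (rule integrable_compact_support[OF continuous_mollifier mollifier_zero])

lemma integral_mollifier:
  assumes "0 < e"
  shows "(\<integral>X. mollifier e (X :: real^'n) \<partial>lborel) = 1"
proof -
  let ?f = "\<lambda>X :: real^'n. flat 0 (e\<^sup>2 - (norm X)\<^sup>2)"
  have cont: "continuous_on UNIV ?f"
    using continuous_on_Re[OF C_times_continuous[OF C_times_bump[of 0 0 e, where 'n = 'n]]]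
    by (simp add: bump_def)
  have zero: "?f X = 0" if "X \<notin> cball 0 e" for X
  proof -
    have "e\<^sup>2 \<le> (norm X)\<^sup>2"
      using assms that by (intro power_mono) auto
    then show ?thesis
      by (simp add: flat_def)
  qed
  have int: "integrable lborel ?f"
    by (rule integrable_compact_support[OF cont zero])
  have "(\<integral>X. ?f X \<partial>lborel) \<noteq> 0"
  proof
    assume "(\<integral>X. ?f X \<partial>lborel) = 0"
    then have "AE X in lborel. ?f X = 0"
      using integral_nonneg_eq_0_iff_AE[OF int] by (simp add: flat_nonneg)
    moreover have "?f X \<noteq> 0" if "X \<in> ball 0 e" for X
    proof -
      have "(norm X)\<^sup>2 < e\<^sup>2"
        using that by (intro power_strict_mono) auto
      then show ?thesis
        by (simp add: flat_def)
    qed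
    ultimately have "AE X in lborel. X \<notin> ball (0 :: real^'n) e"
      by (auto elim!: eventually_mono)
    then have "emeasure lborel (ball (0 :: real^'n) e) = 0"
      by (subst (asm) AE_iff_measurable[OF _ refl]) (auto simp: ball_def)
    then show False
      using open_not_negligible[of "ball (0 :: real^'n) e"] assms
      by (simp add: negligible_iff_null_sets null_sets_def)
  qed
  then show ?thesis
    by (simp add: mollifier_def)
qed

lemma nn_integral_mollifier:
  assumes "0 < e"
  shows "(\<integral>\<^sup>+X. ennreal (mollifier e (X :: real^'n)) \<partial>lborel) = 1"
proof -
  have "(\<integral>\<^sup>+X. ennreal (mollifier e (X :: real^'n)) \<partial>lborel) = ennreal (\<integral>X. mollifier e (X :: real^'n) \<partial>lborel)"
    using integrable_mollifier[OF assms] by (rule nn_integral_eq_integral) (simp add: mollifier_nonneg)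
  then show ?thesis
    using integral_mollifier[OF assms, where 'n = 'n] by simp
qed

lemma integrable_cmollifier: "0 < e \<Longrightarrow> integrable lborel (cmollifier e)"
  by (rule integrable_compact_support[OF continuous_cmollifier, of 0 e])
    (simp add: mollifier_zero del: mem_cball)

lemma integrable_mult_mollifier:
  fixes f :: "real^'n \<Rightarrow> complex"
  assumes "integrable lborel f" "0 < e"
  shows "integrable lborel (\<lambda>Y. f Y * cmollifier e (X - Y))"
proof -
  obtain C where "\<And>X :: real^'n. norm (cmollifier e X) \<le> C"
    using bounded_compact_support[OF continuous_cmollifier, of 0 e e] mollifier_zero[OF assms(2)]
    by (metis of_real_0)
  then show ?thesis
    by (rule integrable_mult_bounded_continuous[OF assms(1) continuous_cmollifier])
qed

text \<open>Young's inequality for a probability density. The kernel is split into two square roots,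
  Cauchy-Schwarz puts one of them alone into a factor of integral 1, and Tonelli integrates the
  other factor over \<open>X\<close>.\<close>

lemma nn_integral_conv_mollifier_le:
  fixes f :: "real^'n \<Rightarrow> complex"
  assumes f: "integrable lborel f" and e: "0 < e"
  shows "(\<integral>\<^sup>+X. ennreal ((norm (conv f (cmollifier e) X))\<^sup>2) \<partial>lborel)
    \<le> (\<integral>\<^sup>+X. ennreal ((norm (f X))\<^sup>2) \<partial>lborel)"
proof -
  have [measurable]: "f \<in> borel_measurable borel"
    using f by simp
  have m: "(\<integral>\<^sup>+Y. ennreal (mollifier e (X - Y)) \<partial>lborel) = 1" for X :: "real^'n"
    by (subst nn_integral_lborel_reflect[of "\<lambda>Y. ennreal (mollifier e Y)"])
      (auto simp: nn_integral_mollifier[OF e])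
  have m': "(\<integral>\<^sup>+X. ennreal (mollifier e (X - Y)) \<partial>lborel) = 1" for Y :: "real^'n"
  proof -
    have "mollifier e (X - Y) = mollifier e (Y - X)" for X
      by (simp add: mollifier_def norm_minus_commute)
    then show ?thesis
      using m[of Y] by simp
  qed
  have "ennreal ((norm (conv f (cmollifier e) X))\<^sup>2)
      \<le> (\<integral>\<^sup>+Y. ennreal ((norm (f Y))\<^sup>2 * mollifier e (X - Y)) \<partial>lborel)" for X
  proof -
    let ?F = "\<lambda>Y. ennreal (norm (f Y) * sqrt (mollifier e (X - Y)))"
    let ?G = "\<lambda>Y. ennreal (sqrt (mollifier e (X - Y)))"
    have "ennreal (norm (conv f (cmollifier e) X))
        \<le> (\<integral>\<^sup>+Y. ennreal (norm (f Y * cmollifier e (X - Y))) \<partial>lborel)"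
      unfolding conv_def by (rule integral_norm_bound_ennreal[OF integrable_mult_mollifier[OF f e]])
    also have "\<dots> = (\<integral>\<^sup>+Y. ?F Y * ?G Y \<partial>lborel)"
      by (intro nn_integral_cong)
        (simp add: norm_mult mollifier_nonneg ennreal_mult'[symmetric] mult.assoc)
    finally have "(ennreal (norm (conv f (cmollifier e) X)))\<^sup>2 \<le> (\<integral>\<^sup>+Y. ?F Y * ?G Y \<partial>lborel)\<^sup>2"
      by (rule power_mono) simp
    also have "\<dots> \<le> (\<integral>\<^sup>+Y. (?F Y)\<^sup>2 \<partial>lborel) * (\<integral>\<^sup>+Y. (?G Y)\<^sup>2 \<partial>lborel)"
      by (rule Cauchy_Schwarz_nn_integral) measurable
    also have "(\<lambda>Y. (?F Y)\<^sup>2) = (\<lambda>Y. ennreal ((norm (f Y))\<^sup>2 * mollifier e (X - Y)))"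
      by (simp add: ennreal_power mollifier_nonneg power_mult_distrib)
    also have "(\<lambda>Y. (?G Y)\<^sup>2) = (\<lambda>Y. ennreal (mollifier e (X - Y)))"
      by (simp add: ennreal_power mollifier_nonneg)
    finally show ?thesis
      by (simp add: m ennreal_power)
  qed
  then have "(\<integral>\<^sup>+X. ennreal ((norm (conv f (cmollifier e) X))\<^sup>2) \<partial>lborel)
      \<le> (\<integral>\<^sup>+X. (\<integral>\<^sup>+Y. ennreal ((norm (f Y))\<^sup>2 * mollifier e (X - Y)) \<partial>lborel) \<partial>lborel)"
    by (intro nn_integral_mono)
  also have "\<dots> = (\<integral>\<^sup>+Y. (\<integral>\<^sup>+X. ennreal ((norm (f Y))\<^sup>2 * mollifier e (X - Y)) \<partial>lborel) \<partial>lborel)"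
    by (rule lborel_pair.Fubini'[symmetric]) measurable
  also have "\<dots> = (\<integral>\<^sup>+Y. ennreal ((norm (f Y))\<^sup>2) \<partial>lborel)"
    by (simp add: ennreal_mult' nn_integral_cmult m')
  finally show ?thesis .
qed

lemma conv_zero_outside:
  assumes f: "\<And>X. X \<notin> cball x B \<Longrightarrow> f X = 0" and g: "\<And>X. X \<notin> cball 0 e \<Longrightarrow> g X = 0"
    and X: "X \<notin> cball x (B + e)"
  shows "conv f g X = 0"
proof -
  have "f Y * g (X - Y) = 0" for Y
  proof (cases "Y \<in> cball x B")
    case True
    have "dist x X \<le> dist x Y + norm (X - Y)"
      by (metis dist_commute dist_norm dist_triangle)
    with True X have "X - Y \<notin> cball 0 e"
      by auto
    with g show ?thesis
      by simp
  qed (simp add: f)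
  then have "(\<lambda>Y. f Y * g (X - Y)) = (\<lambda>Y. 0)"
    by blast
  then show ?thesis
    by (simp add: conv_def)
qed

lemma conv_mollifier_uniform:
  fixes f :: "real^'n \<Rightarrow> complex"
  assumes f: "continuous_on UNIV f" and zero: "\<And>X. X \<notin> cball 0 B \<Longrightarrow> f X = 0" and "0 < \<epsilon>"
  obtains \<delta> where "0 < \<delta>"
    "\<And>e X. 0 < e \<Longrightarrow> e < \<delta> \<Longrightarrow> norm (conv f (cmollifier e) X - f X) \<le> \<epsilon>"
proof -
  obtain \<delta> where \<delta>: "0 < \<delta>" "\<And>X Y. dist X Y < \<delta> \<Longrightarrow> dist (f X) (f Y) < \<epsilon>"
    using uniformly_continuous_compact_support[OF f zero \<open>0 < \<epsilon>\<close>] by blast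
  obtain C where C: "\<And>X. norm (f X) \<le> C"
    using bounded_compact_support[OF f zero] by blast
  have "norm (conv f (cmollifier e) X - f X) \<le> \<epsilon>" if e: "0 < e" "e < \<delta>" for e X
  proof -
    have mi: "integrable lborel (cmollifier e :: real^'n \<Rightarrow> complex)"
      by (rule integrable_cmollifier[OF e(1)])
    have int: "integrable lborel (\<lambda>Y. cmollifier e Y * f (X - Y))"
      by (rule integrable_mult_bounded_continuous[OF mi f C])
    have int2: "integrable lborel (\<lambda>Y :: real^'n. cmollifier e Y * f X)"
      using mi by (intro integrable_mult_left)
    have "conv f (cmollifier e) X = conv (cmollifier e) f X"
      using f by (subst conv_commute) (auto intro: borel_measurable_continuous_onI)
    moreover have "f X = (\<integral>Y. cmollifier e (Y :: real^'n) * f X \<partial>lborel)"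
      using integral_mollifier[OF e(1), where 'n = 'n] by simp
    ultimately have "conv f (cmollifier e) X - f X =
        (\<integral>Y. cmollifier e Y * f (X - Y) - cmollifier e Y * f X \<partial>lborel)"
      by (simp only: conv_def Bochner_Integration.integral_diff[OF int int2])
    also have "norm \<dots> \<le> (\<integral>Y. mollifier e (Y :: real^'n) * \<epsilon> \<partial>lborel)"
    proof (rule Bochner_Integration.integral_norm_bound_integral)
      show "norm (cmollifier e Y * f (X - Y) - cmollifier e Y * f X) \<le> mollifier e Y * \<epsilon>" for Y
      proof (cases "Y \<in> cball 0 e")
        case True
        then have "dist (f (X - Y)) (f X) < \<epsilon>"
          using e by (intro \<delta>(2)) (auto simp: dist_norm)
        then have "mollifier e Y * norm (f (X - Y) - f X) \<le> mollifier e Y * \<epsilon>"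
          by (intro mult_left_mono mollifier_nonneg) (auto simp: dist_norm)
        then show ?thesis
          by (simp add: right_diff_distrib[symmetric] norm_mult mollifier_nonneg)
      next
        case False
        then show ?thesis
          using mollifier_zero[OF e(1) False] by simp
      qed
    qed (use int int2 integrable_mollifier[OF e(1)] in auto)
    also have "\<dots> = \<epsilon>"
      using integral_mollifier[OF e(1), where 'n = 'n] by simp
    finally show ?thesis .
  qed
  with \<delta>(1) show ?thesis
    by (intro that)
qed

lemma norm_add_power2_le: "(norm (a + b))\<^sup>2 \<le> 2 * (norm a)\<^sup>2 + 2 * (norm (b :: 'a::real_normed_vector))\<^sup>2"
proof -
  have "(norm (a + b))\<^sup>2 \<le> (norm a + norm b)\<^sup>2"
    by (intro power_mono norm_triangle_ineq) simp
  also have "\<dots> \<le> 2 * (norm a)\<^sup>2 + 2 * (norm b)\<^sup>2"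
    using sum_squares_bound[of "norm a" "norm b"] by (simp add: power2_sum)
  finally show ?thesis .
qed

lemma nn_integral_power2_add_le:
  fixes f g :: "'a \<Rightarrow> complex"
  assumes [measurable]: "f \<in> borel_measurable M" "g \<in> borel_measurable M"
    and f: "(\<integral>\<^sup>+X. ennreal ((norm (f X))\<^sup>2) \<partial>M) \<le> ennreal a"
    and g: "(\<integral>\<^sup>+X. ennreal ((norm (g X))\<^sup>2) \<partial>M) \<le> ennreal b"
    and "0 \<le> a" "0 \<le> b"
  shows "(\<integral>\<^sup>+X. ennreal ((norm (f X + g X))\<^sup>2) \<partial>M) \<le> ennreal (2 * a + 2 * b)"
proof -
  have "(\<integral>\<^sup>+X. ennreal ((norm (f X + g X))\<^sup>2) \<partial>M)
      \<le> (\<integral>\<^sup>+X. 2 * ennreal ((norm (f X))\<^sup>2) + 2 * ennreal ((norm (g X))\<^sup>2) \<partial>M)"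
    by (intro nn_integral_mono)
      (simp add: norm_add_power2_le ennreal_leI flip: ennreal_plus ennreal_mult' ennreal_numeral)
  also have "\<dots> = 2 * (\<integral>\<^sup>+X. ennreal ((norm (f X))\<^sup>2) \<partial>M) + 2 * (\<integral>\<^sup>+X. ennreal ((norm (g X))\<^sup>2) \<partial>M)"
    by (simp add: nn_integral_add nn_integral_cmult)
  also have "\<dots> \<le> 2 * ennreal a + 2 * ennreal b"
    using f g by (intro add_mono mult_left_mono) auto
  also have "\<dots> = ennreal (2 * a + 2 * b)"
    using assms(5,6) by (simp add: ennreal_mult')
  finally show ?thesis .
qed

lemma integrable_square_bounded_support:
  fixes f :: "real^'n \<Rightarrow> complex"
  assumes [measurable]: "f \<in> borel_measurable borel"
    and f: "integrable lborel (\<lambda>X. (norm (f X))\<^sup>2)" and zero: "\<And>X. X \<notin> cball x B \<Longrightarrow> f X = 0"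
  shows "integrable lborel f"
proof (rule Bochner_Integration.integrable_bound)
  have "emeasure lborel (cball x B) < \<infinity>"
    by (intro emeasure_compact_finite) auto
  then show "integrable lborel (\<lambda>X. indicator (cball x B) X + (norm (f X))\<^sup>2 :: real)"
    using f by (intro Bochner_Integration.integrable_add integrable_real_indicator) auto
  show "f \<in> borel_measurable lborel"
    by simp
  show "AE X in lborel. norm (f X) \<le> norm (indicator (cball x B) X + (norm (f X))\<^sup>2 :: real)"
  proof (intro AE_I2)
    fix X
    have "2 * norm (f X) \<le> 1 + (norm (f X))\<^sup>2"
      using sum_squares_bound[of 1 "norm (f X)"] by simp
    then have "norm (f X) \<le> 1 + (norm (f X))\<^sup>2"
      using norm_ge_zero[of "f X"] by linarith
    with zero[of X] show "norm (f X) \<le> norm (indicator (cball x B) X + (norm (f X))\<^sup>2 :: real)"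
      by (cases "X \<in> cball x B") (auto simp del: mem_cball)
  qed
qed

text \<open>Two dominated limits. Truncating the values makes \<open>f\<close> bounded; then the
  truncation is composed with continuous functions that converge to \<open>f\<close> almost
  everywhere, and a cutoff keeps the support in a fixed ball, so constants serve as
  majorant.\<close>

lemma L2_continuous_approximation:
  fixes f :: "real^'n \<Rightarrow> complex"
  assumes f [measurable]: "f \<in> borel_measurable borel"
    and int: "integrable lborel (\<lambda>X. (norm (f X))\<^sup>2)" and zero: "\<And>X. X \<notin> cball x B \<Longrightarrow> f X = 0"
    and "0 < \<epsilon>"
  obtains g where "continuous_on UNIV g" "\<And>X. X \<notin> cball x (B + 1) \<Longrightarrow> g X = 0"
    "(\<integral>\<^sup>+X. ennreal ((norm (f X - g X))\<^sup>2) \<partial>lborel) \<le> ennreal \<epsilon>"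
proof -
  \<comment> \<open>A continuous substitute for truncation at height \<open>n + 1\<close>: its
    values are bounded by that height, it moves \<open>z\<close> by at most \<open>norm z\<close>,
    and it tends to \<open>z\<close>.\<close>
  define T where "T n z = (real (Suc n) / (real (Suc n) + norm z)) *\<^sub>R z" for n and z :: complex
  define cut where "cut X = max 0 (min 1 (B + 1 - dist x X))" for X
  have den: "real (Suc n) + norm z \<noteq> 0" for n and z :: complex
    by (metis add_pos_nonneg norm_ge_zero of_nat_0_less_iff order_less_irrefl zero_less_Suc)
  have T_cont: "continuous_on UNIV (T n)" for n
    unfolding T_def using den by (intro continuous_intros) auto
  have T_le: "norm (T n z) \<le> real (Suc n)" for n z
    by (simp add: T_def field_simps add_pos_nonneg)
  have T_0: "T n 0 = 0" for n
    by (simp add: T_def)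
  have T_meas [measurable]: "T n \<in> borel_measurable borel" for n
    by (rule borel_measurable_continuous_onI[OF T_cont])
  have T_diff: "norm (z - T n z) = (norm z)\<^sup>2 / (real (Suc n) + norm z)" for n z
  proof -
    have "z - T n z = (1 - real (Suc n) / (real (Suc n) + norm z)) *\<^sub>R z"
      by (simp add: T_def scaleR_diff_left)
    also have "1 - real (Suc n) / (real (Suc n) + norm z) = norm z / (real (Suc n) + norm z)"
      using den[of n z] by (simp add: diff_divide_eq_iff del: of_nat_Suc)
    finally show ?thesis
      by (simp add: power2_eq_square del: of_nat_Suc)
  qed
  have T_diff_le: "norm (z - T n z) \<le> norm z" for n z
    unfolding T_diff by (simp add: power2_eq_square divide_le_eq add_pos_nonneg mult_left_mono)
  have T_lim: "(\<lambda>n. (norm (z - T n z))\<^sup>2) \<longlonglongrightarrow> 0" for z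
  proof -
    have "(\<lambda>n. (norm z)\<^sup>2 / (real (Suc n) + norm z)) \<longlonglongrightarrow> 0"
      by real_asymp
    then show ?thesis
      unfolding T_diff using tendsto_power[of _ 0 _ 2] by fastforce
  qed
  have "(\<lambda>n. \<integral>\<^sup>+X. ennreal ((norm (f X - T n (f X)))\<^sup>2) \<partial>lborel) \<longlonglongrightarrow> (\<integral>\<^sup>+X. 0 \<partial>(lborel :: (real^'n) measure))"
  proof (rule nn_integral_dominated_convergence[where w = "\<lambda>X. ennreal ((norm (f X))\<^sup>2)"])
    show "(\<integral>\<^sup>+X. ennreal ((norm (f X))\<^sup>2) \<partial>lborel) < \<infinity>"
      using int by (simp add: nn_integral_eq_integral)
    show "AE X in lborel. ennreal ((norm (f X - T n (f X)))\<^sup>2) \<le> ennreal ((norm (f X))\<^sup>2)" for n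
      by (intro AE_I2 ennreal_leI power_mono T_diff_le) simp
    show "AE X in lborel. (\<lambda>n. ennreal ((norm (f X - T n (f X)))\<^sup>2)) \<longlonglongrightarrow> 0"
      using tendsto_ennrealI[OF T_lim] by simp
  qed measurable
  \<comment> \<open>Both errors are taken at \<open>\<epsilon> / 4\<close>, since squaring a sum
    costs a factor 2 on each:
    \<open>2 * (\<epsilon> / 4) + 2 * (\<epsilon> / 4) = \<epsilon>\<close>.\<close>
  then have "eventually (\<lambda>n. (\<integral>\<^sup>+X. ennreal ((norm (f X - T n (f X)))\<^sup>2) \<partial>lborel) < ennreal (\<epsilon> / 4)) sequentially"
    using \<open>0 < \<epsilon>\<close> by (intro order_tendstoD(2)[where y = 0]) auto
  then obtain n where n: "(\<integral>\<^sup>+X. ennreal ((norm (f X - T n (f X)))\<^sup>2) \<partial>lborel) < ennreal (\<epsilon> / 4)"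
    by (auto simp: eventually_sequentially)
  have "f measurable_on UNIV"
    using f by (intro lebesgue_measurable_imp_measurable_on) (auto intro: measurable_completion)
  then obtain N h where N: "negligible N" and h: "\<And>m. continuous_on UNIV (h m)"
    and lim: "\<And>X. X \<notin> N \<Longrightarrow> (\<lambda>m. h m X) \<longlonglongrightarrow> f X"
    unfolding measurable_on_def by auto
  define g where "g m X = cut X *\<^sub>R T n (h m X)" for m X
  have g_cont: "continuous_on UNIV (g m)" for m
    unfolding g_def cut_def by (intro continuous_intros continuous_on_compose2[OF T_cont h]) auto
  then have [measurable]: "g m \<in> borel_measurable borel" for m
    by (rule borel_measurable_continuous_onI)
  have g_zero: "g m X = 0" if "X \<notin> cball x (B + 1)" for m X
    using that by (simp add: g_def cut_def)
  have cut_le: "0 \<le> cut X" "cut X \<le> 1" for X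
    by (auto simp: cut_def)
  have [measurable]: "cball x (B + 1) \<in> sets borel"
    by (rule borel_closed) simp
  have "(\<lambda>m. \<integral>\<^sup>+X. ennreal ((norm (T n (f X) - g m X))\<^sup>2) \<partial>lborel) \<longlonglongrightarrow> (\<integral>\<^sup>+X. 0 \<partial>(lborel :: (real^'n) measure))"
  proof (rule nn_integral_dominated_convergence[where
        w = "\<lambda>X. ennreal ((2 * real (Suc n))\<^sup>2) * indicator (cball x (B + 1)) X"])
    have "emeasure lborel (cball x (B + 1)) < \<infinity>"
      by (intro emeasure_compact_finite) auto
    then show "(\<integral>\<^sup>+X. ennreal ((2 * real (Suc n))\<^sup>2) * indicator (cball x (B + 1)) X \<partial>lborel) < \<infinity>"
      by (subst nn_integral_cmult_indicator) (simp_all add: ennreal_mult_less_top)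
    show "AE X in lborel. ennreal ((norm (T n (f X) - g m X))\<^sup>2)
        \<le> ennreal ((2 * real (Suc n))\<^sup>2) * indicator (cball x (B + 1)) X" for m
    proof (intro AE_I2)
      fix X
      have "norm (g m X) \<le> 1 * real (Suc n)"
        unfolding g_def norm_scaleR using T_le cut_le by (intro mult_mono) auto
      then have "norm (T n (f X) - g m X) \<le> 2 * real (Suc n)"
        using norm_triangle_ineq4[of "T n (f X)" "g m X"] T_le[of n "f X"] by simp
      then have "(norm (T n (f X) - g m X))\<^sup>2 \<le> (2 * real (Suc n))\<^sup>2"
        by (intro power_mono) auto
      moreover have "T n (f X) - g m X = 0" if "X \<notin> cball x (B + 1)"
        using that zero[of X] g_zero[of X] by (simp add: T_0)
      ultimately show "ennreal ((norm (T n (f X) - g m X))\<^sup>2)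
          \<le> ennreal ((2 * real (Suc n))\<^sup>2) * indicator (cball x (B + 1)) X"
        by (cases "X \<in> cball x (B + 1)") (auto simp: ennreal_leI simp del: mem_cball)
    qed
    have "AE X in lborel. X \<notin> N"
      using AE_not_in[of N lebesgue] N
      by (simp only: negligible_iff_null_sets AE_completion_iff)
    then show "AE X in lborel. (\<lambda>m. ennreal ((norm (T n (f X) - g m X))\<^sup>2)) \<longlonglongrightarrow> 0"
    proof eventually_elim
      case (elim X)
      have "isCont (T n) (f X)"
        using T_cont by (simp add: continuous_on_eq_continuous_at)
      from isCont_tendsto_compose[OF this lim[OF elim]]
      have "(\<lambda>m. g m X) \<longlonglongrightarrow> cut X *\<^sub>R T n (f X)"
        unfolding g_def by (intro tendsto_intros)
      also have "cut X *\<^sub>R T n (f X) = T n (f X)"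
        using zero[of X] by (cases "X \<in> cball x B") (auto simp: T_0 cut_def)
      finally have "(\<lambda>m. (norm (T n (f X) - g m X))\<^sup>2) \<longlonglongrightarrow> (norm (T n (f X) - T n (f X)))\<^sup>2"
        by (intro tendsto_intros)
      then have "(\<lambda>m. (norm (T n (f X) - g m X))\<^sup>2) \<longlonglongrightarrow> 0"
        by simp
      from tendsto_ennrealI[OF this] show ?case
        by simp
    qed
  qed measurable
  then have "eventually (\<lambda>m. (\<integral>\<^sup>+X. ennreal ((norm (T n (f X) - g m X))\<^sup>2) \<partial>lborel) < ennreal (\<epsilon> / 4)) sequentially"
    using \<open>0 < \<epsilon>\<close> by (intro order_tendstoD(2)[where y = 0]) auto
  then obtain m where m: "(\<integral>\<^sup>+X. ennreal ((norm (T n (f X) - g m X))\<^sup>2) \<partial>lborel) < ennreal (\<epsilon> / 4)"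
    by (auto simp: eventually_sequentially)
  have "(\<integral>\<^sup>+X. ennreal ((norm ((f X - T n (f X)) + (T n (f X) - g m X)))\<^sup>2) \<partial>lborel)
      \<le> ennreal (2 * (\<epsilon> / 4) + 2 * (\<epsilon> / 4))"
    using n m \<open>0 < \<epsilon>\<close> by (intro nn_integral_power2_add_le) auto
  then have "(\<integral>\<^sup>+X. ennreal ((norm (f X - g m X))\<^sup>2) \<partial>lborel) \<le> ennreal \<epsilon>"
    by simp
  then show ?thesis
    using that g_cont g_zero by blast
qed

text \<open>Density argument: for a continuous \<open>g\<close> close to \<open>f\<close>
  convergence is uniform on a bounded set, and the error \<open>f - g\<close> is not enlarged by
  mollification.\<close>

lemma conv_mollifier_L2:
  fixes f :: "real^'n \<Rightarrow> complex"
  assumes f [measurable]: "f \<in> borel_measurable borel"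
    and int: "integrable lborel (\<lambda>X. (norm (f X))\<^sup>2)" and zero: "\<And>X. X \<notin> cball 0 B \<Longrightarrow> f X = 0"
    and "0 < \<epsilon>"
  shows "eventually (\<lambda>e. (\<integral>\<^sup>+X. ennreal ((norm (conv f (cmollifier e) X - f X))\<^sup>2) \<partial>lborel) \<le> ennreal \<epsilon>)
    (at_right 0)"
proof -
  \<comment> \<open>Three errors are added with a factor 2 at each addition, which gives
    \<open>10 / 16\<close> of \<epsilon>.\<close>
  have e16: "0 < \<epsilon> / 16"
    using \<open>0 < \<epsilon>\<close> by simp
  obtain g where g: "continuous_on UNIV g" and gz: "\<And>X. X \<notin> cball 0 (B + 1) \<Longrightarrow> g X = 0"
    and fg: "(\<integral>\<^sup>+X. ennreal ((norm (f X - g X))\<^sup>2) \<partial>lborel) \<le> ennreal (\<epsilon> / 16)"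
    using L2_continuous_approximation[OF f int zero e16] by blast
  have [measurable]: "g \<in> borel_measurable borel"
    using g by (rule borel_measurable_continuous_onI)
  have fi: "integrable lborel f"
    by (rule integrable_square_bounded_support[OF f int zero])
  have gi: "integrable lborel g"
    by (rule integrable_compact_support[OF g gz])
  have "emeasure lborel (cball (0 :: real^'n) (B + 2)) < \<infinity>"
    by (intro emeasure_compact_finite) auto
  then obtain V where V: "0 \<le> V" "emeasure lborel (cball (0 :: real^'n) (B + 2)) = ennreal V"
    by (metis ennreal_cases infinity_ennreal_def less_irrefl)
  \<comment> \<open>\<open>V\<close> is the volume of the ball that contains the supports of
    \<open>g\<close> and of its mollifications with \<open>e < 1\<close>; a uniform error \<eta>
    then contributes at most \<open>\<epsilon> / 16\<close>.\<close>
  define \<eta> where "\<eta> = sqrt (\<epsilon> / (16 * (V + 1)))"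
  have \<eta>: "0 < \<eta>" "\<eta>\<^sup>2 * V \<le> \<epsilon> / 16"
    using V(1) \<open>0 < \<epsilon>\<close> by (auto simp: \<eta>_def field_simps)
  obtain \<delta> where \<delta>: "0 < \<delta>"
    "\<And>e X. 0 < e \<Longrightarrow> e < \<delta> \<Longrightarrow> norm (conv g (cmollifier e) X - g X) \<le> \<eta>"
    using conv_mollifier_uniform[OF g gz \<eta>(1)] by blast
  have main: "(\<integral>\<^sup>+X. ennreal ((norm (conv f (cmollifier e) X - f X))\<^sup>2) \<partial>lborel) \<le> ennreal \<epsilon>"
    if e: "0 < e" "e < min 1 \<delta>" for e
  proof -
    have cont: "continuous_on UNIV (conv h (cmollifier e))"
      if "integrable lborel h" for h :: "real^'n \<Rightarrow> complex"
      using that mollifier_zero[OF e(1)]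
      by (intro continuous_conv[OF _ continuous_cmollifier, of _ e]) (auto simp del: mem_cball)
    have [measurable]: "conv f (cmollifier e) \<in> borel_measurable borel"
      "conv g (cmollifier e) \<in> borel_measurable borel"
      "conv (\<lambda>X. f X - g X) (cmollifier e) \<in> borel_measurable borel"
      using cont fi gi by (auto intro!: borel_measurable_continuous_onI)
    have 1: "(\<integral>\<^sup>+X. ennreal ((norm (conv (\<lambda>X. f X - g X) (cmollifier e) X))\<^sup>2) \<partial>lborel) \<le> ennreal (\<epsilon> / 16)"
      using nn_integral_conv_mollifier_le[OF _ e(1), of "\<lambda>X. f X - g X"] fi gi fg by auto
    have "(\<integral>\<^sup>+X. ennreal ((norm (conv g (cmollifier e) X - g X))\<^sup>2) \<partial>lborel)
        \<le> (\<integral>\<^sup>+X. ennreal (\<eta>\<^sup>2) * indicator (cball (0 :: real^'n) (B + 2)) X \<partial>lborel)"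
    proof (intro nn_integral_mono)
      fix X :: "real^'n"
      have "(norm (conv g (cmollifier e) X - g X))\<^sup>2 \<le> \<eta>\<^sup>2"
        using \<delta>(2)[OF e(1)] e(2) by (intro power_mono) auto
      moreover have "conv g (cmollifier e) X - g X = 0" if "X \<notin> cball 0 (B + 2)"
      proof -
        have "conv g (cmollifier e) X = 0"
          using gz mollifier_zero[OF e(1)] that e
          by (intro conv_zero_outside[of 0 "B + 1" g e]) (auto simp del: mem_cball simp: subset_cball)
        moreover have "g X = 0"
          using that by (intro gz) auto
        ultimately show ?thesis
          by simp
      qed
      ultimately show "ennreal ((norm (conv g (cmollifier e) X - g X))\<^sup>2)
          \<le> ennreal (\<eta>\<^sup>2) * indicator (cball 0 (B + 2)) X"
        by (cases "X \<in> cball 0 (B + 2)") (auto simp: ennreal_leI simp del: mem_cball)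
    qed
    also have "\<dots> = ennreal (\<eta>\<^sup>2 * V)"
      by (subst nn_integral_cmult_indicator) (simp_all add: V ennreal_mult')
    also have "\<dots> \<le> ennreal (\<epsilon> / 16)"
      using \<eta>(2) by (rule ennreal_leI)
    finally have 2: "(\<integral>\<^sup>+X. ennreal ((norm (conv g (cmollifier e) X - g X))\<^sup>2) \<partial>lborel) \<le> ennreal (\<epsilon> / 16)" .
    have 3: "(\<integral>\<^sup>+X. ennreal ((norm (g X - f X))\<^sup>2) \<partial>lborel) \<le> ennreal (\<epsilon> / 16)"
      using fg by (simp add: norm_minus_commute)
    have "(\<integral>\<^sup>+X. ennreal ((norm ((conv (\<lambda>X. f X - g X) (cmollifier e) X + (conv g (cmollifier e) X - g X))
        + (g X - f X)))\<^sup>2) \<partial>lborel) \<le> ennreal (2 * (2 * (\<epsilon> / 16) + 2 * (\<epsilon> / 16)) + 2 * (\<epsilon> / 16))"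
      using \<open>0 < \<epsilon>\<close> 1 2 3 by (intro nn_integral_power2_add_le) auto
    also have "\<dots> \<le> ennreal \<epsilon>"
      using \<open>0 < \<epsilon>\<close> by (intro ennreal_leI) auto
    also have "(\<lambda>X. conv (\<lambda>X. f X - g X) (cmollifier e) X + (conv g (cmollifier e) X - g X) + (g X - f X))
        = (\<lambda>X. conv f (cmollifier e) X - f X)"
      by (simp add: conv_def left_diff_distrib integrable_mult_mollifier[OF fi e(1)]
          integrable_mult_mollifier[OF gi e(1)])
    finally show ?thesis .
  qed
  show ?thesis
    unfolding eventually_at_right_field using main \<delta>(1) by (intro exI[of _ "min 1 \<delta>"]) auto
qed

text \<open>Choosing \<open>e k\<close> with summable squared \<open>L\<^sup>2\<close> errors gives almost everywhere convergence together with an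
  integrable bound, so that all later limits are dominated convergence.\<close>

lemma mollifier_sequence:
  fixes g :: "'i \<Rightarrow> real^'n \<Rightarrow> complex"
  assumes I: "finite I" and g [measurable]: "\<And>i. i \<in> I \<Longrightarrow> g i \<in> borel_measurable borel"
    and int: "\<And>i. i \<in> I \<Longrightarrow> integrable lborel (\<lambda>X. (norm (g i X))\<^sup>2)"
    and zero: "\<And>i X. i \<in> I \<Longrightarrow> X \<notin> cball 0 B \<Longrightarrow> g i X = 0" and "0 < \<delta>"
  obtains e W where "\<And>k. 0 < e k" "\<And>k :: nat. e k < \<delta>" "integrable lborel W"
    "AE X in lborel. \<forall>i\<in>I. (\<lambda>k. conv (g i) (cmollifier (e k)) X) \<longlonglongrightarrow> g i X"
    "AE X in lborel. \<forall>i\<in>I. \<forall>k. (norm (conv (g i) (cmollifier (e k)) X))\<^sup>2 \<le> W X"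
proof -
  have gi: "integrable lborel (g i)" if "i \<in> I" for i
    by (rule integrable_square_bounded_support[OF g[OF that] int[OF that] zero[OF that]])
  \<comment> \<open>Finiteness of \<open>I\<close> allows one radius to serve all functions. This
    matters because a function and its partial derivatives must be mollified with the same
    kernel.\<close>
  have "\<exists>e. 0 < e \<and> e < \<delta> \<and> (\<forall>i\<in>I. (\<integral>\<^sup>+X. ennreal ((norm (conv (g i) (cmollifier e) X - g i X))\<^sup>2) \<partial>lborel)
      \<le> ennreal ((1 / 2) ^ k))" for k :: nat
  proof -
    have "eventually (\<lambda>e. \<forall>i\<in>I. (\<integral>\<^sup>+X. ennreal ((norm (conv (g i) (cmollifier e) X - g i X))\<^sup>2) \<partial>lborel)
        \<le> ennreal ((1 / 2) ^ k)) (at_right 0)"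
      using I by (intro eventually_ball_finite ballI conv_mollifier_L2[OF g int zero]) auto
    moreover have "eventually (\<lambda>e. 0 < e \<and> e < \<delta>) (at_right (0 :: real))"
      using \<open>0 < \<delta>\<close> by (auto simp: eventually_at_right_field)
    ultimately have "eventually (\<lambda>e. (\<forall>i\<in>I. (\<integral>\<^sup>+X. ennreal ((norm (conv (g i) (cmollifier e) X - g i X))\<^sup>2) \<partial>lborel)
        \<le> ennreal ((1 / 2) ^ k)) \<and> 0 < e \<and> e < \<delta>) (at_right 0)"
      by (rule eventually_conj)
    from eventually_happens'[OF trivial_limit_at_right_real this] show ?thesis
      by blast
  qed
  then have "\<exists>e. \<forall>k :: nat. 0 < e k \<and> e k < \<delta> \<and>
      (\<forall>i\<in>I. (\<integral>\<^sup>+X. ennreal ((norm (conv (g i) (cmollifier (e k)) X - g i X))\<^sup>2) \<partial>lborel)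
        \<le> ennreal ((1 / 2) ^ k))"
    by (intro choice allI)
  then obtain e where e: "\<And>k. 0 < e k" "\<And>k. e k < \<delta>"
    and eL2: "\<And>k i. i \<in> I \<Longrightarrow> (\<integral>\<^sup>+X. ennreal ((norm (conv (g i) (cmollifier (e k)) X - g i X))\<^sup>2) \<partial>lborel)
      \<le> ennreal ((1 / 2) ^ k)"
    by blast
  have [measurable]: "conv (g i) (cmollifier (e k)) \<in> borel_measurable borel" if "i \<in> I" for i k
    using gi[OF that] mollifier_zero[OF e(1)]
    by (intro borel_measurable_continuous_onI continuous_conv[OF _ continuous_cmollifier, of _ "e k"])
      (auto simp del: mem_cball)
  define d where "d i k X = (norm (conv (g i) (cmollifier (e k)) X - g i X))\<^sup>2" for i k X
  have d_nonneg: "0 \<le> d i k X" for i k X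
    by (simp add: d_def)
  have d_meas [measurable]: "d i k \<in> borel_measurable borel" if "i \<in> I" for i k
    using that unfolding d_def[abs_def] by measurable
  \<comment> \<open>The sum of all squared errors has finite integral. Where it is finite, the
    errors tend to 0 and each of them is at most \<open>S X\<close>; both conclusions rest on this
    one function.\<close>
  define S where "S X = (\<Sum>i\<in>I. \<Sum>k. ennreal (d i k X))" for X
  have S_meas [measurable]: "S \<in> borel_measurable borel"
    unfolding S_def[abs_def] by measurable
  have "(\<integral>\<^sup>+X. S X \<partial>lborel) = (\<Sum>i\<in>I. \<Sum>k. \<integral>\<^sup>+X. ennreal (d i k X) \<partial>lborel)"
    unfolding S_def by (subst nn_integral_sum) (auto intro!: sum.cong nn_integral_suminf)
  also have "\<dots> \<le> (\<Sum>i\<in>I. \<Sum>k. ennreal ((1 / 2) ^ k))"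
    using eL2 by (intro sum_mono suminf_le) (auto simp: d_def)
  also have "\<dots> = (\<Sum>i\<in>I. ennreal 2)"
    by (subst suminf_ennreal2) (auto simp: suminf_geometric)
  also have "\<dots> < \<infinity>"
    by (simp add: ennreal_mult_less_top of_nat_less_top)
  finally have S_fin: "(\<integral>\<^sup>+X. S X \<partial>lborel) < \<infinity>" .
  then have S_AE: "AE X in lborel. S X \<noteq> \<infinity>"
    by (intro nn_integral_PInf_AE) auto
  define W where "W X = 2 * (\<Sum>i\<in>I. (norm (g i X))\<^sup>2) + 2 * enn2real (S X)" for X
  have "integrable lborel (\<lambda>X. enn2real (S X))"
  proof (rule integrableI_nonneg)
    have "(\<integral>\<^sup>+X. ennreal (enn2real (S X)) \<partial>lborel) \<le> (\<integral>\<^sup>+X. S X \<partial>lborel)"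
      by (intro nn_integral_mono) (metis ennreal_enn2real_if le_zero_eq linear order_refl zero_le)
    with S_fin show "(\<integral>\<^sup>+X. ennreal (enn2real (S X)) \<partial>lborel) < \<infinity>"
      by (rule order.strict_trans1[rotated])
  qed auto
  then have "integrable lborel W"
    unfolding W_def[abs_def] using int by (intro Bochner_Integration.integrable_add integrable_mult_right
        Bochner_Integration.integrable_sum) auto
  moreover have "AE X in lborel. \<forall>i\<in>I. (\<lambda>k. conv (g i) (cmollifier (e k)) X) \<longlonglongrightarrow> g i X"
    using S_AE
  proof eventually_elim
    case (elim X)
    show ?case
    proof
      fix i
      assume "i \<in> I"
      have "(\<Sum>k. ennreal (d i k X)) \<le> S X"
        unfolding S_def using I \<open>i \<in> I\<close> by (intro member_le_sum) auto
      with elim have "(\<Sum>k. ennreal (d i k X)) \<noteq> top"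
        by (auto simp: top_unique)
      then have "(\<lambda>k. d i k X) \<longlonglongrightarrow> 0"
        by (intro summable_LIMSEQ_zero summable_suminf_not_top d_nonneg)
      then have "(\<lambda>k. sqrt (d i k X)) \<longlonglongrightarrow> sqrt 0"
        by (rule tendsto_real_sqrt)
      then have "(\<lambda>k. norm (conv (g i) (cmollifier (e k)) X - g i X)) \<longlonglongrightarrow> 0"
        by (simp add: d_def)
      then show "(\<lambda>k. conv (g i) (cmollifier (e k)) X) \<longlonglongrightarrow> g i X"
        by (simp add: tendsto_norm_zero_iff Lim_null[symmetric])
    qed
  qed
  moreover have "AE X in lborel. \<forall>i\<in>I. \<forall>k. (norm (conv (g i) (cmollifier (e k)) X))\<^sup>2 \<le> W X"
    using S_AE
  proof eventually_elim
    case (elim X)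
    show ?case
    proof (intro ballI allI)
      fix i k
      assume "i \<in> I"
      have "ennreal (d i k X) \<le> (\<Sum>k. ennreal (d i k X))"
        using sum_le_suminf[of "\<lambda>k. ennreal (d i k X)" "{k}"] by simp
      also have "\<dots> \<le> S X"
        unfolding S_def using I \<open>i \<in> I\<close> by (intro member_le_sum) auto
      finally have "d i k X \<le> enn2real (S X)"
        using elim d_nonneg[of i k X]
        by (metis enn2real_ennreal enn2real_mono infinity_ennreal_def top.not_eq_extremum)
      moreover have "(norm (g i X))\<^sup>2 \<le> (\<Sum>i\<in>I. (norm (g i X))\<^sup>2)"
        using I \<open>i \<in> I\<close> by (intro member_le_sum) auto
      moreover have "(norm (g i X + (conv (g i) (cmollifier (e k)) X - g i X)))\<^sup>2
          \<le> 2 * (norm (g i X))\<^sup>2 + 2 * d i k X"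
        unfolding d_def by (rule norm_add_power2_le)
      ultimately show "(norm (conv (g i) (cmollifier (e k)) X))\<^sup>2 \<le> W X"
        by (simp add: W_def)
    qed
  qed
  ultimately show ?thesis
    using that e by blast
qed

section \<open>Borel representatives\<close>

text \<open>Off a null set the function is a limit of continuous functions, and \<open>lim\<close>
  of a sequence of continuous functions is Borel everywhere. Needed because convolution and Tonelli
  are carried out over \<open>lborel\<close>, whereas the given functions are only Lebesgue
  measurable.\<close>

lemma lebesgue_measurable_borel_version:
  fixes f :: "'a::euclidean_space \<Rightarrow> 'b::euclidean_space"
  assumes "f \<in> borel_measurable lebesgue"
  obtains g where "g \<in> borel_measurable borel" "AE X in lebesgue. g X = f X"
proof -
  have "f measurable_on UNIV"
    using assms by (intro lebesgue_measurable_imp_measurable_on) auto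
  then obtain N h where N: "negligible N" and h: "\<And>m. continuous_on UNIV (h m)"
    and lim: "\<And>X. X \<notin> N \<Longrightarrow> (\<lambda>m. h m X) \<longlonglongrightarrow> f X"
    unfolding measurable_on_def by auto
  show ?thesis
  proof (rule that)
    show "(\<lambda>X. lim (\<lambda>m. h m X)) \<in> borel_measurable borel"
      using h by (intro borel_measurable_lim_metric borel_measurable_continuous_onI)
    have "AE X in lebesgue. X \<notin> N"
      using AE_not_in[of N lebesgue] N by (simp only: negligible_iff_null_sets)
    then show "AE X in lebesgue. lim (\<lambda>m. h m X) = f X"
      by (auto elim!: eventually_mono intro: limI lim)
  qed
qed

text \<open>Turns a locally square integrable function into one that is square integrable on the
  whole space with compact support, hence into one that can be convolved.\<close>

lemma borel_version_on_compact:
  fixes f :: "real^'n \<Rightarrow> complex"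
  assumes "open \<Omega>" and K: "compact K" "K \<subseteq> \<Omega>"
    and f: "f \<in> borel_measurable (lebesgue_on \<Omega>)"
    and int: "set_integrable lebesgue K (\<lambda>X. (norm (f X))\<^sup>2)"
  obtains g where "g \<in> borel_measurable borel" "AE X in lebesgue. X \<in> K \<longrightarrow> g X = f X"
    "\<And>X. X \<notin> K \<Longrightarrow> g X = 0" "integrable lborel (\<lambda>X. (norm (g X))\<^sup>2)"
proof -
  have "(\<lambda>X. indicator \<Omega> X *\<^sub>R f X) \<in> borel_measurable lebesgue"
    using f \<open>open \<Omega>\<close> by (subst (asm) borel_measurable_restrict_space_iff) auto
  then obtain h where h [measurable]: "h \<in> borel_measurable borel"
    and hf: "AE X in lebesgue. h X = indicator \<Omega> X *\<^sub>R f X"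
    using lebesgue_measurable_borel_version by blast
  have [measurable]: "K \<in> sets borel"
    using K(1) by (simp add: borel_compact)
  define g where "g X = indicator K X *\<^sub>R h X" for X
  have g [measurable]: "g \<in> borel_measurable borel"
    unfolding g_def[abs_def] by measurable
  have gf: "AE X in lebesgue. X \<in> K \<longrightarrow> g X = f X"
    using hf by eventually_elim (use K(2) in \<open>auto simp: g_def indicator_def\<close>)
  have "integrable lebesgue (\<lambda>X. (norm (g X))\<^sup>2)"
  proof (subst integrable_cong_AE)
    show "AE X in lebesgue. (norm (g X))\<^sup>2 = indicator K X *\<^sub>R (norm (f X))\<^sup>2"
      using gf by eventually_elim (auto simp: g_def indicator_def)
    show "integrable lebesgue (\<lambda>X. indicator K X *\<^sub>R (norm (f X))\<^sup>2)"
      using int by (simp add: set_integrable_def)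
    then show "(\<lambda>X. indicator K X *\<^sub>R (norm (f X))\<^sup>2) \<in> borel_measurable lebesgue"
      by (rule borel_measurable_integrable)
    show "(\<lambda>X. (norm (g X))\<^sup>2) \<in> borel_measurable lebesgue"
      by (intro measurable_completion) measurable
  qed
  then have int': "integrable lborel (\<lambda>X. (norm (g X))\<^sup>2)"
    by (subst (asm) integrable_completion) measurable
  show ?thesis
    by (rule that[OF g gf _ int']) (simp add: g_def)
qed

section \<open>Mollification of weak gradients\<close>

lemma has_derivative_translate:
  assumes "(f has_derivative D) (at (Y - c))"
  shows "((\<lambda>Y. f (Y - c)) has_derivative D) (at Y)"
proof -
  have "((\<lambda>Y. Y - c) has_derivative (\<lambda>h. h)) (at Y)"
    by (auto intro!: derivative_eq_intros)
  from has_derivative_compose[OF this assms] show ?thesis .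
qed

lemma C_times_translate: "C_times k f \<Longrightarrow> C_times k (\<lambda>Y. f (Y - c))"
proof (induction k arbitrary: f)
  case 0
  then have "continuous_on UNIV f"
    by simp
  then have "continuous_on UNIV (\<lambda>Y. f (Y - c))"
    by (rule continuous_on_compose2) (auto intro!: continuous_intros)
  then show ?case
    by simp
next
  case (Suc k)
  have "(f has_derivative frechet_derivative f (at X)) (at X)" for X
    using Suc.prems by (simp add: frechet_derivative_works[symmetric])
  then have D: "((\<lambda>Y. f (Y - c)) has_derivative frechet_derivative f (at (Y - c))) (at Y)" for Y
    by (intro has_derivative_translate)
  show ?case
  proof (rule C_times_SucI[OF D])
    fix i
    have "C_times k (\<lambda>Y. (\<lambda>X. gradient f X $ i) (Y - c))"
      using Suc.prems by (intro Suc.IH) simp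
    then show "C_times k (\<lambda>Y. frechet_derivative f (at (Y - c)) (axis i 1))"
      by (simp add: gradient_def)
  qed
qed

lemma gradient_reflect:
  assumes "f differentiable (at (X - Y))"
  shows "gradient (\<lambda>Y. f (X - Y)) Y $ i = - gradient f (X - Y) $ i"
proof -
  have "((\<lambda>Y. X - Y) has_derivative (\<lambda>h. - h)) (at Y)"
    by (auto intro!: derivative_eq_intros)
  from has_derivative_compose[OF this has_derivative_gradient[OF assms]]
  have "gradient (\<lambda>Y. f (X - Y)) Y $ i
      = (\<Sum>j\<in>UNIV. ((- axis i 1 :: real^'a) $ j) *\<^sub>R gradient f (X - Y) $ j)"
    by (rule gradient_nth)
  also have "\<dots> = (\<Sum>j\<in>UNIV. if j = i then - gradient f (X - Y) $ j else 0)"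
    by (intro sum.cong) (auto simp: axis_def)
  finally show ?thesis
    by simp
qed

text \<open>These test functions turn the definition of the weak gradient into a formula for the
  gradient of the mollified function at \<open>X\<close>.\<close>

lemma cmollifier_reflect_test_function:
  assumes "0 < e" "cball X e \<subseteq> \<Omega>"
  shows "(\<lambda>Y. cmollifier e (X - Y)) \<in> test_functions \<Omega>"
proof -
  have eq: "(\<lambda>Y. cmollifier e (X - Y)) = (\<lambda>Y. cmollifier e (Y - X))"
    by (simp add: mollifier_def norm_minus_commute)
  have "{Y. cmollifier e (X - Y) \<noteq> 0} \<subseteq> cball X e"
  proof clarify
    fix Y
    assume "cmollifier e (X - Y) \<noteq> 0"
    then show "Y \<in> cball X e"
      using mollifier_zero[OF assms(1), of "X - Y"] by (auto simp: dist_norm norm_minus_commute)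
  qed
  then have "closure {Y. cmollifier e (X - Y) \<noteq> 0} \<subseteq> cball X e"
    by (intro closure_minimal) auto
  moreover from this have "compact (closure {Y. cmollifier e (X - Y) \<noteq> 0})"
    using compact_Int_closed[OF compact_cball closed_closure, of X e]
    by (metis inf.absorb2)
  moreover have "C_times k (\<lambda>Y. cmollifier e (X - Y))" for k
    unfolding eq by (rule C_times_translate[OF C_times_cmollifier])
  ultimately show ?thesis
    using assms(2) by (auto simp: test_functions_def)
qed

text \<open>Converts integrals from the definitions, over \<Omega> and \<open>lebesgue\<close>, into
  integrals of Borel representatives over \<open>lborel\<close>. Only values on \<open>K\<close>
  enter, because both \<phi> and \<open>g\<close> vanish outside.\<close>

lemma set_integral_lborel_version:
  fixes f :: "real^'n \<Rightarrow> complex"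
  assumes "open \<Omega>" "K \<subseteq> \<Omega>"
    and f: "f \<in> borel_measurable (lebesgue_on \<Omega>)"
    and g [measurable]: "g \<in> borel_measurable borel" and gf: "AE X in lebesgue. X \<in> K \<longrightarrow> g X = f X"
    and gz: "\<And>X. X \<notin> K \<Longrightarrow> g X = 0"
    and \<phi> [measurable]: "\<phi> \<in> borel_measurable borel" and \<phi>z: "\<And>X. X \<notin> K \<Longrightarrow> \<phi> X = 0"
  shows "(LINT X:\<Omega>|lebesgue. f X * \<phi> X) = (\<integral>X. g X * \<phi> X \<partial>lborel)"
proof -
  have "(\<integral>X. g X * \<phi> X \<partial>lborel) = (\<integral>X. g X * \<phi> X \<partial>lebesgue)"
    by (rule integral_completion[symmetric]) measurable
  also have "\<dots> = (LINT X:\<Omega>|lebesgue. f X * \<phi> X)"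
    unfolding set_lebesgue_integral_def
  proof (rule Bochner_Integration.integral_cong_AE)
    show "(\<lambda>X. g X * \<phi> X) \<in> borel_measurable lebesgue"
      by (rule measurable_completion) measurable
    have "(\<lambda>X. indicator \<Omega> X *\<^sub>R f X) \<in> borel_measurable lebesgue"
      using f \<open>open \<Omega>\<close> by (subst (asm) borel_measurable_restrict_space_iff) auto
    moreover have "\<phi> \<in> borel_measurable lebesgue"
      by (rule measurable_completion) measurable
    ultimately have "(\<lambda>X. (indicator \<Omega> X *\<^sub>R f X) * \<phi> X) \<in> borel_measurable lebesgue"
      by (rule borel_measurable_times)
    then show "(\<lambda>X. indicator \<Omega> X *\<^sub>R (f X * \<phi> X)) \<in> borel_measurable lebesgue"
      by simp
    show "AE X in lebesgue. g X * \<phi> X = indicator \<Omega> X *\<^sub>R (f X * \<phi> X)"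
      using gf
    proof eventually_elim
      case (elim X)
      then show ?case
        using assms(2) gz[of X] \<phi>z[of X] by (cases "X \<in> K") (auto simp: indicator_def)
    qed
  qed
  finally show ?thesis
    by simp
qed

lemma borel_measurable_vec_lambda_complex:
  fixes f :: "'n::finite \<Rightarrow> 'a \<Rightarrow> complex"
  assumes "\<And>i. f i \<in> borel_measurable M"
  shows "(\<lambda>X. \<chi> i. f i X) \<in> borel_measurable M"
proof (rule borel_measurable_euclidean_space[THEN iffD2], intro ballI)
  fix b :: "complex^'n"
  have "(\<lambda>X. \<Sum>i\<in>UNIV. f i X \<bullet> b $ i) \<in> borel_measurable M"
    using assms by (intro borel_measurable_sum borel_measurable_inner) auto
  then show "(\<lambda>X. (\<chi> i. f i X) \<bullet> b) \<in> borel_measurable M"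
    by (simp add: inner_vec_def)
qed

lemma borel_measurable_vec_nth_complex:
  fixes F :: "'a \<Rightarrow> complex^'n"
  assumes "F \<in> borel_measurable M"
  shows "(\<lambda>X. F X $ i) \<in> borel_measurable M"
  by (rule borel_measurable_continuous_on[OF _ assms]) (intro continuous_intros)

lemma norm_vec_square: "(norm (v :: complex^'n))\<^sup>2 = (\<Sum>i\<in>UNIV. (norm (v $ i))\<^sup>2)"
  by (simp add: norm_vec_def L2_set_def sum_nonneg)

text \<open>The scalar statement is applied to each coordinate; the finitely many exceptional null
  sets are united.\<close>

lemma borel_version_component:
  fixes F :: "real^'n \<Rightarrow> complex^'n"
  assumes "open \<Omega>" "compact K" "K \<subseteq> \<Omega>"
    and Fm: "F \<in> borel_measurable (lebesgue_on \<Omega>)"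
    and Fi: "set_integrable lebesgue K (\<lambda>X. (norm (F X))\<^sup>2)"
  obtains F' where "F' \<in> borel_measurable borel" "AE X in lebesgue. X \<in> K \<longrightarrow> F' X = F X"
    "\<And>X. X \<notin> K \<Longrightarrow> F' X = 0" "integrable lborel (\<lambda>X. (norm (F' X))\<^sup>2)"
proof -
  have Fim: "(\<lambda>X. F X $ i) \<in> borel_measurable (lebesgue_on \<Omega>)" for i
    by (rule borel_measurable_vec_nth_complex[OF Fm])
  have K: "K \<in> sets lebesgue"
    using \<open>compact K\<close> by (simp add: borel_compact)
  have fi: "set_integrable lebesgue K (\<lambda>X. (norm (F X $ i))\<^sup>2)" for i
  proof -
    define f where "f X = indicator \<Omega> X *\<^sub>R (F X $ i)" for X
    have "f \<in> borel_measurable lebesgue"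
      unfolding f_def[abs_def]
      using Fim \<open>open \<Omega>\<close> by (subst (asm) borel_measurable_restrict_space_iff) auto
    then have "(\<lambda>X. indicator K X *\<^sub>R (norm (f X))\<^sup>2) \<in> borel_measurable lebesgue"
      using K by (intro borel_measurable_scaleR borel_measurable_power
          measurable_compose[OF _ borel_measurable_norm] borel_measurable_indicator)
    moreover have "(\<lambda>X. indicator K X *\<^sub>R (norm (f X))\<^sup>2)
        = (\<lambda>X. indicator K X *\<^sub>R (norm (F X $ i))\<^sup>2)"
      using \<open>K \<subseteq> \<Omega>\<close> by (auto simp: f_def indicator_def fun_eq_iff)
    ultimately have m: "(\<lambda>X. indicator K X *\<^sub>R (norm (F X $ i))\<^sup>2) \<in> borel_measurable lebesgue"
      by simp
    show ?thesis
      unfolding set_integrable_def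
      by (rule Bochner_Integration.integrable_bound[OF Fi[unfolded set_integrable_def] m])
        (auto intro!: AE_I2 mult_left_mono power_mono Finite_Cartesian_Product.norm_nth_le)
  qed
  have "\<exists>g. g \<in> borel_measurable borel \<and> (AE X in lebesgue. X \<in> K \<longrightarrow> g X = F X $ i) \<and>
    (\<forall>X. X \<notin> K \<longrightarrow> g X = 0) \<and> integrable lborel (\<lambda>X. (norm (g X))\<^sup>2)" for i
    by (rule borel_version_on_compact[OF assms(1-3) Fim fi]) blast
  then have "\<exists>g. \<forall>i. g i \<in> borel_measurable borel \<and> (AE X in lebesgue. X \<in> K \<longrightarrow> g i X = F X $ i) \<and>
    (\<forall>X. X \<notin> K \<longrightarrow> g i X = 0) \<and> integrable lborel (\<lambda>X. (norm (g i X))\<^sup>2)"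
    by (intro choice allI)
  then obtain g where g: "\<And>i. g i \<in> borel_measurable borel"
    and gf: "\<And>i. AE X in lebesgue. X \<in> K \<longrightarrow> g i X = F X $ i"
    and gz: "\<And>i X. X \<notin> K \<Longrightarrow> g i X = 0"
    and gL2: "\<And>i. integrable lborel (\<lambda>X. (norm (g i X))\<^sup>2)"
    by blast
  show ?thesis
  proof (rule that[of "\<lambda>X. \<chi> i. g i X"])

    show "(\<lambda>X. \<chi> i. g i X) \<in> borel_measurable borel"
      by (rule borel_measurable_vec_lambda_complex[OF g])
    have "AE X in lebesgue. \<forall>i. X \<in> K \<longrightarrow> g i X = F X $ i"
      using gf by (subst AE_all_countable) auto
    then show "AE X in lebesgue. X \<in> K \<longrightarrow> (\<chi> i. g i X) = F X"
      by eventually_elim (auto simp: vec_eq_iff)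
    show "(\<chi> i. g i X) = 0" if "X \<notin> K" for X
      using gz[OF that] by (simp add: vec_eq_iff)
    show "integrable lborel (\<lambda>X. (norm (\<chi> i. g i X))\<^sup>2)"
      using gL2 by (simp add: norm_vec_square)
  qed
qed

text \<open>On the smaller ball the classical gradient of the mollified function is the mollified
  weak gradient, so convergence of functions and of gradients reduces to mollifying square
  integrable functions with common radii.\<close>

lemma weak_gradient_approximation:
  fixes u :: "real^'n \<Rightarrow> complex"
  assumes wg: "has_weak_gradient \<Omega> u G" and "open \<Omega>" and ball: "cball x S \<subseteq> \<Omega>" and "R < S"
    and u' [measurable]: "u' \<in> borel_measurable borel" and uu': "AE X in lebesgue. X \<in> cball x S \<longrightarrow> u' X = u X"
    and u'z: "\<And>X. X \<notin> cball x S \<Longrightarrow> u' X = 0" and u'L2: "integrable lborel (\<lambda>X. (norm (u' X))\<^sup>2)"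
    and G' [measurable]: "G' \<in> borel_measurable borel" and GG': "AE X in lebesgue. X \<in> cball x S \<longrightarrow> G' X = G X"
    and G'z: "\<And>X. X \<notin> cball x S \<Longrightarrow> G' X = 0" and G'L2: "integrable lborel (\<lambda>X. (norm (G' X))\<^sup>2)"
  shows "\<exists>v W. (\<forall>k :: nat. C_times (Suc 0) (v k)) \<and> integrable lborel W \<and>
    (AE X in lborel. X \<in> cball x R \<longrightarrow>
      (\<lambda>k. v k X) \<longlonglongrightarrow> u' X \<and> (\<forall>i. (\<lambda>k. gradient (v k) X $ i) \<longlonglongrightarrow> G' X $ i)) \<and>
    (AE X in lborel. X \<in> cball x R \<longrightarrow>
      (\<forall>k. (norm (v k X))\<^sup>2 \<le> W X \<and> (\<forall>i. (norm (gradient (v k) X $ i))\<^sup>2 \<le> W X)))"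
proof -
  let ?K = "cball x S"
  \<comment> \<open>The index type \<open>option\<close> bundles the function (\<open>None\<close>)
    and the components of its gradient (\<open>Some i\<close>) into one family, so that they share
    the radii and the majorant.\<close>
  define f where "f j X = (case j of None \<Rightarrow> u X | Some i \<Rightarrow> G X $ i)" for j and X :: "real^'n"
  define g where "g j X = (case j of None \<Rightarrow> u' X | Some i \<Rightarrow> G' X $ i)" for j and X :: "real^'n"
  have um: "u \<in> borel_measurable (lebesgue_on \<Omega>)" and Gm: "G \<in> borel_measurable (lebesgue_on \<Omega>)"
    using wg by (auto simp: has_weak_gradient_def L2_loc_def)
  have Gim: "(\<lambda>X. G X $ i) \<in> borel_measurable (lebesgue_on \<Omega>)" for i
    by (rule borel_measurable_vec_nth_complex[OF Gm])
  have fm: "f j \<in> borel_measurable (lebesgue_on \<Omega>)" for j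
    using um Gim by (cases j) (auto simp: f_def[abs_def])
  have G'i [measurable]: "(\<lambda>X. G' X $ i) \<in> borel_measurable borel" for i
    by (rule borel_measurable_vec_nth_complex[OF G'])
  have g: "g j \<in> borel_measurable borel" for j
    by (cases j) (simp_all add: g_def[abs_def])
  have gf: "AE X in lebesgue. X \<in> ?K \<longrightarrow> g j X = f j X" for j
    using uu' GG' by (cases j) (auto simp: f_def g_def elim: eventually_mono)
  have gz: "g j X = 0" if "X \<notin> ?K" for j X
    using u'z[OF that] G'z[OF that] by (cases j) (simp_all add: g_def)
  have gL2: "integrable lborel (\<lambda>X. (norm (g j X))\<^sup>2)" for j
  proof (cases j)
    case (Some i)
    show ?thesis
      unfolding Some g_def option.case
      by (rule Bochner_Integration.integrable_bound[OF G'L2])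
        (auto intro!: AE_I2 power_mono Finite_Cartesian_Product.norm_nth_le)
  qed (use u'L2 in \<open>simp add: g_def\<close>)
  have gz0: "g j X = 0" if "X \<notin> cball 0 (norm x + S)" for j X
  proof (rule gz)
    show "X \<notin> ?K"
      using that norm_triangle_ineq[of x "X - x"] by (auto simp: dist_norm norm_minus_commute)
  qed
  have SR: "0 < S - R"
    using \<open>R < S\<close> by simp
  obtain e W where e: "\<And>k. 0 < e k" "\<And>k :: nat. e k < S - R" and W: "integrable lborel W"
    and lim: "AE X in lborel. \<forall>i\<in>UNIV. (\<lambda>k. conv (g i) (cmollifier (e k)) X) \<longlonglongrightarrow> g i X"
    and le: "AE X in lborel. \<forall>i\<in>UNIV. \<forall>k. (norm (conv (g i) (cmollifier (e k)) X))\<^sup>2 \<le> W X"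
    by (rule mollifier_sequence[where I = UNIV and g = g and B = "norm x + S", OF finite g gL2 _ SR])
      (rule gz0, assumption, rule that)
  have gi: "integrable lborel (g j)" for j
    by (rule integrable_square_bounded_support[OF g gL2 gz])
  define v where "v k = conv (g None) (cmollifier (e k))" for k
  have mz: "cmollifier (e k) X = 0" if "X \<notin> cball 0 (e k)" for k and X :: "real^'n"
    using mollifier_zero[OF e(1) that] by simp
  have v1: "C_times (Suc 0) (v k)" for k
    unfolding v_def by (rule C_times_conv[OF gi C_times_cmollifier mz])
  \<comment> \<open>Because \<open>e k < S - R\<close>, the reflected mollifier centred at
    \<open>X\<close> is an admissible test function. The sign from the reflection cancels the sign
    in the definition of the weak gradient.\<close>
  have grad: "gradient (v k) X $ i = conv (g (Some i)) (cmollifier (e k)) X" if X: "X \<in> cball x R" for k X i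
  proof -
    let ?\<phi> = "\<lambda>Y. cmollifier (e k) (X - Y)"
    have sub: "cball X (e k) \<subseteq> ?K"
    proof
      fix Y
      assume "Y \<in> cball X (e k)"
      then show "Y \<in> ?K"
        using X e(2)[of k] dist_triangle[of x Y X] by simp
    qed
    then have test: "?\<phi> \<in> test_functions \<Omega>"
      using ball e(1) by (intro cmollifier_reflect_test_function) auto
    have \<phi>1: "C_times (Suc 0) ?\<phi>"
      using test by (simp add: test_functions_def del: C_times.simps)
    have z: "?\<phi> Y = 0" if "Y \<notin> ?K" for Y
    proof (rule mz)
      have "Y \<notin> cball X (e k)"
        using that sub by blast
      then show "X - Y \<notin> cball 0 (e k)"
        by (simp add: dist_norm norm_minus_commute)
    qed
    have gz': "gradient ?\<phi> Y $ i = 0" if "Y \<notin> ?K" for Y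
      using gradient_zero_outside[of ?K ?\<phi> Y] z that by (simp del: mem_cball)
    have gm: "(\<lambda>Y. gradient ?\<phi> Y $ i) \<in> borel_measurable borel"
      using \<phi>1 by (intro borel_measurable_continuous_onI) simp
    have \<phi>m: "?\<phi> \<in> borel_measurable borel"
      using C_times_continuous[OF \<phi>1] by (rule borel_measurable_continuous_onI)
    have diff: "cmollifier (e k) differentiable (at Y)" for Y :: "real^'n"
      using C_times_cmollifier[of "Suc 0" "e k", where 'n = 'n] by simp
    have "gradient (v k) X $ i = conv (g None) (\<lambda>X. gradient (cmollifier (e k)) X $ i) X"
      unfolding v_def by (rule gradient_conv[OF gi C_times_cmollifier]) (rule mz)
    also have "\<dots> = (\<integral>Y. g None Y * gradient (cmollifier (e k)) (X - Y) $ i \<partial>lborel)"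
      by (simp add: conv_def)
    also have "\<dots> = - (\<integral>Y. g None Y * gradient ?\<phi> Y $ i \<partial>lborel)"
      by (subst gradient_reflect[OF diff]) simp
    also have "(\<integral>Y. g None Y * gradient ?\<phi> Y $ i \<partial>lborel) = (LINT Y:\<Omega>|lebesgue. f None Y * gradient ?\<phi> Y $ i)"
      by (rule set_integral_lborel_version[OF \<open>open \<Omega>\<close> ball fm g gf gz gm gz', symmetric])
    also have "\<dots> = - (LINT Y:\<Omega>|lebesgue. f (Some i) Y * ?\<phi> Y)"
      using wg test by (simp add: has_weak_gradient_def f_def)
    also have "(LINT Y:\<Omega>|lebesgue. f (Some i) Y * ?\<phi> Y) = (\<integral>Y. g (Some i) Y * ?\<phi> Y \<partial>lborel)"
      by (rule set_integral_lborel_version[OF \<open>open \<Omega>\<close> ball fm g gf gz \<phi>m z])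
    finally show ?thesis
      by (simp add: conv_def)
  qed
  have RS: "cball x R \<subseteq> ?K"
    using \<open>R < S\<close> by auto
  have "AE X in lborel. X \<in> cball x R \<longrightarrow>
      (\<lambda>k. v k X) \<longlonglongrightarrow> u' X \<and> (\<forall>i. (\<lambda>k. gradient (v k) X $ i) \<longlonglongrightarrow> G' X $ i)"
    using lim
  proof eventually_elim
    case (elim X)
    show ?case
    proof
      assume X: "X \<in> cball x R"
      have "(\<lambda>k. conv (g j) (cmollifier (e k)) X) \<longlonglongrightarrow> g j X" for j
        using elim by simp
      from this[of None] this[of "Some _"]
      show "(\<lambda>k. v k X) \<longlonglongrightarrow> u' X \<and> (\<forall>i. (\<lambda>k. gradient (v k) X $ i) \<longlonglongrightarrow> G' X $ i)"
        by (simp add: grad[OF X]) (simp add: v_def g_def)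
    qed
  qed
  moreover have "AE X in lborel. X \<in> cball x R \<longrightarrow>
      (\<forall>k. (norm (v k X))\<^sup>2 \<le> W X \<and> (\<forall>i. (norm (gradient (v k) X $ i))\<^sup>2 \<le> W X))"
    using le
  proof eventually_elim
    case (elim X)
    show ?case
    proof (intro impI allI conjI)
      fix k i
      assume X: "X \<in> cball x R"
      show "(norm (v k X))\<^sup>2 \<le> W X"
        using elim by (simp add: v_def)
      show "(norm (gradient (v k) X $ i))\<^sup>2 \<le> W X"
        using elim by (simp add: grad[OF X])
    qed
  qed
  ultimately show ?thesis
    using v1 W by blast
qed

lemma gradient_cnj:
  assumes "f differentiable (at X)"
  shows "gradient (\<lambda>Y. cnj (f Y)) X = cnj_vec (gradient f X)"
proof -
  have "((\<lambda>Y. cnj (f Y)) has_derivative (\<lambda>h. cnj (\<Sum>i\<in>UNIV. (h $ i) *\<^sub>R gradient f X $ i))) (at X)"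
    by (rule has_derivative_cnj[OF has_derivative_gradient[OF assms]])
  from gradient_nth[OF this]
  have "gradient (\<lambda>Y. cnj (f Y)) X $ i = cnj (\<Sum>j\<in>UNIV. (axis i 1 $ j) *\<^sub>R gradient f X $ j)" for i
    .
  moreover have "(\<Sum>j\<in>UNIV. (axis i 1 $ j) *\<^sub>R gradient f X $ j)
      = (\<Sum>j\<in>UNIV. if j = i then gradient f X $ j else 0)" for i
    by (intro sum.cong) (auto simp: axis_def)
  ultimately show ?thesis
    by (simp add: vec_eq_iff cnj_vec_def)
qed

text \<open>The cutoffs and the regularized powers used later are only \<open>C^1\<close>.
  Mollifying \<Psi> gives smooth test functions whose gradients converge uniformly, and
  integrability of \<open>H\<close> is enough to pass to the limit.\<close>

lemma weak_formulation_C1: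
  fixes H :: "real^'n \<Rightarrow> complex^'n"
  assumes H [measurable]: "H \<in> borel_measurable borel" and Hi: "\<And>i. integrable lborel (\<lambda>X. H X $ i)"
    and test: "\<And>\<Psi>. \<Psi> \<in> test_functions \<Omega> \<Longrightarrow> (\<And>X. X \<notin> cball x S \<Longrightarrow> \<Psi> X = 0) \<Longrightarrow>
      (\<integral>X. cdot (H X) (cnj_vec (gradient \<Psi> X)) \<partial>lborel) = 0"
    and ball: "cball x S \<subseteq> \<Omega>" and "R < S"
    and \<Psi>: "C_times (Suc 0) \<Psi>" and zero: "\<And>X. X \<notin> cball x R \<Longrightarrow> \<Psi> X = 0"
  shows "(\<integral>X. cdot (H X) (cnj_vec (gradient \<Psi> X)) \<partial>lborel) = 0"
proof -
  define B where "B = norm x + R"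
  have zero0: "\<Psi> X = 0" if "X \<notin> cball 0 B" for X
  proof (rule zero)
    show "X \<notin> cball x R"
      using that norm_triangle_ineq[of x "X - x"] by (auto simp: B_def dist_norm norm_minus_commute)
  qed
  have \<Psi>0: "continuous_on UNIV \<Psi>"
    by (rule C_times_continuous[OF \<Psi>])
  then have [measurable]: "\<Psi> \<in> borel_measurable borel"
    by (rule borel_measurable_continuous_onI)
  have \<Psi>i: "integrable lborel \<Psi>"
    by (rule integrable_compact_support[OF \<Psi>0 zero])
  have gc: "continuous_on UNIV (\<lambda>X. gradient \<Psi> X $ i)" for i
    using \<Psi> by simp
  have gm: "(\<lambda>X. gradient \<Psi> X $ i) \<in> borel_measurable borel" for i
    by (rule borel_measurable_continuous_onI[OF gc])
  have gz: "gradient \<Psi> X $ i = 0" if "X \<notin> cball 0 B" for X i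
    using gradient_zero_outside[of "cball 0 B" \<Psi> X] zero0 that by (simp del: mem_cball)
  have int: "integrable lborel (\<lambda>X. H X $ i * cnj (g X))"
    if g: "continuous_on UNIV g" and gb: "\<And>X. norm (g X) \<le> C" for g i and C :: real
  proof (rule Bochner_Integration.integrable_bound)
    show "integrable lborel (\<lambda>X. C * norm (H X $ i))"
      using Hi by simp
    have "(\<lambda>X. cnj (g X)) \<in> borel_measurable lborel"
      using g by (auto intro!: borel_measurable_continuous_onI continuous_intros)
    then show "(\<lambda>X. H X $ i * cnj (g X)) \<in> borel_measurable lborel"
      by (intro borel_measurable_times borel_measurable_integrable[OF Hi])
    show "AE X in lborel. norm (H X $ i * cnj (g X)) \<le> norm (C * norm (H X $ i))"
    proof (intro AE_I2)
      fix X
      have "norm (H X $ i) * norm (g X) \<le> norm (H X $ i) * C"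
        using gb by (intro mult_left_mono) auto
      then show "norm (H X $ i * cnj (g X)) \<le> norm (C * norm (H X $ i))"
        using order_trans[OF _ abs_ge_self, of _ "norm (H X $ i) * C"] by (simp add: norm_mult mult.commute)
    qed
  qed
  let ?I = "\<lambda>\<Psi>. \<integral>X. cdot (H X) (cnj_vec (gradient \<Psi> X)) \<partial>lborel"
  define N where "N = (\<Sum>i\<in>UNIV. \<integral>X. norm (H X $ i) \<partial>lborel)"
  have le: "norm (?I \<Psi>) \<le> \<epsilon> * N" if "0 < \<epsilon>" for \<epsilon>
  proof -
    have "\<exists>\<delta>>0. \<forall>e X. 0 < e \<longrightarrow> e < \<delta> \<longrightarrow>
        norm (conv (\<lambda>X. gradient \<Psi> X $ i) (cmollifier e) X - gradient \<Psi> X $ i) \<le> \<epsilon>" for i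
      by (rule conv_mollifier_uniform[OF gc gz that]) blast+
    then have "\<exists>\<delta>. \<forall>i. 0 < \<delta> i \<and> (\<forall>e X. 0 < e \<longrightarrow> e < \<delta> i \<longrightarrow>
        norm (conv (\<lambda>X. gradient \<Psi> X $ i) (cmollifier e) X - gradient \<Psi> X $ i) \<le> \<epsilon>)"
      by (intro choice allI)
    then obtain \<delta> where \<delta>: "\<And>i. 0 < \<delta> i" "\<And>i e X. 0 < e \<Longrightarrow> e < \<delta> i \<Longrightarrow>
        norm (conv (\<lambda>X. gradient \<Psi> X $ i) (cmollifier e) X - gradient \<Psi> X $ i) \<le> \<epsilon>"
      by blast
    \<comment> \<open>The minimum runs over finitely many coordinates, so one radius works for all
      partial derivatives; the bound by \<open>S - R\<close> keeps the mollified function supported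
      in \<open>cball x S\<close>.\<close>
    define m where "m = Min (range \<delta>)"
    define e where "e = min (S - R) m / 2"
    have "0 < m"
      unfolding m_def using \<delta>(1) by (subst Min_gr_iff) auto
    then have e: "0 < e" "e < S - R" "e < m"
      using \<open>R < S\<close> by (auto simp: e_def min_def)
    have e\<delta>: "e < \<delta> i" for i
      using e(3) Min_le[of "range \<delta>" "\<delta> i"] by (auto simp: m_def)
    define \<Phi> where "\<Phi> = conv \<Psi> (cmollifier e)"
    have mz: "cmollifier e X = 0" if "X \<notin> cball 0 e" for X :: "real^'n"
      using mollifier_zero[OF e(1) that] by simp
    have \<Phi>z: "\<Phi> X = 0" if "X \<notin> cball x (R + e)" for X
      unfolding \<Phi>_def by (rule conv_zero_outside[OF zero mz that])
    have \<Phi>z': "\<Phi> X = 0" if "X \<notin> cball x S" for X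
      using that e(2) by (intro \<Phi>z) auto
    have \<Phi>C: "C_times k \<Phi>" for k
      unfolding \<Phi>_def by (rule C_times_conv[OF \<Psi>i C_times_cmollifier mz])
    have "{X. \<Phi> X \<noteq> 0} \<subseteq> cball x S"
      using \<Phi>z' by blast
    then have cl: "closure {X. \<Phi> X \<noteq> 0} \<subseteq> cball x S"
      by (intro closure_minimal) auto
    then have "compact (closure {X. \<Phi> X \<noteq> 0})"
      using compact_Int_closed[OF compact_cball closed_closure] by (metis inf.absorb2)
    with cl \<Phi>C ball have "\<Phi> \<in> test_functions \<Omega>"
      by (auto simp: test_functions_def)
    from test[OF this \<Phi>z'] have I0: "?I \<Phi> = 0" .
    have \<Phi>g: "gradient \<Phi> X $ i = conv (\<lambda>X. gradient \<Psi> X $ i) (cmollifier e) X" for X i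
    proof -
      \<comment> \<open>With the mollifier in the first place the derivative falls on \<Psi>, so the
        gradient of \<Phi> is the mollified gradient of \<Psi>.\<close>
      have "\<Phi> = conv (cmollifier e) \<Psi>"
        unfolding \<Phi>_def by (rule conv_commute) measurable
      then have "gradient \<Phi> X $ i = conv (cmollifier e) (\<lambda>X. gradient \<Psi> X $ i) X"
        using gradient_conv[OF integrable_cmollifier[OF e(1)] \<Psi>, of B] zero0 by simp
      also have "conv (cmollifier e) (\<lambda>X. gradient \<Psi> X $ i) = conv (\<lambda>X. gradient \<Psi> X $ i) (cmollifier e)"
        using gm by (intro conv_commute) measurable
      finally show ?thesis .
    qed
    have \<Phi>c: "continuous_on UNIV (\<lambda>X. gradient \<Phi> X $ i)" for i
      using \<Phi>C[of "Suc 0"] by simp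
    have close: "norm (gradient \<Phi> X $ i - gradient \<Psi> X $ i) \<le> \<epsilon>" for X i
      unfolding \<Phi>g using \<delta>(2)[OF e(1) e\<delta>] .
    obtain C where C: "\<And>X. norm (gradient \<Psi> X) \<le> C"
      using bounded_compact_support[OF continuous_gradient[OF \<Psi>], of 0 B]
        gradient_zero_outside[of "cball 0 B" \<Psi>] zero0 by (metis closed_cball)
    have Ci: "norm (gradient \<Psi> X $ i) \<le> C" for X i
      using C[of X] Finite_Cartesian_Product.norm_nth_le[of "gradient \<Psi> X" i] by linarith
    have Ci': "norm (gradient \<Phi> X $ i) \<le> C + \<epsilon>" for X i
      using close[of X i] Ci[of X i] norm_triangle_sub[of "gradient \<Phi> X $ i" "gradient \<Psi> X $ i"] by linarith
    have exp: "?I h = (\<Sum>i\<in>UNIV. \<integral>X. H X $ i * cnj (gradient h X $ i) \<partial>lborel)"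
      if "\<And>i. integrable lborel (\<lambda>X. H X $ i * cnj (gradient h X $ i))" for h
      using that by (simp add: cdot_def cnj_vec_def)
    have "?I \<Psi> = ?I \<Psi> - ?I \<Phi>"
      by (simp add: I0)
    also have "\<dots> = (\<Sum>i\<in>UNIV. (\<integral>X. H X $ i * cnj (gradient \<Psi> X $ i) \<partial>lborel)
        - (\<integral>X. H X $ i * cnj (gradient \<Phi> X $ i) \<partial>lborel))"
      by (simp only: exp int[OF gc Ci] int[OF \<Phi>c Ci'] sum_subtractf)
    also have "norm \<dots> \<le> (\<Sum>i\<in>UNIV. \<epsilon> * (\<integral>X. norm (H X $ i) \<partial>lborel))"
    proof (rule order_trans[OF norm_sum sum_mono])
      fix i
      have "(\<integral>X. H X $ i * cnj (gradient \<Psi> X $ i) \<partial>lborel) - (\<integral>X. H X $ i * cnj (gradient \<Phi> X $ i) \<partial>lborel)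
          = (\<integral>X. H X $ i * cnj (gradient \<Psi> X $ i - gradient \<Phi> X $ i) \<partial>lborel)"
        by (subst Bochner_Integration.integral_diff[OF int[OF gc Ci] int[OF \<Phi>c Ci'], symmetric])
          (simp add: right_diff_distrib)
      also have "norm \<dots> \<le> \<epsilon> * (\<integral>X. norm (H X $ i) \<partial>lborel)"
      proof (rule norm_integral_mult_le[OF Hi])
        show "norm (cnj (gradient \<Psi> X $ i - gradient \<Phi> X $ i)) \<le> \<epsilon>" for X
          using close[of X i] by (simp only: complex_mod_cnj norm_minus_commute)
        show "(\<lambda>X. cnj (gradient \<Psi> X $ i - gradient \<Phi> X $ i)) \<in> borel_measurable borel"
          by (intro borel_measurable_continuous_onI continuous_on_cnj continuous_on_diff gc \<Phi>c)
      qed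
      finally show "norm ((\<integral>X. H X $ i * cnj (gradient \<Psi> X $ i) \<partial>lborel)
          - (\<integral>X. H X $ i * cnj (gradient \<Phi> X $ i) \<partial>lborel)) \<le> \<epsilon> * (\<integral>X. norm (H X $ i) \<partial>lborel)" .
    qed
    finally show ?thesis
      by (simp add: N_def sum_distrib_left)
  qed
  have "0 \<le> N"
    by (simp add: N_def sum_nonneg)
  have "norm (?I \<Psi>) \<le> 0"
  proof (rule field_le_epsilon)
    fix \<epsilon> :: real
    assume "0 < \<epsilon>"
    then have "0 < \<epsilon> / (N + 1)"
      using \<open>0 \<le> N\<close> by (intro divide_pos_pos) auto
    then have "norm (?I \<Psi>) \<le> \<epsilon> / (N + 1) * N"
      by (rule le)
    also have "\<dots> \<le> \<epsilon>"
      using \<open>0 < \<epsilon>\<close> \<open>0 \<le> N\<close> by (simp add: field_simps)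
    finally show "norm (?I \<Psi>) \<le> 0 + \<epsilon>"
      by simp
  qed
  then show ?thesis
    by simp
qed

section \<open>A Nash type inequality and cutoff functions\<close>

lemma nn_integral_lborel_translate:
  fixes f :: "'a::euclidean_space \<Rightarrow> ennreal"
  assumes [measurable]: "f \<in> borel_measurable borel"
  shows "(\<integral>\<^sup>+Y. f (Y - c) \<partial>lborel) = (\<integral>\<^sup>+Y. f Y \<partial>lborel)"
proof -
  have "(\<integral>\<^sup>+Y. f (Y - c) \<partial>lborel) = (\<integral>\<^sup>+Y. f ((0 - Y) - c) \<partial>lborel)"
    by (rule nn_integral_lborel_reflect[symmetric]) measurable
  also have "\<dots> = (\<integral>\<^sup>+Y. f (- c - Y) \<partial>lborel)"
    by (intro nn_integral_cong arg_cong[where f = f]) simp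
  also have "\<dots> = (\<integral>\<^sup>+Y. f Y \<partial>lborel)"
    by (rule nn_integral_lborel_reflect) measurable
  finally show ?thesis .
qed

text \<open>The fundamental theorem of calculus along the segment from \<open>X\<close> to
  \<open>X - h\<close>, Cauchy-Schwarz on the unit interval, and then Tonelli: for each
  \<open>s\<close> the translated gradient has the same integral over \<open>X\<close>.\<close>

lemma nn_integral_difference_le:
  fixes f :: "real^'n \<Rightarrow> complex"
  assumes f: "C_times (Suc 0) f"
  shows "(\<integral>\<^sup>+X. ennreal ((norm (f X - f (X - h)))\<^sup>2) \<partial>lborel)
    \<le> ennreal ((norm h)\<^sup>2) * (\<integral>\<^sup>+X. ennreal ((norm (gradient f X))\<^sup>2) \<partial>lborel)"
proof -
  have G: "continuous_on UNIV (gradient f)"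
    by (rule continuous_gradient[OF f])
  have [measurable]: "gradient f \<in> borel_measurable borel"
    by (rule borel_measurable_continuous_onI[OF G])
  have pointwise: "ennreal ((norm (f X - f (X - h)))\<^sup>2)
      \<le> ennreal ((norm h)\<^sup>2) * (\<integral>\<^sup>+s. ennreal ((norm (gradient f (X - s *\<^sub>R h)))\<^sup>2) * indicator {0..1} s \<partial>lborel)" for X
  proof -
    let ?d = "\<lambda>s. \<Sum>i\<in>UNIV. ((- h) $ i) *\<^sub>R gradient f (X - s *\<^sub>R h) $ i"
    have Gc: "continuous_on UNIV (\<lambda>s. gradient f (X - s *\<^sub>R h))"
      by (rule continuous_on_compose2[OF G]) (auto intro!: continuous_intros)
    have vd: "((\<lambda>s. f (X - s *\<^sub>R h)) has_vector_derivative ?d s) (at s within {0..1})" for s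
    proof -
      have 1: "((\<lambda>s. X - s *\<^sub>R h) has_derivative (\<lambda>r. r *\<^sub>R (- h))) (at s)"
        by (auto intro!: derivative_eq_intros)
      have 2: "(f has_derivative (\<lambda>k. \<Sum>i\<in>UNIV. (k $ i) *\<^sub>R gradient f (X - s *\<^sub>R h) $ i)) (at (X - s *\<^sub>R h))"
        using f by (intro has_derivative_gradient) simp
      have "((\<lambda>s. f (X - s *\<^sub>R h)) has_derivative
          (\<lambda>r. \<Sum>i\<in>UNIV. ((r *\<^sub>R (- h)) $ i) *\<^sub>R gradient f (X - s *\<^sub>R h) $ i)) (at s)"
        by (rule has_derivative_compose[OF 1 2])
      then have "((\<lambda>s. f (X - s *\<^sub>R h)) has_vector_derivative ?d s) (at s)"
        by (simp add: has_vector_derivative_def scaleR_sum_right)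
      then show ?thesis
        by (rule has_vector_derivative_at_within)
    qed
    have "continuous_on {0..1} ?d"
      by (intro continuous_intros continuous_on_subset[OF Gc]) auto
    then have FTC: "has_bochner_integral lborel (\<lambda>s. indicator {0..1} s *\<^sub>R ?d s) (f (X - 1 *\<^sub>R h) - f (X - 0 *\<^sub>R h))"
      by (intro has_bochner_integral_FTC_Icc[where F = "\<lambda>s. f (X - s *\<^sub>R h)"] vd) auto
    let ?g = "\<lambda>s. ennreal (norm (gradient f (X - s *\<^sub>R h))) * indicator {0..1} s"
    have "ennreal (norm (f X - f (X - h))) = ennreal (norm (\<integral>s. indicator {0..1} s *\<^sub>R ?d s \<partial>lborel))"
      using has_bochner_integral_integral_eq[OF FTC] by (simp add: norm_minus_commute)
    also have "\<dots> \<le> (\<integral>\<^sup>+s. ennreal (norm (indicator {0..1} s *\<^sub>R ?d s)) \<partial>lborel)"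
      using FTC by (intro integral_norm_bound_ennreal) (auto simp: has_bochner_integral_iff)
    also have "\<dots> \<le> (\<integral>\<^sup>+s. ennreal (norm h) * (?g s * indicator {0..1} s) \<partial>lborel)"
    proof (intro nn_integral_mono)
      fix s :: real
      have "norm (?d s) \<le> norm (- h) * norm (gradient f (X - s *\<^sub>R h))"
        by (rule norm_gradient_apply_le)
      then show "ennreal (norm (indicator {0..1} s *\<^sub>R ?d s)) \<le> ennreal (norm h) * (?g s * indicator {0..1} s)"
        by (auto simp: indicator_def ennreal_mult'[symmetric] intro!: ennreal_leI)
    qed
    also have "\<dots> = ennreal (norm h) * (\<integral>\<^sup>+s. ?g s * indicator {0..1} s \<partial>lborel)"
      by (rule nn_integral_cmult) measurable
    finally have "(ennreal (norm (f X - f (X - h))))\<^sup>2 \<le> (ennreal (norm h) * (\<integral>\<^sup>+s. ?g s * indicator {0..1} s \<partial>lborel))\<^sup>2"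
      by (rule power_mono) simp
    also have "\<dots> = ennreal ((norm h)\<^sup>2) * (\<integral>\<^sup>+s. ?g s * indicator {0..1} s \<partial>lborel)\<^sup>2"
      by (simp add: power_mult_distrib ennreal_power)
    also have "\<dots> \<le> ennreal ((norm h)\<^sup>2) * ((\<integral>\<^sup>+s. (?g s)\<^sup>2 \<partial>lborel) * (\<integral>\<^sup>+s. (indicator {0..1} s)\<^sup>2 \<partial>(lborel :: real measure)))"
      by (intro mult_left_mono Cauchy_Schwarz_nn_integral) auto
    also have "(\<integral>\<^sup>+s. (indicator {0..1} s)\<^sup>2 \<partial>(lborel :: real measure)) = (\<integral>\<^sup>+s. indicator {0..1} s \<partial>(lborel :: real measure))"
      by (intro nn_integral_cong) (simp add: indicator_def)
    also have "\<dots> = 1"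
      by simp
    also have "(\<lambda>s. (?g s)\<^sup>2) = (\<lambda>s. ennreal ((norm (gradient f (X - s *\<^sub>R h)))\<^sup>2) * indicator {0..1} s)"
      by (auto simp: indicator_def fun_eq_iff ennreal_power)
    finally show ?thesis
      by (simp add: ennreal_power)
  qed
  have "(\<integral>\<^sup>+X. ennreal ((norm (f X - f (X - h)))\<^sup>2) \<partial>lborel)
      \<le> (\<integral>\<^sup>+X. ennreal ((norm h)\<^sup>2) * (\<integral>\<^sup>+s. ennreal ((norm (gradient f (X - s *\<^sub>R h)))\<^sup>2) * indicator {0..1} s \<partial>lborel) \<partial>lborel)"
    by (intro nn_integral_mono pointwise)
  also have "\<dots> = ennreal ((norm h)\<^sup>2) * (\<integral>\<^sup>+X. (\<integral>\<^sup>+s. ennreal ((norm (gradient f (X - s *\<^sub>R h)))\<^sup>2) * indicator {0..1} s \<partial>lborel) \<partial>lborel)"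
    by (rule nn_integral_cmult) measurable
  also have "(\<integral>\<^sup>+X. (\<integral>\<^sup>+s. ennreal ((norm (gradient f (X - s *\<^sub>R h)))\<^sup>2) * indicator {0..1} s \<partial>lborel) \<partial>lborel)
      = (\<integral>\<^sup>+s. (\<integral>\<^sup>+X. ennreal ((norm (gradient f (X - s *\<^sub>R h)))\<^sup>2) * indicator {0..1} s \<partial>lborel) \<partial>lborel)"
    by (rule lborel_pair.Fubini'[symmetric]) measurable
  also have "\<dots> = (\<integral>\<^sup>+s. (\<integral>\<^sup>+X. ennreal ((norm (gradient f X))\<^sup>2) \<partial>lborel) * indicator {0..1} (s :: real) \<partial>lborel)"
    by (intro nn_integral_cong, subst nn_integral_multc)
      (simp_all add: nn_integral_lborel_translate[of "\<lambda>X. ennreal ((norm (gradient f X))\<^sup>2)"])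
  also have "\<dots> = (\<integral>\<^sup>+X. ennreal ((norm (gradient f X))\<^sup>2) \<partial>lborel)"
    by (subst nn_integral_cmult_indicator) auto
  finally show ?thesis .
qed

text \<open>Integrate \<open>\<bar>f(X)\<bar>\<^sup>2 + \<bar>f(X - h)\<bar>\<^sup>2 \<le> 2 \<bar>f(X)\<bar> \<bar>f(X - h)\<bar> + \<bar>f(X) - f(X - h)\<bar>\<^sup>2\<close> over \<open>X\<close> and over \<open>h\<close> in a ball.\<close>

lemma Nash_nn_integral:
  fixes f :: "real^'n \<Rightarrow> complex"
  assumes f: "C_times (Suc 0) f"
  defines "V t \<equiv> emeasure lborel (ball (0 :: real^'n) t)"
  shows "V t * (2 * (\<integral>\<^sup>+X. ennreal ((norm (f X))\<^sup>2) \<partial>lborel))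
    \<le> 2 * (\<integral>\<^sup>+X. ennreal (norm (f X)) \<partial>lborel)\<^sup>2
      + V t * (ennreal (t\<^sup>2) * (\<integral>\<^sup>+X. ennreal ((norm (gradient f X))\<^sup>2) \<partial>lborel))"
proof -
  have [measurable]: "f \<in> borel_measurable borel"
    using C_times_continuous[OF f] by (rule borel_measurable_continuous_onI)
  let ?N1 = "\<integral>\<^sup>+X. ennreal (norm (f X)) \<partial>lborel"
  let ?N2 = "\<integral>\<^sup>+X. ennreal ((norm (f X))\<^sup>2) \<partial>lborel"
  let ?D = "\<integral>\<^sup>+X. ennreal ((norm (gradient f X))\<^sup>2) \<partial>lborel"
  let ?c = "\<lambda>h. \<integral>\<^sup>+X. ennreal (norm (f X)) * ennreal (norm (f (X - h))) \<partial>lborel"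
  have *: "2 * ?N2 \<le> 2 * ?c h + ennreal (t\<^sup>2) * ?D" if "h \<in> ball 0 t" for h
  proof -
    \<comment> \<open>One of the two copies is translated by \<open>h\<close>, which leaves its
      integral unchanged.\<close>
    have "2 * ?N2 = ?N2 + (\<integral>\<^sup>+X. ennreal ((norm (f (X - h)))\<^sup>2) \<partial>lborel)"
      by (subst nn_integral_lborel_translate[of "\<lambda>X. ennreal ((norm (f X))\<^sup>2)"]) (auto simp: mult_2)
    also have "\<dots> = (\<integral>\<^sup>+X. ennreal ((norm (f X))\<^sup>2) + ennreal ((norm (f (X - h)))\<^sup>2) \<partial>lborel)"
      by (rule nn_integral_add[symmetric]) measurable
    also have "\<dots> \<le> (\<integral>\<^sup>+X. 2 * (ennreal (norm (f X)) * ennreal (norm (f (X - h))))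
        + ennreal ((norm (f X - f (X - h)))\<^sup>2) \<partial>lborel)"
    proof (intro nn_integral_mono)
      fix X
      have "(norm (f X) - norm (f (X - h)))\<^sup>2 \<le> (norm (f X - f (X - h)))\<^sup>2"
        using norm_triangle_ineq3[of "f X" "f (X - h)"] by (simp add: power2_le_iff_abs_le)
      then have "(norm (f X))\<^sup>2 + (norm (f (X - h)))\<^sup>2
          \<le> 2 * (norm (f X) * norm (f (X - h))) + (norm (f X - f (X - h)))\<^sup>2"
        by (simp add: power2_diff)
      then have "ennreal ((norm (f X))\<^sup>2 + (norm (f (X - h)))\<^sup>2)
          \<le> ennreal (2 * (norm (f X) * norm (f (X - h))) + (norm (f X - f (X - h)))\<^sup>2)"
        by (rule ennreal_leI)
      then show "ennreal ((norm (f X))\<^sup>2) + ennreal ((norm (f (X - h)))\<^sup>2)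
          \<le> 2 * (ennreal (norm (f X)) * ennreal (norm (f (X - h)))) + ennreal ((norm (f X - f (X - h)))\<^sup>2)"
        by (simp add: ennreal_mult')
    qed
    also have "\<dots> = 2 * ?c h + (\<integral>\<^sup>+X. ennreal ((norm (f X - f (X - h)))\<^sup>2) \<partial>lborel)"
      by (simp add: nn_integral_add nn_integral_cmult)
    also have "\<dots> \<le> 2 * ?c h + ennreal ((norm h)\<^sup>2) * ?D"
      by (intro add_left_mono nn_integral_difference_le f)
    also have "\<dots> \<le> 2 * ?c h + ennreal (t\<^sup>2) * ?D"
      using that by (intro add_left_mono mult_right_mono ennreal_leI power_mono) auto
    finally show ?thesis .
  qed
  have [measurable]: "ball (0 :: real^'n) t \<in> sets borel"
    by simp
  define K where "K = ennreal (t\<^sup>2) * ?D"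
  have "V t * (2 * ?N2) = (\<integral>\<^sup>+h. (2 * ?N2) * indicator (ball (0 :: real^'n) t) h \<partial>lborel)"
    unfolding V_def by (subst nn_integral_cmult_indicator) (auto simp: mult.commute)
  \<comment> \<open>The correlation term is enlarged from the ball to all \<open>h\<close>. Tonelli
    then turns it into the square of the \<open>L^1\<close> norm, and only the gradient term keeps
    the factor \<open>V t\<close>.\<close>
  also have "\<dots> \<le> (\<integral>\<^sup>+h. 2 * ?c h + K * indicator (ball (0 :: real^'n) t) h \<partial>lborel)"
    using * by (intro nn_integral_mono) (auto simp: indicator_def K_def)
  also have "\<dots> = (\<integral>\<^sup>+h. 2 * ?c h \<partial>lborel) + (\<integral>\<^sup>+h. K * indicator (ball (0 :: real^'n) t) h \<partial>lborel)"
    by (rule nn_integral_add) measurable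
  also have "\<dots> = 2 * (\<integral>\<^sup>+h. ?c h \<partial>lborel) + (ennreal (t\<^sup>2) * ?D) * V t"
    unfolding V_def by (simp add: nn_integral_cmult nn_integral_cmult_indicator K_def)
  also have "(\<integral>\<^sup>+h. ?c h \<partial>lborel)
      = (\<integral>\<^sup>+X. (\<integral>\<^sup>+h. ennreal (norm (f X)) * ennreal (norm (f (X - h))) \<partial>lborel) \<partial>lborel)"
    by (rule lborel_pair.Fubini') measurable
  also have "\<dots> = (\<integral>\<^sup>+X. ennreal (norm (f X)) * ?N1 \<partial>lborel)"
    by (intro nn_integral_cong, subst nn_integral_cmult)
      (simp_all add: nn_integral_lborel_reflect[of "\<lambda>X. ennreal (norm (f X))"])
  also have "\<dots> = ?N1\<^sup>2"
    by (simp add: nn_integral_multc power2_eq_square)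
  finally show ?thesis
    by (simp add: mult.commute)
qed

section \<open>Cutoff functions with explicit gradient bounds\<close>

lemma power2_pos_part_has_derivative:
  "((\<lambda>t. (max 0 t)\<^sup>2) has_real_derivative 2 * max 0 t) (at t)"
proof -
  consider "t = 0" | "t < 0" | "0 < t"
    by linarith
  then show ?thesis
  proof cases
    case 1
    have "\<bar>(max 0 t)\<^sup>2\<bar> \<le> 1 * t\<^sup>2" for t :: real
      by (auto simp: max_def)
    from has_derivative_zero_of_quadratic_bound[OF this] show ?thesis
      unfolding 1 by simp
  next
    case 2
    have "((\<lambda>t. 0) has_real_derivative 0) (at t)"
      by simp
    then have "((\<lambda>t. (max 0 t)\<^sup>2) has_real_derivative 0) (at t)"
      by (rule has_field_derivative_transform_within_open[where S = "{..<0}"])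
        (use 2 in \<open>auto simp: max_def\<close>)
    with 2 show ?thesis
      by (simp add: max_def)
  next
    case 3
    have "((\<lambda>t. t\<^sup>2) has_real_derivative 2 * t) (at t)"
      by (auto intro!: derivative_eq_intros)
    then have "((\<lambda>t. (max 0 t)\<^sup>2) has_real_derivative 2 * t) (at t)"
      by (rule has_field_derivative_transform_within_open[where S = "{0<..}"])
        (use 3 in \<open>auto simp: max_def\<close>)
    with 3 show ?thesis
      by (simp add: max_def)
  qed
qed

text \<open>Piecewise quadratic transition from 0 to 1 of class \<open>C^1\<close>: its second
  derivative is 4 on the first half of the unit interval, -4 on the second half and 0 elsewhere, so
  the slope peaks at 2.\<close>

definition step :: "real \<Rightarrow> real" where
  "step t = 2 * (max 0 t)\<^sup>2 - 4 * (max 0 (t - 1 / 2))\<^sup>2 + 2 * (max 0 (t - 1))\<^sup>2"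

definition step_deriv :: "real \<Rightarrow> real" where
  "step_deriv t = 4 * max 0 t - 8 * max 0 (t - 1 / 2) + 4 * max 0 (t - 1)"

lemma step_has_derivative: "(step has_real_derivative step_deriv t) (at t)"
proof -
  have *: "((\<lambda>t. (max 0 (t - c))\<^sup>2) has_real_derivative 2 * max 0 (t - c)) (at t)" for c
    using DERIV_shift[of "\<lambda>t. (max 0 t)\<^sup>2" "2 * max 0 (t - c)" t "- c"]
      power2_pos_part_has_derivative[of "t - c"] by simp
  show ?thesis
    using DERIV_add[OF DERIV_diff[OF DERIV_cmult[OF power2_pos_part_has_derivative[of t], of 2]
        DERIV_cmult[OF *[of "1 / 2"], of 4]] DERIV_cmult[OF *[of 1], of 2]]
    by (simp add: step_def[abs_def] step_deriv_def)
qed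

lemma step_deriv_bounds: "0 \<le> step_deriv t" "step_deriv t \<le> 2" "t \<le> 0 \<Longrightarrow> step_deriv t = 0"
  by (auto simp: step_deriv_def max_def)

lemma step_low: "t \<le> 0 \<Longrightarrow> step t = 0"
  by (simp add: step_def max_def)

lemma step_high:
  assumes "1 \<le> t"
  shows "step t = 1"
proof -
  have "step t = 2 * t\<^sup>2 - 4 * (t - 1 / 2)\<^sup>2 + 2 * (t - 1)\<^sup>2"
    using assms by (simp add: step_def max_def)
  also have "\<dots> = 1"
    by (simp add: power2_eq_square algebra_simps)
  finally show ?thesis .
qed

lemma step_mono: "s \<le> t \<Longrightarrow> step s \<le> step t"
  using step_has_derivative step_deriv_bounds(1) by (intro DERIV_nonneg_imp_nondecreasing[of s t step]) blast+

lemma step_bounds: "0 \<le> step t" "step t \<le> 1"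
  using step_mono[of "min t 0" t] step_mono[of t "max t 1"] step_low[of "min t 0"] step_high[of "max t 1"]
  by auto

text \<open>\<open>step\<close> is applied to the squared distance, which is smooth at the centre.
  The 4 is the maximal slope 2 times the 2 from differentiating a square; with
  \<open>D = (R - \<rho>) * (R + \<rho>)\<close> the second factor absorbs
  \<open>norm (X - x)\<close>.\<close>

lemma cutoff_exists:
  fixes x :: "real^'n"
  assumes "0 \<le> \<rho>" "\<rho> < R"
  obtains \<zeta> :: "real^'n \<Rightarrow> real" where "C_times (Suc 0) (\<lambda>X. complex_of_real (\<zeta> X))"
    "\<And>X. 0 \<le> \<zeta> X" "\<And>X. \<zeta> X \<le> 1" "\<And>X. X \<in> cball x \<rho> \<Longrightarrow> \<zeta> X = 1" "\<And>X. X \<notin> ball x R \<Longrightarrow> \<zeta> X = 0"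
    "\<And>X. norm (gradient (\<lambda>X. complex_of_real (\<zeta> X)) X) \<le> 4 / (R - \<rho>)"
proof -
  define D where "D = R\<^sup>2 - \<rho>\<^sup>2"
  have D_eq: "D = (R - \<rho>) * (R + \<rho>)"
    by (simp add: D_def power2_eq_square algebra_simps)
  have D: "0 < D"
    unfolding D_eq using assms by (intro mult_pos_pos) auto
  define \<zeta> where "\<zeta> X = step ((R\<^sup>2 - (norm (X - x))\<^sup>2) / D)" for X
  have d: "((\<lambda>t. step (t / D)) has_real_derivative step_deriv (t / D) / D) (at t)" for t
    by (rule DERIV_chain2[OF step_has_derivative, THEN DERIV_cong]) (use D in \<open>auto intro!: derivative_eq_intros\<close>)
  have deriv: "((\<lambda>X. complex_of_real (\<zeta> X)) has_derivative
      (\<lambda>h. complex_of_real (step_deriv ((R\<^sup>2 - (norm (X - x))\<^sup>2) / D) / D * (- 2 * ((X - x) \<bullet> h))))) (at X)" for X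
    unfolding \<zeta>_def by (rule has_derivative_of_real_radial[OF d])
  have step_cont: "continuous_on UNIV step_deriv"
    unfolding step_deriv_def by (intro continuous_intros)
  show ?thesis
  proof (rule that[of \<zeta>])
    show "C_times (Suc 0) (\<lambda>X. complex_of_real (\<zeta> X))"
    proof (rule C_times_SucI[OF deriv])
      fix i
      have "continuous_on UNIV (\<lambda>X :: real^'n. complex_of_real
          (step_deriv ((R\<^sup>2 - (norm (X - x))\<^sup>2) / D) / D * (- 2 * ((X - x) \<bullet> axis i 1))))"
        using D by (intro continuous_intros continuous_on_compose2[OF step_cont]) auto
      then show "C_times 0 (\<lambda>X :: real^'n. complex_of_real
          (step_deriv ((R\<^sup>2 - (norm (X - x))\<^sup>2) / D) / D * (- 2 * ((X - x) \<bullet> axis i 1))))"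
        by simp
    qed
    show "0 \<le> \<zeta> X" "\<zeta> X \<le> 1" for X
      by (simp_all add: \<zeta>_def step_bounds)
    show "\<zeta> X = 1" if "X \<in> cball x \<rho>" for X
    proof -
      have "(norm (X - x))\<^sup>2 \<le> \<rho>\<^sup>2"
        using that by (intro power_mono) (auto simp: dist_norm norm_minus_commute)
      then show ?thesis
        unfolding \<zeta>_def using D by (intro step_high) (simp add: D_def)
    qed
    have out: "(R\<^sup>2 - (norm (X - x))\<^sup>2) / D \<le> 0" if "X \<notin> ball x R" for X
    proof -
      have "R\<^sup>2 \<le> (norm (X - x))\<^sup>2"
        using that assms by (intro power_mono) (auto simp: dist_norm norm_minus_commute)
      then show ?thesis
        using D by (simp add: divide_le_0_iff)
    qed
    show "\<zeta> X = 0" if "X \<notin> ball x R" for X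
      unfolding \<zeta>_def using out[OF that] by (rule step_low)
    show "norm (gradient (\<lambda>X. complex_of_real (\<zeta> X)) X) \<le> 4 / (R - \<rho>)" for X
    proof -
      define c where "c = step_deriv ((R\<^sup>2 - (norm (X - x))\<^sup>2) / D) / D * (- 2)"
      have "gradient (\<lambda>X. complex_of_real (\<zeta> X)) X $ i = complex_of_real ((c *\<^sub>R (X - x)) $ i)" for i
        unfolding gradient_nth[OF deriv]
        by (rule arg_cong[where f = complex_of_real])
          (simp only: c_def vector_scaleR_component inner_axis real_scaleR_def mult.assoc inner_real_def mult_1_right)
      then have "norm (gradient (\<lambda>X. complex_of_real (\<zeta> X)) X) = norm (c *\<^sub>R (X - x))"
        by (simp only: norm_vec_def norm_of_real real_norm_def)
      also have "\<dots> = \<bar>c\<bar> * norm (X - x)"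
        by simp
      also have "\<dots> \<le> 4 / (R - \<rho>)"
      proof (cases "X \<in> ball x R")
        case True
        have "\<bar>c\<bar> \<le> 4 / D"
          using D step_deriv_bounds(1,2)[of "(R\<^sup>2 - (norm (X - x))\<^sup>2) / D"]
          by (simp add: c_def abs_mult divide_right_mono)
        moreover have "norm (X - x) \<le> R + \<rho>"
          using True assms by (simp add: dist_norm norm_minus_commute)
        ultimately have "\<bar>c\<bar> * norm (X - x) \<le> 4 / D * (R + \<rho>)"
          using D by (intro mult_mono) auto
        also have "\<dots> = 4 / (R - \<rho>)"
        proof -
          have "R + \<rho> \<noteq> 0" "R - \<rho> \<noteq> 0"
            using assms by auto
          then show ?thesis
            unfolding D_eq by (simp add: divide_eq_eq eq_divide_eq)
        qed
        finally show ?thesis .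
      next
        case False
        then have "c = 0"
          using step_deriv_bounds(3)[OF out[OF False]] by (simp add: c_def)
        then show ?thesis
          using assms by simp
      qed
      finally show ?thesis .
    qed
  qed
qed

section \<open>Regularized powers and ellipticity\<close>

text \<open>\<open>reg_powr a \<epsilon> s = ((s + \<epsilon>) / (1 + \<epsilon> (s + \<epsilon>)))\<^sup>a\<close> is bounded above and below for fixed \<open>\<epsilon>\<close> and tends to \<open>s\<^sup>a\<close>
  for \<open>s > 0\<close>. The logarithmic derivative \<open>reg_slope\<close> of its base satisfies \<open>0 \<le> s reg_slope \<epsilon> s \<le> 1\<close>, so it interpolates
  between the exponents \<open>0\<close> and \<open>a\<close>.\<close>

definition log_reg :: "real \<Rightarrow> real \<Rightarrow> real" where
  "log_reg \<epsilon> s = ln (s + \<epsilon>) - ln (1 + \<epsilon> * (s + \<epsilon>))"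

definition reg_powr :: "real \<Rightarrow> real \<Rightarrow> real \<Rightarrow> real" where
  "reg_powr a \<epsilon> s = exp (a * log_reg \<epsilon> s)"

definition reg_slope :: "real \<Rightarrow> real \<Rightarrow> real" where
  "reg_slope \<epsilon> s = 1 / ((s + \<epsilon>) * (1 + \<epsilon> * (s + \<epsilon>)))"

text \<open>With \<open>2 * a = p - 2\<close> this regularizes \<open>norm z powr (p - 2)\<close>
  times \<open>z\<close>, which enters the test function. With \<open>a / 2\<close> in place of
  \<open>a\<close> its modulus tends to \<open>norm z powr (p / 2)\<close>, and this version is the
  one inserted into the Nash type inequality.\<close>

definition reg_power :: "real \<Rightarrow> real \<Rightarrow> complex \<Rightarrow> complex" where
  "reg_power a \<epsilon> z = reg_powr a \<epsilon> ((norm z)\<^sup>2) *\<^sub>R z"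

definition reg_power_deriv :: "real \<Rightarrow> real \<Rightarrow> complex \<Rightarrow> complex \<Rightarrow> complex" where
  "reg_power_deriv a \<epsilon> z g = reg_powr a \<epsilon> ((norm z)\<^sup>2) *\<^sub>R
    (g + (2 * a * reg_slope \<epsilon> ((norm z)\<^sup>2) * Re (cnj z * g)) *\<^sub>R z)"

lemma reg_powr_pos: "0 < reg_powr a \<epsilon> s"
  by (simp add: reg_powr_def)

lemma reg_powr_square: "reg_powr (2 * a) \<epsilon> s = (reg_powr a \<epsilon> s)\<^sup>2"
  by (simp add: reg_powr_def power2_eq_square exp_add[symmetric])

lemma reg_slope_mult:
  assumes "0 < \<epsilon>" "0 \<le> s"
  shows "0 \<le> reg_slope \<epsilon> s * s" "reg_slope \<epsilon> s * s \<le> 1"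
proof -
  have "s * 1 \<le> (s + \<epsilon>) * (1 + \<epsilon> * (s + \<epsilon>))"
    using assms by (intro mult_mono) auto
  moreover have "0 < (s + \<epsilon>) * (1 + \<epsilon> * (s + \<epsilon>))"
    using assms by (intro mult_pos_pos add_pos_nonneg add_nonneg_pos) auto
  ultimately show "reg_slope \<epsilon> s * s \<le> 1"
    by (simp add: reg_slope_def)
  show "0 \<le> reg_slope \<epsilon> s * s"
    using assms by (simp add: reg_slope_def)
qed

lemma log_reg_has_derivative:
  assumes "0 < \<epsilon>" "0 \<le> s"
  shows "(log_reg \<epsilon> has_real_derivative reg_slope \<epsilon> s) (at s)"
proof -
  have pos: "0 < s + \<epsilon>" "0 < 1 + \<epsilon> * (s + \<epsilon>)"
    using assms by (auto intro: add_pos_nonneg add_nonneg_pos)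
  have "(log_reg \<epsilon> has_real_derivative (1 / (s + \<epsilon>) - \<epsilon> / (1 + \<epsilon> * (s + \<epsilon>)))) (at s)"
    unfolding log_reg_def[abs_def] using pos by (auto intro!: derivative_eq_intros)
  moreover have "1 / (s + \<epsilon>) - \<epsilon> / (1 + \<epsilon> * (s + \<epsilon>)) = reg_slope \<epsilon> s"
    using pos by (simp add: reg_slope_def divide_simps)
  ultimately show ?thesis
    by simp
qed

lemma reg_powr_has_derivative:
  assumes "0 < \<epsilon>" "0 \<le> s"
  shows "(reg_powr a \<epsilon> has_real_derivative reg_powr a \<epsilon> s * (a * reg_slope \<epsilon> s)) (at s)"
  unfolding reg_powr_def[abs_def]
  by (rule derivative_eq_intros log_reg_has_derivative[OF assms] refl | simp)+

lemma reg_power_has_derivative: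
  assumes "0 < \<epsilon>"
  shows "(reg_power a \<epsilon> has_derivative reg_power_deriv a \<epsilon> z) (at z)"
proof -
  have "((\<lambda>z :: complex. (norm z)\<^sup>2) has_derivative (\<lambda>h. 2 * Re (cnj z * h))) (at z)"
    unfolding power2_norm_eq_inner by (auto intro!: derivative_eq_intros simp: inner_complex_def)
  moreover have "(reg_powr a \<epsilon> has_derivative (*) (reg_powr a \<epsilon> ((norm z)\<^sup>2) * (a * reg_slope \<epsilon> ((norm z)\<^sup>2))))
      (at ((norm z)\<^sup>2))"
    by (rule has_field_derivative_imp_has_derivative[OF reg_powr_has_derivative[OF assms]]) simp
  ultimately have "((\<lambda>z. reg_powr a \<epsilon> ((norm z)\<^sup>2)) has_derivative
      (\<lambda>h. reg_powr a \<epsilon> ((norm z)\<^sup>2) * (a * reg_slope \<epsilon> ((norm z)\<^sup>2)) * (2 * Re (cnj z * h)))) (at z)"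
    by (rule has_derivative_compose)
  from has_derivative_scaleR[OF this has_derivative_ident]
  have "(reg_power a \<epsilon> has_derivative (\<lambda>h. reg_powr a \<epsilon> ((norm z)\<^sup>2) *\<^sub>R h
      + (reg_powr a \<epsilon> ((norm z)\<^sup>2) * (a * reg_slope \<epsilon> ((norm z)\<^sup>2)) * (2 * Re (cnj z * h))) *\<^sub>R z)) (at z)"
    by (simp add: reg_power_def[abs_def])
  moreover have "(\<lambda>h. reg_powr a \<epsilon> ((norm z)\<^sup>2) *\<^sub>R h
      + (reg_powr a \<epsilon> ((norm z)\<^sup>2) * (a * reg_slope \<epsilon> ((norm z)\<^sup>2)) * (2 * Re (cnj z * h))) *\<^sub>R z)
      = reg_power_deriv a \<epsilon> z"
    by (rule ext) (simp add: reg_power_deriv_def scaleR_add_right mult_ac)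
  ultimately show ?thesis
    by simp
qed

lemma continuous_reg_power:
  assumes "0 < \<epsilon>"
  shows "continuous_on UNIV (reg_power a \<epsilon>)"
  using reg_power_has_derivative[OF assms] has_derivative_continuous
  by (fast intro: continuous_at_imp_continuous_on)

lemma continuous_reg_power_deriv:
  assumes "0 < \<epsilon>"
  shows "continuous_on UNIV (\<lambda>(z, g). reg_power_deriv a \<epsilon> z g)"
proof -
  have pos: "0 < (norm z)\<^sup>2 + \<epsilon>" "0 < 1 + \<epsilon> * ((norm z)\<^sup>2 + \<epsilon>)" for z :: complex
    using assms by (auto intro: add_pos_nonneg add_nonneg_pos)
  then have ne: "(norm z)\<^sup>2 + \<epsilon> \<noteq> 0" "1 + \<epsilon> * ((norm z)\<^sup>2 + \<epsilon>) \<noteq> 0" for z :: complex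
    by (metis less_irrefl)+
  show ?thesis
    unfolding reg_power_deriv_def reg_powr_def log_reg_def reg_slope_def split_def
    using ne by (intro continuous_intros) auto
qed

lemma norm_reg_power: "norm (reg_power a \<epsilon> z) = reg_powr a \<epsilon> ((norm z)\<^sup>2) * norm z"
  using reg_powr_pos[of a \<epsilon> "(norm z)\<^sup>2"] by (simp add: reg_power_def)

text \<open>The radial part of the derivative carries the factor \<open>reg_slope\<close> times
  \<open>(norm z)\<^sup>2\<close>, which is at most 1. The bound is therefore relative to the weight
  and uniform in \<epsilon>.\<close>

lemma norm_reg_power_deriv_le:
  assumes "0 < \<epsilon>"
  shows "norm (reg_power_deriv a \<epsilon> z g) \<le> (1 + 2 * \<bar>a\<bar>) * (reg_powr a \<epsilon> ((norm z)\<^sup>2) * norm g)"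
proof -
  let ?c = "reg_slope \<epsilon> ((norm z)\<^sup>2)"
  have c: "0 \<le> ?c"
    using assms by (simp add: reg_slope_def)
  have "\<bar>Re (cnj z * g)\<bar> \<le> norm z * norm g"
    using abs_Re_le_cmod[of "cnj z * g"] by (simp add: norm_mult)
  then have "\<bar>2 * a * ?c\<bar> * \<bar>Re (cnj z * g)\<bar> * norm z \<le> \<bar>2 * a * ?c\<bar> * (norm z * norm g) * norm z"
    by (intro mult_right_mono mult_left_mono) auto
  also have "\<dots> = 2 * \<bar>a\<bar> * norm g * (?c * (norm z)\<^sup>2)"
    using c by (simp add: abs_mult power2_eq_square mult_ac)
  also have "\<dots> \<le> 2 * \<bar>a\<bar> * norm g * 1"
    using reg_slope_mult(2)[OF assms, of "(norm z)\<^sup>2"] by (intro mult_left_mono) auto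
  finally have "norm ((2 * a * ?c * Re (cnj z * g)) *\<^sub>R z) \<le> 2 * \<bar>a\<bar> * norm g"
    by (simp add: abs_mult)
  then have "norm (g + (2 * a * ?c * Re (cnj z * g)) *\<^sub>R z) \<le> (1 + 2 * \<bar>a\<bar>) * norm g"
    by (intro order_trans[OF norm_triangle_ineq]) (simp add: algebra_simps)
  then have "reg_powr a \<epsilon> ((norm z)\<^sup>2) * norm (g + (2 * a * ?c * Re (cnj z * g)) *\<^sub>R z)
      \<le> reg_powr a \<epsilon> ((norm z)\<^sup>2) * ((1 + 2 * \<bar>a\<bar>) * norm g)"
    by (intro mult_left_mono) (auto simp: reg_powr_pos less_imp_le)
  then show ?thesis
    using reg_powr_pos[of a \<epsilon> "(norm z)\<^sup>2"] by (simp add: reg_power_deriv_def mult_ac)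
qed

text \<open>The first two bounds remain finite as \<epsilon> tends to 0 with \<open>s > 0\<close>;
  they give majorants for nonnegative and for negative exponents. The third expresses the saturation
  of the base at \<open>1 / \<epsilon>\<close>.\<close>

lemma log_reg_bounds:
  assumes "0 < \<epsilon>" "\<epsilon> \<le> 1" "0 \<le> s"
  shows "log_reg \<epsilon> s \<le> ln (s + \<epsilon>)" "- log_reg \<epsilon> s \<le> ln (\<epsilon> + 1 / (s + \<epsilon>))" "log_reg \<epsilon> s \<le> ln (1 / \<epsilon>)"
proof -
  have pos: "0 < s + \<epsilon>" "0 < 1 + \<epsilon> * (s + \<epsilon>)"
    using assms by (auto intro: add_pos_nonneg add_nonneg_pos)
  have "0 \<le> ln (1 + \<epsilon> * (s + \<epsilon>))"
    using assms by (intro ln_ge_zero) auto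
  then show "log_reg \<epsilon> s \<le> ln (s + \<epsilon>)"
    by (simp add: log_reg_def)
  have "- log_reg \<epsilon> s = ln ((1 + \<epsilon> * (s + \<epsilon>)) / (s + \<epsilon>))"
    using pos by (simp add: log_reg_def ln_div)
  also have "(1 + \<epsilon> * (s + \<epsilon>)) / (s + \<epsilon>) = \<epsilon> + 1 / (s + \<epsilon>)"
    using pos by (simp add: field_simps)
  finally show "- log_reg \<epsilon> s \<le> ln (\<epsilon> + 1 / (s + \<epsilon>))"
    by simp
  have "log_reg \<epsilon> s = ln ((s + \<epsilon>) / (1 + \<epsilon> * (s + \<epsilon>)))"
    using pos by (simp add: log_reg_def ln_div)
  also have "\<dots> \<le> ln (1 / \<epsilon>)"
  proof (rule ln_mono)
    show "(s + \<epsilon>) / (1 + \<epsilon> * (s + \<epsilon>)) \<le> 1 / \<epsilon>"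
      using pos \<open>0 < \<epsilon>\<close> by (simp add: divide_simps mult.commute)
  qed (use pos \<open>0 < \<epsilon>\<close> in auto)
  finally show "log_reg \<epsilon> s \<le> ln (1 / \<epsilon>)" .
qed

text \<open>For fixed \<epsilon> the base stays between \<open>\<epsilon> / 2\<close> and
  \<open>1 / \<epsilon>\<close>, so powers of either sign are bounded. This keeps every integral at
  positive \<epsilon> finite.\<close>

lemma reg_powr_le:
  assumes "0 < \<epsilon>" "\<epsilon> \<le> 1" "0 \<le> s"
  shows "reg_powr a \<epsilon> s \<le> (2 / \<epsilon>) powr \<bar>a\<bar>"
proof -
  note b = log_reg_bounds[OF assms]
  have "1 / (s + \<epsilon>) \<le> 1 / \<epsilon>"
    using assms by (intro divide_left_mono) auto
  moreover have "\<epsilon> * \<epsilon> \<le> 1 * 1"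
    using assms by (intro mult_mono) auto
  then have "\<epsilon> \<le> 1 / \<epsilon>"
    using assms by (simp add: le_divide_eq)
  ultimately have "\<epsilon> + 1 / (s + \<epsilon>) \<le> 2 / \<epsilon>"
    by simp
  moreover have "0 < \<epsilon> + 1 / (s + \<epsilon>)"
    using assms by (intro add_pos_nonneg) auto
  ultimately have 1: "- log_reg \<epsilon> s \<le> ln (2 / \<epsilon>)"
    using assms by (intro order_trans[OF b(2) ln_mono]) auto
  have "ln (1 / \<epsilon>) \<le> ln (2 / \<epsilon>)"
    using assms by (intro ln_mono) (auto intro: divide_right_mono)
  with 1 b(3) have "\<bar>log_reg \<epsilon> s\<bar> \<le> ln (2 / \<epsilon>)"
    by linarith
  then have "\<bar>a\<bar> * \<bar>log_reg \<epsilon> s\<bar> \<le> \<bar>a\<bar> * ln (2 / \<epsilon>)"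
    by (intro mult_left_mono) auto
  then have "a * log_reg \<epsilon> s \<le> \<bar>a\<bar> * ln (2 / \<epsilon>)"
    using abs_ge_self[of "a * log_reg \<epsilon> s"] by (simp add: abs_mult)
  then show ?thesis
    using assms by (simp add: reg_powr_def powr_def)
qed

text \<open>Provides the majorant for the limit in \<epsilon>, which therefore must not contain
  \<epsilon>. Replacing \<epsilon> by 1 produces \<open>(s + 1) powr a\<close>, or
  \<open>(1 / s + 1) powr (- a)\<close> for negative \<open>a\<close>, and splitting these sums
  yields the two terms.\<close>

lemma reg_powr_mult_le:
  assumes "0 < \<epsilon>" "\<epsilon> \<le> 1" "0 \<le> s" "0 \<le> b"
  shows "reg_powr a \<epsilon> s * s powr b \<le> 2 powr \<bar>a\<bar> * (s powr (a + b) + s powr b)"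
proof (cases "s = 0")
  case False
  with assms have s: "0 < s"
    by simp
  have max: "(x + 1) powr c \<le> 2 powr c * (x powr c + 1)" if "0 < x" "0 \<le> c" for x c :: real
  proof -
    have "(x + 1) powr c \<le> (2 * max x 1) powr c"
      using that by (intro powr_mono2) auto
    also have "\<dots> = 2 powr c * (max x 1) powr c"
      using that by (intro powr_mult) 
    also have "\<dots> \<le> 2 powr c * (x powr c + 1)"
      using that by (intro mult_left_mono) (auto simp: max_def)
    finally show ?thesis .
  qed
  have "reg_powr a \<epsilon> s \<le> 2 powr \<bar>a\<bar> * (s powr a + 1)"
  proof (cases "0 \<le> a")
    case True
    have "ln (s + \<epsilon>) \<le> ln (s + 1)"
      using s assms(1,2) by (intro ln_mono) auto
    with log_reg_bounds(1)[OF assms(1-3)] have "log_reg \<epsilon> s \<le> ln (s + 1)"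
      by linarith
    then have "a * log_reg \<epsilon> s \<le> a * ln (s + 1)"
      using True by (rule mult_left_mono)
    then have "reg_powr a \<epsilon> s \<le> (s + 1) powr a"
      using s by (simp add: reg_powr_def powr_def)
    with max[OF s True] True show ?thesis
      by simp
  next
    case neg: False
    have "1 / (s + \<epsilon>) \<le> 1 / s"
      using s assms(1) by (intro divide_left_mono) auto
    with assms(2) have "\<epsilon> + 1 / (s + \<epsilon>) \<le> 1 / s + 1"
      by linarith
    moreover have "0 < \<epsilon> + 1 / (s + \<epsilon>)"
      using s assms by (intro add_pos_nonneg) auto
    ultimately have "- log_reg \<epsilon> s \<le> ln (1 / s + 1)"
      using s by (intro order_trans[OF log_reg_bounds(2)[OF assms(1-3)] ln_mono]) (auto intro: add_pos_pos)
    then have "(- a) * (- log_reg \<epsilon> s) \<le> (- a) * ln (1 / s + 1)"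
      using neg by (intro mult_left_mono) auto
    moreover have "0 < 1 / s + 1"
      using s by (intro add_pos_pos) auto
    ultimately have "reg_powr a \<epsilon> s \<le> (1 / s + 1) powr (- a)"
      by (simp add: reg_powr_def powr_def)
    also have "\<dots> \<le> 2 powr (- a) * ((1 / s) powr (- a) + 1)"
      using s neg by (intro max) auto
    also have "(1 / s) powr (- a) = s powr a"
      using s by (simp add: powr_divide powr_minus_divide)
    finally show ?thesis
      using neg by simp
  qed
  then have "reg_powr a \<epsilon> s * s powr b \<le> 2 powr \<bar>a\<bar> * (s powr a + 1) * s powr b"
    by (intro mult_right_mono) auto
  then show ?thesis
    using s by (simp add: powr_add algebra_simps)
qed simp

lemma reg_powr_tendsto:
  assumes "0 < s" and \<epsilon>: "\<epsilon> \<longlonglongrightarrow> 0"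
  shows "(\<lambda>k. reg_powr a (\<epsilon> k) s) \<longlonglongrightarrow> s powr a"
proof -
  have "(\<lambda>k. ln (s + \<epsilon> k) - ln (1 + \<epsilon> k * (s + \<epsilon> k))) \<longlonglongrightarrow> ln (s + 0) - ln (1 + 0 * (s + 0))"
    using assms by (intro tendsto_intros) auto
  then have "(\<lambda>k. exp (a * log_reg (\<epsilon> k) s)) \<longlonglongrightarrow> exp (a * ln s)"
    by (intro tendsto_intros) (simp add: log_reg_def)
  then show ?thesis
    using assms(1) by (simp add: reg_powr_def powr_def)
qed

section \<open>Coercivity for the intermediate exponents\<close>

text \<open>Rotation by the unit number \<open>w = sgn z\<close> reduces the claim to real and
  imaginary parts. For \<open>\<xi> = cnj w * g\<close> the correction term only multiplies the real
  part of \<xi> by \<open>1 + \<tau> * (q - 2)\<close>, so the form becomes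
  \<open>(1 + \<tau> * (q - 2)) * P + Q\<close>. It is affine in \<tau>, and its values at 0 and 1
  are controlled by ellipticity at \<xi> and at \<open>\<i> * \<xi>\<close>.\<close>

lemma q_ellipticity_interpolated:
  fixes A :: "complex^'n^'n" and g :: "complex^'n"
  assumes "1 < q" and "0 \<le> lam"
    and ell: "\<And>\<xi>. Re (cdot (A *v \<xi>) (cnj_vec (J q \<xi>))) \<ge> lam * (norm \<xi>)\<^sup>2"
    and \<theta>: "0 \<le> \<theta>" "\<theta> \<le> 1" and k: "k * (norm z)\<^sup>2 = \<theta> * (q - 2)"
  shows "Re (cdot (A *v g) (cnj_vec (\<chi> i. g $ i + (k * Re (cnj z * g $ i)) *\<^sub>R z))) \<ge> lam * (norm g)\<^sup>2"
proof -
  \<comment> \<open>At \<open>z = 0\<close> there is no direction, but the correction vanishes too;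
    \<open>w = 1\<close> and \<open>\<tau> = 0\<close> represent it.\<close>
  obtain w \<tau> where w: "norm w = 1" and \<tau>: "0 \<le> \<tau>" "\<tau> \<le> 1"
    and kw: "\<And>x. (k * Re (cnj z * x)) *\<^sub>R z = (\<tau> * (q - 2) * Re (cnj w * x)) *\<^sub>R w"
  proof (cases "z = 0")
    case True
    then show ?thesis
      by (intro that[of 1 0]) auto
  next
    case False
    have "(k * Re (cnj z * x)) *\<^sub>R z = (\<theta> * (q - 2) * Re (cnj (sgn z) * x)) *\<^sub>R sgn z" for x
    proof -
      have "cnj (sgn z) * x = (1 / norm z) *\<^sub>R (cnj z * x)"
        by (simp add: sgn_div_norm scaleR_conv_of_real divide_inverse mult_ac)
      then have "Re (cnj (sgn z) * x) = Re (cnj z * x) / norm z"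
        by simp
      then have "(\<theta> * (q - 2) * Re (cnj (sgn z) * x)) *\<^sub>R sgn z
          = (k * (norm z)\<^sup>2 * (Re (cnj z * x) / norm z)) *\<^sub>R ((1 / norm z) *\<^sub>R z)"
        by (simp only: k sgn_div_norm inverse_eq_divide)
      also have "\<dots> = (k * Re (cnj z * x)) *\<^sub>R z"
        using False by (simp add: power2_eq_square)
      finally show ?thesis
        by simp
    qed
    with False \<theta> show ?thesis
      by (intro that[of "sgn z" \<theta>]) (auto simp: norm_sgn)
  qed
  have ww: "w * cnj w = 1"
    using w by (simp add: complex_norm_square[symmetric])
  define \<xi> where "\<xi> = (\<chi> i. cnj w * g $ i)"
  define c where "c = A *v \<xi>"
  define P where "P = (\<Sum>i\<in>UNIV. Re (c $ i) * Re (\<xi> $ i))"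
  define Q where "Q = (\<Sum>i\<in>UNIV. Im (c $ i) * Im (\<xi> $ i))"
  define N where "N = lam * (norm g)\<^sup>2"
  have g\<xi>: "g $ i = w * \<xi> $ i" for i
    using ww by (simp add: \<xi>_def mult.assoc[symmetric])
  have norm\<xi>: "norm \<xi> = norm g"
    using w by (simp add: norm_vec_def \<xi>_def norm_mult)
  have mult: "(A *v (\<chi> i. a * \<xi> $ i)) $ i = a * c $ i" for a i
    by (simp add: c_def matrix_vector_mult_def sum_distrib_left mult_ac)
  have q': "q / (q - 1) \<noteq> 0" "1 / (q / (q - 1)) = (q - 1) / q"
    using \<open>1 < q\<close> by auto
  have "cdot (A *v \<xi>) (cnj_vec (J q \<xi>)) = (\<Sum>i\<in>UNIV. c $ i * cnj (Complex (Re (\<xi> $ i) / q) (Im (\<xi> $ i) / (q / (q - 1)))))"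
    by (simp add: cdot_def cnj_vec_def J_def Let_def c_def)
  then have "Re (cdot (A *v \<xi>) (cnj_vec (J q \<xi>))) = P / q + Q * ((q - 1) / q)"
    by (simp add: P_def Q_def sum.distrib sum_divide_distrib sum_distrib_left mult_ac)
  then have 1: "N \<le> P / q + Q * ((q - 1) / q)"
    using ell[of \<xi>] by (simp add: N_def norm\<xi>)
  \<comment> \<open>Multiplication by \<i> exchanges real and imaginary parts and thereby the roles
    of \<open>P\<close> and \<open>Q\<close> in the ellipticity condition.\<close>
  have "norm (\<chi> i. \<i> * \<xi> $ i) = norm \<xi>"
    by (simp add: norm_vec_def norm_mult)
  then have "norm (\<chi> i. \<i> * \<xi> $ i) = norm g"
    by (simp only: norm\<xi>)
  moreover have "cdot (A *v (\<chi> i. \<i> * \<xi> $ i)) (cnj_vec (J q (\<chi> i. \<i> * \<xi> $ i)))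
      = (\<Sum>i\<in>UNIV. \<i> * c $ i * cnj (Complex (- Im (\<xi> $ i) / q) (Re (\<xi> $ i) / (q / (q - 1)))))"
    by (simp add: cdot_def cnj_vec_def J_def Let_def mult)
  then have "Re (cdot (A *v (\<chi> i. \<i> * \<xi> $ i)) (cnj_vec (J q (\<chi> i. \<i> * \<xi> $ i)))) = Q / q + P * ((q - 1) / q)"
    by (simp add: P_def Q_def sum.distrib sum_divide_distrib sum_distrib_left mult_ac)
  ultimately have 2: "N \<le> Q / q + P * ((q - 1) / q)"
    using ell[of "\<chi> i. \<i> * \<xi> $ i"] by (simp add: N_def)
  have E: "q * (a / q + b * ((q - 1) / q)) = a + (q - 1) * b" for a b
    using \<open>1 < q\<close> by (simp add: field_simps)
  have "0 \<le> q"
    using \<open>1 < q\<close> by simp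
  note 3 = mult_left_mono[OF 1 this, unfolded E] and 4 = mult_left_mono[OF 2 this, unfolded E]
  have N: "0 \<le> N"
    using \<open>0 \<le> lam\<close> by (simp add: N_def)
  \<comment> \<open>Adding the two inequalities makes the coefficients symmetric. This is the
    endpoint \<open>\<tau> = 0\<close>, ordinary coercivity.\<close>
  have "q * (2 * N) \<le> q * (P + Q)"
    using 3 4 by (simp add: algebra_simps)
  then have 5: "2 * N \<le> P + Q"
    using \<open>1 < q\<close> by simp
  \<comment> \<open>The coefficient of \<open>P\<close> on the right combines to
    \<open>1 + \<tau> * (q - 2)\<close> and that of \<open>Q\<close> to 1. On the left both
    \<open>2 * N\<close> and \<open>q * N\<close> are at least \<open>N\<close>.\<close>
  have "(1 - \<tau>) * (2 * N) + \<tau> * (q * N) \<le> (1 - \<tau>) * (P + Q) + \<tau> * (Q + (q - 1) * P)"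
    using \<tau> 4 5 by (intro add_mono mult_left_mono) auto
  moreover have "N \<le> (1 - \<tau>) * (2 * N) + \<tau> * (q * N)"
  proof -
    have "(1 - \<tau>) * N + \<tau> * N \<le> (1 - \<tau>) * (2 * N) + \<tau> * (q * N)"
      using \<tau> N \<open>1 < q\<close> by (intro add_mono mult_left_mono) (auto simp: mult_le_cancel_right1)
    then show ?thesis
      by (simp add: algebra_simps)
  qed
  ultimately have main: "N \<le> (1 + \<tau> * (q - 2)) * P + Q"
    by (simp add: algebra_simps)
  have "A *v g = (\<chi> i. w * c $ i)"
  proof -
    have "(\<chi> i. w * \<xi> $ i) = g"
      by (simp add: vec_eq_iff g\<xi>)
    moreover have "A *v (\<chi> i. w * \<xi> $ i) = (\<chi> i. w * c $ i)"
      by (simp add: vec_eq_iff mult)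
    ultimately show ?thesis
      by simp
  qed
  moreover have "g $ i + (k * Re (cnj z * g $ i)) *\<^sub>R z
      = w * (\<xi> $ i + of_real (\<tau> * (q - 2) * Re (\<xi> $ i)))" for i
  proof -
    have "cnj w * g $ i = \<xi> $ i"
      by (simp add: \<xi>_def)
    then have "g $ i + (k * Re (cnj z * g $ i)) *\<^sub>R z = g $ i + (\<tau> * (q - 2) * Re (\<xi> $ i)) *\<^sub>R w"
      by (simp only: kw)
    also have "\<dots> = w * (\<xi> $ i + of_real (\<tau> * (q - 2) * Re (\<xi> $ i)))"
      by (simp only: g\<xi> scaleR_conv_of_real distrib_left mult.commute[of w])
    finally show ?thesis .
  qed
  ultimately have "cdot (A *v g) (cnj_vec (\<chi> i. g $ i + (k * Re (cnj z * g $ i)) *\<^sub>R z))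
      = (\<Sum>i\<in>UNIV. (w * c $ i) * cnj (w * (\<xi> $ i + of_real (\<tau> * (q - 2) * Re (\<xi> $ i)))))"
    by (simp add: cdot_def cnj_vec_def)
  also have "\<dots> = (\<Sum>i\<in>UNIV. c $ i * cnj (\<xi> $ i + of_real (\<tau> * (q - 2) * Re (\<xi> $ i))))"
  proof (rule sum.cong[OF refl])
    fix i
    have "(w * c $ i) * cnj (w * (\<xi> $ i + of_real (\<tau> * (q - 2) * Re (\<xi> $ i))))
        = (w * cnj w) * (c $ i * cnj (\<xi> $ i + of_real (\<tau> * (q - 2) * Re (\<xi> $ i))))"
      by (simp add: mult_ac)
    then show "(w * c $ i) * cnj (w * (\<xi> $ i + of_real (\<tau> * (q - 2) * Re (\<xi> $ i))))
        = c $ i * cnj (\<xi> $ i + of_real (\<tau> * (q - 2) * Re (\<xi> $ i)))"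
      by (simp add: ww)
  qed
  finally have "Re (cdot (A *v g) (cnj_vec (\<chi> i. g $ i + (k * Re (cnj z * g $ i)) *\<^sub>R z)))
      = (\<Sum>i\<in>UNIV. Re (c $ i * cnj (\<xi> $ i + of_real (\<tau> * (q - 2) * Re (\<xi> $ i)))))"
    by (simp only: Re_sum)
  also have "\<dots> = (\<Sum>i\<in>UNIV. (1 + \<tau> * (q - 2)) * (Re (c $ i) * Re (\<xi> $ i)) + Im (c $ i) * Im (\<xi> $ i))"
    by (rule sum.cong[OF refl]) (simp add: distrib_left distrib_right)
  also have "\<dots> = (1 + \<tau> * (q - 2)) * P + Q"
    by (simp only: P_def Q_def sum.distrib sum_distrib_left)
  finally have "Re (cdot (A *v g) (cnj_vec (\<chi> i. g $ i + (k * Re (cnj z * g $ i)) *\<^sub>R z)))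
      = (1 + \<tau> * (q - 2)) * P + Q" .
  with main show ?thesis
    unfolding N_def by linarith
qed

section \<open>Local estimates for weak solutions\<close>

lemma norm_matrix_vector_mult_le:
  fixes A :: "complex^'n^'n"
  shows "norm (A *v v) \<le> norm A * norm v"
proof (rule power2_le_imp_le)
  have "(norm (A *v v))\<^sup>2 = (\<Sum>i\<in>UNIV. (norm (\<Sum>j\<in>UNIV. A $ i $ j * v $ j))\<^sup>2)"
    by (simp add: norm_vec_square matrix_vector_mult_def)
  also have "\<dots> \<le> (\<Sum>i\<in>UNIV. (norm (A $ i) * norm v)\<^sup>2)"
  proof (intro sum_mono power_mono)
    fix i
    have "norm (\<Sum>j\<in>UNIV. A $ i $ j * v $ j) \<le> (\<Sum>j\<in>UNIV. \<bar>norm (A $ i $ j)\<bar> * \<bar>norm (v $ j)\<bar>)"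
      by (rule order_trans[OF norm_sum]) (simp add: norm_mult)
    also have "\<dots> \<le> L2_set (\<lambda>j. norm (A $ i $ j)) UNIV * L2_set (\<lambda>j. norm (v $ j)) UNIV"
      by (rule L2_set_mult_ineq)
    finally show "norm (\<Sum>j\<in>UNIV. A $ i $ j * v $ j) \<le> norm (A $ i) * norm v"
      by (simp add: norm_vec_def)
  qed simp
  also have "\<dots> = (norm A * norm v)\<^sup>2"
    by (simp add: power_mult_distrib sum_distrib_right[symmetric] norm_vec_def[of A] L2_set_def sum_nonneg)
  finally show "(norm (A *v v))\<^sup>2 \<le> (norm A * norm v)\<^sup>2" .
qed simp

text \<open>Borel representatives on \<open>cball x S\<close> of a solution, of its weak gradient and of the flux \<open>H = A G\<close>.\<close>

locale local_solution =
  fixes u :: "real^'n \<Rightarrow> complex" and G H :: "real^'n \<Rightarrow> complex^'n"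
    and x :: "real^'n" and S lam M q :: real
  assumes u_meas [measurable]: "u \<in> borel_measurable borel"
    and G_meas [measurable]: "G \<in> borel_measurable borel"
    and H_meas [measurable]: "H \<in> borel_measurable borel"
    and u_L2: "integrable lborel (\<lambda>X. (norm (u X))\<^sup>2)"
    and G_L2: "integrable lborel (\<lambda>X. (norm (G X))\<^sup>2)"
    and H_L2: "integrable lborel (\<lambda>X. (norm (H X))\<^sup>2)"
    and approximation: "\<And>R. R < S \<Longrightarrow> \<exists>v W. (\<forall>k :: nat. C_times (Suc 0) (v k)) \<and> integrable lborel W \<and>
      (AE X in lborel. X \<in> cball x R \<longrightarrow>
        (\<lambda>k. v k X) \<longlonglongrightarrow> u X \<and> (\<forall>i. (\<lambda>k. gradient (v k) X $ i) \<longlonglongrightarrow> G X $ i)) \<and>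
      (AE X in lborel. X \<in> cball x R \<longrightarrow>
        (\<forall>k. (norm (v k X))\<^sup>2 \<le> W X \<and> (\<forall>i. (norm (gradient (v k) X $ i))\<^sup>2 \<le> W X)))"
    and weak_equation: "\<And>\<Psi> R. R < S \<Longrightarrow> C_times (Suc 0) \<Psi> \<Longrightarrow> (\<And>X. X \<notin> cball x R \<Longrightarrow> \<Psi> X = 0) \<Longrightarrow>
      (\<integral>X. cdot (H X) (cnj_vec (gradient \<Psi> X)) \<partial>lborel) = 0"
    and ellipticity: "AE X in lborel. X \<in> cball x S \<longrightarrow> (\<exists>A. norm A \<le> M \<and> H X = A *v G X \<and>
      (\<forall>\<xi>. Re (cdot (A *v \<xi>) (cnj_vec (J q \<xi>))) \<ge> lam * (norm \<xi>)\<^sup>2))"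
    and q: "1 < q" and lam: "0 < lam" and M: "0 \<le> M"

lemma norm_cdot_le: "norm (cdot v (cnj_vec w)) \<le> norm v * norm w"
proof -
  have "norm (cdot v (cnj_vec w)) \<le> (\<Sum>i\<in>UNIV. \<bar>norm (v $ i)\<bar> * \<bar>norm (w $ i)\<bar>)"
    unfolding cdot_def cnj_vec_def by (rule order_trans[OF norm_sum]) (simp add: norm_mult)
  also have "\<dots> \<le> L2_set (\<lambda>i. norm (v $ i)) UNIV * L2_set (\<lambda>i. norm (w $ i)) UNIV"
    by (rule L2_set_mult_ineq)
  finally show ?thesis
    by (simp add: norm_vec_def)
qed

text \<open>Compact support makes all three integrals finite, so the extended inequality descends to
  real numbers, where limits are taken later.\<close>

lemma Nash_integral:
  fixes f :: "real^'n \<Rightarrow> complex"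
  assumes f: "C_times (Suc 0) f" and zero: "\<And>X. X \<notin> cball x R \<Longrightarrow> f X = 0"
  defines "V t \<equiv> measure lborel (ball (0 :: real^'n) t)"
  shows "V t * (2 * (\<integral>X. (norm (f X))\<^sup>2 \<partial>lborel))
    \<le> 2 * (\<integral>X. norm (f X) \<partial>lborel)\<^sup>2 + V t * (t\<^sup>2 * (\<integral>X. (norm (gradient f X))\<^sup>2 \<partial>lborel))"
proof -
  have f0: "continuous_on UNIV f"
    by (rule C_times_continuous[OF f])
  have G0: "continuous_on UNIV (gradient f)"
    by (rule continuous_gradient[OF f])
  have Gz: "gradient f X = 0" if "X \<notin> cball x R" for X
    by (rule gradient_zero_outside[of "cball x R" f]) (use zero that in auto)
  have "integrable lborel (\<lambda>X. norm (f X))" "integrable lborel (\<lambda>X. (norm (f X))\<^sup>2)"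
    "integrable lborel (\<lambda>X. (norm (gradient f X))\<^sup>2)"
    by (rule integrable_compact_support[of _ x R]; (intro continuous_intros f0 G0)?; simp add: zero Gz del: mem_cball)+
  then have 1: "(\<integral>\<^sup>+X. ennreal (norm (f X)) \<partial>lborel) = ennreal (\<integral>X. norm (f X) \<partial>lborel)"
    and 2: "(\<integral>\<^sup>+X. ennreal ((norm (f X))\<^sup>2) \<partial>lborel) = ennreal (\<integral>X. (norm (f X))\<^sup>2 \<partial>lborel)"
    and 3: "(\<integral>\<^sup>+X. ennreal ((norm (gradient f X))\<^sup>2) \<partial>lborel) = ennreal (\<integral>X. (norm (gradient f X))\<^sup>2 \<partial>lborel)"
    by (simp_all add: nn_integral_eq_integral)
  have "emeasure lborel (ball (0 :: real^'n) t) < \<infinity>"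
    by (rule emeasure_bounded_finite) simp
  then have 4: "emeasure lborel (ball (0 :: real^'n) t) = ennreal (V t)"
    unfolding V_def by (simp add: emeasure_eq_ennreal_measure)
  have "ennreal (V t * (2 * (\<integral>X. (norm (f X))\<^sup>2 \<partial>lborel)))
      = ennreal (V t) * (2 * ennreal (\<integral>X. (norm (f X))\<^sup>2 \<partial>lborel))"
    by (simp add: ennreal_mult' V_def)
  also have "\<dots> \<le> 2 * (ennreal (\<integral>X. norm (f X) \<partial>lborel))\<^sup>2
      + ennreal (V t) * (ennreal (t\<^sup>2) * ennreal (\<integral>X. (norm (gradient f X))\<^sup>2 \<partial>lborel))"
    using Nash_nn_integral[OF f, of t] by (simp only: 1 2 3 4)
  also have "\<dots> = ennreal (2 * (\<integral>X. norm (f X) \<partial>lborel)\<^sup>2 + V t * (t\<^sup>2 * (\<integral>X. (norm (gradient f X))\<^sup>2 \<partial>lborel)))"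
    by (simp add: ennreal_mult' V_def ennreal_power)
  finally show ?thesis
    by (subst (asm) ennreal_le_iff) (simp_all add: V_def)
qed

lemma local_solution_exists:
  fixes u :: "real^'n \<Rightarrow> complex"
  assumes "open \<Omega>" and ell: "q_elliptic \<Omega> A q lamq" "lam \<le> lamq" and bound: "Linf_norm \<Omega> A \<le> ennreal M"
    and ball: "cball x S \<subseteq> \<Omega>" and sol: "weak_solution \<Omega> A u" and "1 < q" "0 < lam"
  obtains u' G' H' where "local_solution u' G' H' x S lam (max M 0) q"
    "AE X in lebesgue. X \<in> cball x S \<longrightarrow> u' X = u X \<and> G' X = weak_gradient \<Omega> u X"
proof -
  let ?K = "cball x S"
  define G where "G = weak_gradient \<Omega> u"
  have "\<exists>G. has_weak_gradient \<Omega> u G"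
    using sol by (simp add: weak_solution_def W12_loc_def)
  then have wg: "has_weak_gradient \<Omega> u G"
    unfolding G_def weak_gradient_def by (rule someI_ex)
  have \<Omega>: "\<Omega> \<inter> space lebesgue \<in> sets lebesgue"
    using \<open>open \<Omega>\<close> by simp
  have um: "u \<in> borel_measurable (lebesgue_on \<Omega>)" and ui: "set_integrable lebesgue ?K (\<lambda>X. (norm (u X))\<^sup>2)"
    and Gm: "G \<in> borel_measurable (lebesgue_on \<Omega>)" and Gi: "set_integrable lebesgue ?K (\<lambda>X. (norm (G X))\<^sup>2)"
    using wg ball by (auto simp: has_weak_gradient_def L2_loc_def)
  have Am: "A \<in> borel_measurable (lebesgue_on \<Omega>)"
    using ell by (simp add: q_elliptic_def Linf_def)
  \<comment> \<open>\<open>M\<close> may be any real number and \<open>ennreal\<close> sends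
    negative ones to 0; \<open>max M 0\<close> is the effective bound.\<close>
  have A_le: "AE X in lebesgue. X \<in> \<Omega> \<longrightarrow> norm (A X) \<le> max M 0"
  proof -
    have "AE X in lebesgue_on \<Omega>. ennreal (norm (A X)) \<le> Linf_norm \<Omega> A"
      unfolding Linf_norm_def by (rule esssup_AE)
    then have "AE X in lebesgue_on \<Omega>. norm (A X) \<le> max M 0"
    proof eventually_elim
      case (elim X)
      have "ennreal (norm (A X)) \<le> ennreal (max M 0)"
        using order_trans[OF order_trans[OF elim bound] ennreal_leI[of M "max M 0"]] by simp
      then show ?case
        by (simp only: ennreal_le_iff max.cobounded2)
    qed
    then show ?thesis
      by (simp add: AE_restrict_space_iff[OF \<Omega>])
  qed
  have A_ell: "AE X in lebesgue. X \<in> \<Omega> \<longrightarrow>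
      (\<forall>\<xi>. Re (cdot (A X *v \<xi>) (cnj_vec (J q \<xi>))) \<ge> lam * (norm \<xi>)\<^sup>2)"
  proof -
    have "AE X in lebesgue_on \<Omega>. \<forall>\<xi>. Re (cdot (A X *v \<xi>) (cnj_vec (J q \<xi>))) \<ge> lam * (norm \<xi>)\<^sup>2"
      using ell unfolding q_elliptic_def
      by (auto elim!: eventually_mono intro: order_trans[OF mult_right_mono])
    then show ?thesis
      by (simp add: AE_restrict_space_iff[OF \<Omega>])
  qed
  \<comment> \<open>The flux receives a Borel representative of its own. The matrix survives only
    inside a pointwise existence statement, which holds almost everywhere and involves no
    measurability.\<close>
  define H where "H X = A X *v G X" for X
  have Aijm: "(\<lambda>X. A X $ i $ j) \<in> borel_measurable (lebesgue_on \<Omega>)" for i j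
    by (rule borel_measurable_continuous_on[OF _ Am]) (intro continuous_intros)
  have Hm: "H \<in> borel_measurable (lebesgue_on \<Omega>)"
    unfolding H_def[abs_def] matrix_vector_mult_def
    by (intro borel_measurable_vec_lambda_complex borel_measurable_sum borel_measurable_times
        Aijm borel_measurable_vec_nth_complex[OF Gm])
  have KL: "?K \<in> sets lebesgue"
    by simp
  have Hi: "set_integrable lebesgue ?K (\<lambda>X. (norm (H X))\<^sup>2)"
    unfolding set_integrable_def
  proof (rule Bochner_Integration.integrable_bound)
    show "integrable lebesgue (\<lambda>X. (max M 0)\<^sup>2 * (indicator ?K X *\<^sub>R (norm (G X))\<^sup>2))"
      using Gi by (simp add: set_integrable_def)
    define f where "f X = indicator \<Omega> X *\<^sub>R H X" for X
    have "f \<in> borel_measurable lebesgue"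
      unfolding f_def[abs_def] using Hm \<open>open \<Omega>\<close> by (subst (asm) borel_measurable_restrict_space_iff) auto
    then have "(\<lambda>X. indicator ?K X *\<^sub>R (norm (f X))\<^sup>2) \<in> borel_measurable lebesgue"
      using KL by (intro borel_measurable_scaleR borel_measurable_power
          measurable_compose[OF _ borel_measurable_norm] borel_measurable_indicator)
    moreover have "(\<lambda>X. indicator ?K X *\<^sub>R (norm (f X))\<^sup>2)
        = (\<lambda>X. indicator ?K X *\<^sub>R (norm (H X))\<^sup>2)"
      using ball by (auto simp: f_def indicator_def fun_eq_iff simp del: mem_cball)
    ultimately show "(\<lambda>X. indicator ?K X *\<^sub>R (norm (H X))\<^sup>2) \<in> borel_measurable lebesgue"
      by simp
    show "AE X in lebesgue. norm (indicator ?K X *\<^sub>R (norm (H X))\<^sup>2)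
        \<le> norm ((max M 0)\<^sup>2 * (indicator ?K X *\<^sub>R (norm (G X))\<^sup>2))"
      using A_le
    proof eventually_elim
      case (elim X)
      have "(norm (H X))\<^sup>2 \<le> (max M 0)\<^sup>2 * (norm (G X))\<^sup>2" if "X \<in> \<Omega>"
      proof -
        have "norm (H X) \<le> max M 0 * norm (G X)"
          unfolding H_def using elim that
          by (intro order_trans[OF norm_matrix_vector_mult_le mult_right_mono]) auto
        then have "(norm (H X))\<^sup>2 \<le> (max M 0 * norm (G X))\<^sup>2"
          by (intro power_mono) auto
        then show ?thesis
          by (simp add: power_mult_distrib)
      qed
      then show ?case
        using ball by (cases "X \<in> ?K") (auto simp del: mem_cball)
    qed
  qed
  obtain u' where u': "u' \<in> borel_measurable borel" "AE X in lebesgue. X \<in> ?K \<longrightarrow> u' X = u X"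
    "\<And>X. X \<notin> ?K \<Longrightarrow> u' X = 0" "integrable lborel (\<lambda>X. (norm (u' X))\<^sup>2)"
    by (rule borel_version_on_compact[OF \<open>open \<Omega>\<close> compact_cball ball um ui]) (rule that)
  obtain G' where G': "G' \<in> borel_measurable borel" "AE X in lebesgue. X \<in> ?K \<longrightarrow> G' X = G X"
    "\<And>X. X \<notin> ?K \<Longrightarrow> G' X = 0" "integrable lborel (\<lambda>X. (norm (G' X))\<^sup>2)"
    by (rule borel_version_component[OF \<open>open \<Omega>\<close> compact_cball ball Gm Gi]) (rule that)
  obtain H' where H': "H' \<in> borel_measurable borel" "AE X in lebesgue. X \<in> ?K \<longrightarrow> H' X = H X"
    "\<And>X. X \<notin> ?K \<Longrightarrow> H' X = 0" "integrable lborel (\<lambda>X. (norm (H' X))\<^sup>2)"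
    by (rule borel_version_component[OF \<open>open \<Omega>\<close> compact_cball ball Hm Hi]) (rule that)
  have H'i_m: "(\<lambda>X. H' X $ i) \<in> borel_measurable borel" for i
    by (rule borel_measurable_vec_nth_complex[OF H'(1)])
  have H'i: "integrable lborel (\<lambda>X. H' X $ i)" for i
  proof (rule integrable_square_bounded_support[OF H'i_m])
    show "integrable lborel (\<lambda>X. (norm (H' X $ i))\<^sup>2)"
      by (rule Bochner_Integration.integrable_bound[OF H'(4)])
        (use H'i_m in \<open>auto intro!: AE_I2 power_mono Finite_Cartesian_Product.norm_nth_le\<close>)
    show "H' X $ i = 0" if "X \<notin> ?K" for X
      using H'(3)[OF that] by simp
  qed
  have test: "(\<integral>X. cdot (H' X) (cnj_vec (gradient \<Psi> X)) \<partial>lborel) = 0"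
    if \<Psi>: "\<Psi> \<in> test_functions \<Omega>" and zero: "\<And>X. X \<notin> ?K \<Longrightarrow> \<Psi> X = 0" for \<Psi>
  proof -
    have \<Psi>1: "C_times (Suc 0) \<Psi>"
      using \<Psi> by (simp add: test_functions_def del: C_times.simps)
    have diff: "\<Psi> differentiable (at X)" for X
      using \<Psi>1 by simp
    have wm: "(\<lambda>X. cnj (gradient \<Psi> X $ i)) \<in> borel_measurable borel" for i
      using \<Psi>1 by (auto intro!: borel_measurable_continuous_onI continuous_on_cnj)
    have gz: "gradient \<Psi> X = 0" if "X \<notin> ?K" for X
      by (rule gradient_zero_outside[of ?K \<Psi>]) (use zero that in auto)
    have m: "(\<lambda>X. cdot (H' X) (cnj_vec (gradient \<Psi> X))) \<in> borel_measurable borel"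
      unfolding cdot_def cnj_vec_def vec_lambda_beta
      by (intro borel_measurable_sum borel_measurable_times H'i_m wm)
    have "(\<integral>X. cdot (H' X) (cnj_vec (gradient \<Psi> X)) \<partial>lborel)
        = (\<integral>X. cdot (H' X) (cnj_vec (gradient \<Psi> X)) \<partial>lebesgue)"
      using m by (intro integral_completion[symmetric]) simp
    also have "\<dots> = (LINT X:\<Omega>|lebesgue. cdot (A X *v weak_gradient \<Omega> u X) (gradient (\<lambda>Y. cnj (\<Psi> Y)) X))"
      unfolding set_lebesgue_integral_def gradient_cnj[OF diff] G_def[symmetric] H_def[symmetric]
    proof (rule Bochner_Integration.integral_cong_AE)
      show "(\<lambda>X. cdot (H' X) (cnj_vec (gradient \<Psi> X))) \<in> borel_measurable lebesgue"
        using m by (intro measurable_completion) simp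
      have "(\<lambda>X. indicator \<Omega> X *\<^sub>R (H X $ i)) \<in> borel_measurable lebesgue" for i
        using borel_measurable_vec_nth_complex[OF Hm, of i] \<open>open \<Omega>\<close>
        by (subst (asm) borel_measurable_restrict_space_iff) auto
      moreover have "(\<lambda>X. cnj (gradient \<Psi> X $ i)) \<in> borel_measurable lebesgue" for i
        using wm[of i] by (intro measurable_completion) simp
      ultimately have "(\<lambda>X. \<Sum>i\<in>UNIV. (indicator \<Omega> X *\<^sub>R (H X $ i)) * cnj (gradient \<Psi> X $ i)) \<in> borel_measurable lebesgue"
        by (intro borel_measurable_sum borel_measurable_times)
      then show "(\<lambda>X. indicator \<Omega> X *\<^sub>R cdot (H X) (cnj_vec (gradient \<Psi> X))) \<in> borel_measurable lebesgue"
        by (simp add: cdot_def cnj_vec_def scaleR_sum_right)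
      show "AE X in lebesgue. cdot (H' X) (cnj_vec (gradient \<Psi> X))
          = indicator \<Omega> X *\<^sub>R cdot (H X) (cnj_vec (gradient \<Psi> X))"
        using H'(2)
      proof eventually_elim
        case (elim X)
        show ?case
        proof (cases "X \<in> ?K")
          case True
          with elim ball show ?thesis
            by (auto simp del: mem_cball)
        next
          case False
          then show ?thesis
            by (simp add: gz cdot_def cnj_vec_def)
        qed
      qed
    qed
    also have "\<dots> = 0"
      using sol \<Psi> by (simp add: weak_solution_def)
    finally show ?thesis .
  qed
  have "local_solution u' G' H' x S lam (max M 0) q"
  proof
    show "\<exists>v W. (\<forall>k :: nat. C_times (Suc 0) (v k)) \<and> integrable lborel W \<and>
      (AE X in lborel. X \<in> cball x R \<longrightarrow>
        (\<lambda>k. v k X) \<longlonglongrightarrow> u' X \<and> (\<forall>i. (\<lambda>k. gradient (v k) X $ i) \<longlonglongrightarrow> G' X $ i)) \<and>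
      (AE X in lborel. X \<in> cball x R \<longrightarrow>
        (\<forall>k. (norm (v k X))\<^sup>2 \<le> W X \<and> (\<forall>i. (norm (gradient (v k) X $ i))\<^sup>2 \<le> W X)))" if "R < S" for R
      by (rule weak_gradient_approximation[OF wg \<open>open \<Omega>\<close> ball that u' G'])
    show "(\<integral>X. cdot (H' X) (cnj_vec (gradient \<Psi> X)) \<partial>lborel) = 0"
      if "R < S" "C_times (Suc 0) \<Psi>" "\<And>X. X \<notin> cball x R \<Longrightarrow> \<Psi> X = 0" for \<Psi> R
      by (rule weak_formulation_C1[OF H'(1) H'i test ball that])
    have "AE X in lebesgue. X \<in> ?K \<longrightarrow> (\<exists>A. norm A \<le> max M 0 \<and> H' X = A *v G' X \<and>
      (\<forall>\<xi>. Re (cdot (A *v \<xi>) (cnj_vec (J q \<xi>))) \<ge> lam * (norm \<xi>)\<^sup>2))"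
      using H'(2) G'(2) A_le A_ell
    proof eventually_elim
      case (elim X)
      show ?case
      proof
        assume X: "X \<in> ?K"
        with ball have "X \<in> \<Omega>"
          by blast
        with X elim show "\<exists>A. norm A \<le> max M 0 \<and> H' X = A *v G' X \<and>
            (\<forall>\<xi>. Re (cdot (A *v \<xi>) (cnj_vec (J q \<xi>))) \<ge> lam * (norm \<xi>)\<^sup>2)"
          by (intro exI[of _ "A X"]) (simp add: H_def del: mem_cball)
      qed
    qed
    then show "AE X in lborel. X \<in> ?K \<longrightarrow> (\<exists>A. norm A \<le> max M 0 \<and> H' X = A *v G' X \<and>
      (\<forall>\<xi>. Re (cdot (A *v \<xi>) (cnj_vec (J q \<xi>))) \<ge> lam * (norm \<xi>)\<^sup>2))"
      by (simp only: AE_completion_iff)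
  qed (use u' G' H' \<open>1 < q\<close> \<open>0 < lam\<close> in auto)
  moreover have "AE X in lebesgue. X \<in> ?K \<longrightarrow> u' X = u X \<and> G' X = weak_gradient \<Omega> u X"
    using u'(2) G'(2) by eventually_elim (simp add: G_def)
  ultimately show ?thesis
    by (rule that)
qed

section \<open>Chain rule and energy estimate for regularized powers\<close>

lemma mult_le_sum_power2: "a * b \<le> a\<^sup>2 + (b :: real)\<^sup>2"
  using sum_squares_bound[of a b] sum_power2_ge_zero[of a b] by linarith

lemma gradient_mult:
  assumes "f differentiable (at X)" "g differentiable (at X)"
  shows "gradient (\<lambda>X. f X * g X) X $ i = f X * gradient g X $ i + gradient f X $ i * g X"
proof -
  have "((\<lambda>X. f X * g X) has_derivative
      (\<lambda>h. f X * frechet_derivative g (at X) h + frechet_derivative f (at X) h * g X)) (at X)"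
    using assms by (intro has_derivative_mult) (simp_all add: frechet_derivative_works[symmetric])
  from gradient_nth[OF this] show ?thesis
    by (simp add: gradient_def)
qed

lemma reg_power_comp_has_derivative:
  assumes "f differentiable (at X)" "0 < \<epsilon>"
  shows "((\<lambda>X. reg_power a \<epsilon> (f X)) has_derivative
    (\<lambda>h. reg_power_deriv a \<epsilon> (f X) (frechet_derivative f (at X) h))) (at X)"
  using has_derivative_compose[OF _ reg_power_has_derivative[OF assms(2)], of f "frechet_derivative f (at X)" X UNIV]
    assms(1) by (simp add: frechet_derivative_works[symmetric])

lemma C1_reg_power_comp:
  assumes f: "C_times (Suc 0) f" and "0 < \<epsilon>"
  shows "C_times (Suc 0) (\<lambda>X. reg_power a \<epsilon> (f X))"
    and "gradient (\<lambda>X. reg_power a \<epsilon> (f X)) X $ i = reg_power_deriv a \<epsilon> (f X) (gradient f X $ i)"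
proof -
  have D: "((\<lambda>X. reg_power a \<epsilon> (f X)) has_derivative
    (\<lambda>h. reg_power_deriv a \<epsilon> (f X) (frechet_derivative f (at X) h))) (at X)" for X
    using f \<open>0 < \<epsilon>\<close> by (intro reg_power_comp_has_derivative) simp_all
  have "continuous_on UNIV (\<lambda>X. (f X, gradient f X $ i))" for i
    using f C_times_continuous[OF f] by (intro continuous_on_Pair) simp_all
  from continuous_on_compose2[OF continuous_reg_power_deriv[OF \<open>0 < \<epsilon>\<close>] this]
  have "continuous_on UNIV (\<lambda>X. reg_power_deriv a \<epsilon> (f X) (gradient f X $ i))" for i
    by simp
  then show "C_times (Suc 0) (\<lambda>X. reg_power a \<epsilon> (f X))"
    by (intro C_times_SucI[OF D]) (simp add: gradient_def)
  show "gradient (\<lambda>X. reg_power a \<epsilon> (f X)) X $ i = reg_power_deriv a \<epsilon> (f X) (gradient f X $ i)"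
    by (simp only: gradient_nth[OF D]) (simp add: gradient_def)
qed

context local_solution
begin

lemma G_nth_meas [measurable]: "(\<lambda>X. G X $ i) \<in> borel_measurable borel"
  by (rule borel_measurable_vec_nth_complex) measurable

lemma H_nth_meas [measurable]: "(\<lambda>X. H X $ i) \<in> borel_measurable borel"
  by (rule borel_measurable_vec_nth_complex) measurable

text \<open>The gradient that the product and chain rules assign to
  \<open>reg_power a \<epsilon> (u X) * \<eta> X\<close>, with \<open>G\<close> standing for the
  gradient of \<open>u\<close>.\<close>

definition chain_grad :: "real \<Rightarrow> real \<Rightarrow> (real^'n \<Rightarrow> complex) \<Rightarrow> real^'n \<Rightarrow> complex^'n" where
  "chain_grad a \<epsilon> \<eta> X = (\<chi> i. reg_power_deriv a \<epsilon> (u X) (G X $ i) * \<eta> X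
    + reg_power a \<epsilon> (u X) * gradient \<eta> X $ i)"

lemma reg_power_u_meas: "0 < \<epsilon> \<Longrightarrow> (\<lambda>X. reg_power a \<epsilon> (u X)) \<in> borel_measurable borel"
  by (rule borel_measurable_continuous_on[OF continuous_reg_power u_meas])

lemma reg_power_deriv_u_meas:
  assumes "0 < \<epsilon>"
  shows "(\<lambda>X. reg_power_deriv a \<epsilon> (u X) (G X $ i)) \<in> borel_measurable borel"
proof -
  have "(\<lambda>X. (u X, G X $ i)) \<in> borel_measurable borel"
    by measurable
  from borel_measurable_continuous_on[OF continuous_reg_power_deriv[OF assms] this] show ?thesis
    by simp
qed

lemma chain_grad_meas:
  assumes "0 < \<epsilon>" and \<eta>: "C_times (Suc 0) \<eta>"
  shows "chain_grad a \<epsilon> \<eta> \<in> borel_measurable borel"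
proof -
  have "\<eta> \<in> borel_measurable borel" "(\<lambda>X. gradient \<eta> X $ i) \<in> borel_measurable borel" for i
    using C_times_continuous[OF \<eta>] \<eta> by (auto intro!: borel_measurable_continuous_onI)
  then show ?thesis
    unfolding chain_grad_def[abs_def]
    by (intro borel_measurable_vec_lambda_complex borel_measurable_add borel_measurable_times
        reg_power_u_meas reg_power_deriv_u_meas assms(1))
qed

text \<open>The approximants are regularized powers of the mollified solution times \<eta>. For
  fixed \<epsilon> the map \<open>reg_power a \<epsilon>\<close> has linear growth and bounded
  derivative, so the square integrable majorants of the mollifications carry over.\<close>

lemma chain_approximation:
  assumes "R < S" and \<eta>: "C_times (Suc 0) \<eta>" and \<eta>z: "\<And>X. X \<notin> cball x R \<Longrightarrow> \<eta> X = 0"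
    and \<epsilon>: "0 < \<epsilon>" "\<epsilon> \<le> 1"
  shows "\<exists>\<Psi> W. (\<forall>k :: nat. C_times (Suc 0) (\<Psi> k)) \<and> (\<forall>k X. X \<notin> cball x R \<longrightarrow> \<Psi> k X = 0) \<and> integrable lborel W \<and>
    (AE X in lborel. (\<lambda>k. \<Psi> k X) \<longlonglongrightarrow> reg_power a \<epsilon> (u X) * \<eta> X) \<and>
    (AE X in lborel. (\<lambda>k. gradient (\<Psi> k) X) \<longlonglongrightarrow> chain_grad a \<epsilon> \<eta> X) \<and>
    (AE X in lborel. \<forall>k. (norm (\<Psi> k X))\<^sup>2 \<le> W X \<and> (norm (gradient (\<Psi> k) X))\<^sup>2 \<le> W X)"
proof -
  obtain v W where v: "\<And>k :: nat. C_times (Suc 0) (v k)" and W: "integrable lborel W"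
    and lim: "AE X in lborel. X \<in> cball x R \<longrightarrow>
        (\<lambda>k. v k X) \<longlonglongrightarrow> u X \<and> (\<forall>i. (\<lambda>k. gradient (v k) X $ i) \<longlonglongrightarrow> G X $ i)"
    and le: "AE X in lborel. X \<in> cball x R \<longrightarrow>
        (\<forall>k. (norm (v k X))\<^sup>2 \<le> W X \<and> (\<forall>i. (norm (gradient (v k) X $ i))\<^sup>2 \<le> W X))"
    using approximation[OF \<open>R < S\<close>] by blast
  define \<Psi> where "\<Psi> k X = reg_power a \<epsilon> (v k X) * \<eta> X" for k X
  have Fv: "C_times (Suc 0) (\<lambda>X. reg_power a \<epsilon> (v k X))" for k
    by (rule C1_reg_power_comp(1)[OF v \<epsilon>(1)])
  have \<Psi>: "C_times (Suc 0) (\<Psi> k)" for k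
    unfolding \<Psi>_def by (rule C_times_mult[OF Fv \<eta>])
  have \<Psi>g: "gradient (\<Psi> k) X $ i = reg_power_deriv a \<epsilon> (v k X) (gradient (v k) X $ i) * \<eta> X
      + reg_power a \<epsilon> (v k X) * gradient \<eta> X $ i" for k X i
  proof -
    have "(\<lambda>X. reg_power a \<epsilon> (v k X)) differentiable (at X)" "\<eta> differentiable (at X)"
      using Fv[of k] \<eta> by simp_all
    from gradient_mult[OF this, of i] show ?thesis
      by (simp add: \<Psi>_def[abs_def] C1_reg_power_comp(2)[OF v \<epsilon>(1)])
  qed
  have \<eta>gz: "gradient \<eta> X = 0" if "X \<notin> cball x R" for X
    by (rule gradient_zero_outside[of "cball x R" \<eta>]) (use \<eta>z that in auto)
  obtain C1 where C1: "0 \<le> C1" "\<And>X. norm (\<eta> X) \<le> C1"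
    using bounded_compact_support[OF C_times_continuous[OF \<eta>] \<eta>z] by blast
  obtain C2 where C2: "0 \<le> C2" "\<And>X. norm (gradient \<eta> X) \<le> C2"
    using bounded_compact_support[OF continuous_gradient[OF \<eta>] \<eta>gz] by blast
  define L where "L = (2 / \<epsilon>) powr \<bar>a\<bar>"
  \<comment> \<open>One constant above all three products that occur: value times \<eta>, value
    times the gradient of \<eta>, and derivative times \<eta>.\<close>
  define c where "c = (1 + 2 * \<bar>a\<bar>) * L * (C1 + C2)"
  have L: "0 \<le> L"
    by (simp add: L_def)
  have F_le: "norm (reg_power a \<epsilon> z) \<le> L * norm z" for z
    unfolding norm_reg_power L_def using \<epsilon> by (intro mult_right_mono reg_powr_le) auto
  have D_le: "norm (reg_power_deriv a \<epsilon> z g) \<le> (1 + 2 * \<bar>a\<bar>) * L * norm g" for z g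
  proof -
    have "norm (reg_power_deriv a \<epsilon> z g) \<le> (1 + 2 * \<bar>a\<bar>) * (reg_powr a \<epsilon> ((norm z)\<^sup>2) * norm g)"
      by (rule norm_reg_power_deriv_le[OF \<epsilon>(1)])
    also have "\<dots> \<le> (1 + 2 * \<bar>a\<bar>) * (L * norm g)"
      unfolding L_def using \<epsilon> by (intro mult_left_mono mult_right_mono reg_powr_le) auto
    finally show ?thesis
      by (simp add: mult.assoc)
  qed
  have c: "0 \<le> c" "L * C1 \<le> c" "L * C2 \<le> c" "(1 + 2 * \<bar>a\<bar>) * L * C1 \<le> c"
  proof -
    have *: "1 * L \<le> (1 + 2 * \<bar>a\<bar>) * L"
      using L by (intro mult_right_mono) auto
    show "0 \<le> c" "(1 + 2 * \<bar>a\<bar>) * L * C1 \<le> c"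
      unfolding c_def using C1 C2 L by (auto intro!: mult_left_mono)
    show "L * C1 \<le> c" "L * C2 \<le> c"
      unfolding c_def using C1 C2 L * by (auto intro!: mult_mono)
  qed
  \<comment> \<open>A coordinate of the gradient is a sum of two terms, hence the 4, and there are
    \<open>CARD('n)\<close> coordinates; the 1 accounts for the function.
    \<open>\<bar>W X\<bar>\<close> is used since outside the ball nothing is known about the sign of
    \<open>W\<close>.\<close>
  have "AE X in lborel. \<forall>k. (norm (\<Psi> k X))\<^sup>2 \<le> (4 * real CARD('n) + 1) * c\<^sup>2 * \<bar>W X\<bar> \<and>
      (norm (gradient (\<Psi> k) X))\<^sup>2 \<le> (4 * real CARD('n) + 1) * c\<^sup>2 * \<bar>W X\<bar>"
    using le
  proof eventually_elim
    case (elim X)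
    show ?case
    proof (cases "X \<in> cball x R")
      case True
      show ?thesis
      proof (intro allI)
        fix k
        have W: "(norm (v k X))\<^sup>2 \<le> \<bar>W X\<bar>" "(norm (gradient (v k) X $ i))\<^sup>2 \<le> \<bar>W X\<bar>" for i
          using elim True by (auto intro: order_trans[OF _ abs_ge_self] simp del: mem_cball)
        have cW: "(c * norm (v k X))\<^sup>2 \<le> c\<^sup>2 * \<bar>W X\<bar>" "(c * norm (gradient (v k) X $ i))\<^sup>2 \<le> c\<^sup>2 * \<bar>W X\<bar>" for i
          unfolding power_mult_distrib using W by (auto intro!: mult_left_mono)
        have "norm (\<Psi> k X) \<le> (L * norm (v k X)) * C1"
          unfolding \<Psi>_def norm_mult using F_le C1 L by (intro mult_mono) auto
        also have "\<dots> = (L * C1) * norm (v k X)"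
          by simp
        also have "\<dots> \<le> c * norm (v k X)"
          using c by (intro mult_right_mono) auto
        finally have "(norm (\<Psi> k X))\<^sup>2 \<le> (c * norm (v k X))\<^sup>2"
          by (intro power_mono) auto
        with cW(1) have 1: "(norm (\<Psi> k X))\<^sup>2 \<le> c\<^sup>2 * \<bar>W X\<bar>"
          by linarith
        have 2: "(norm (gradient (\<Psi> k) X $ i))\<^sup>2 \<le> 4 * (c\<^sup>2 * \<bar>W X\<bar>)" for i
        proof -
          have "norm (reg_power_deriv a \<epsilon> (v k X) (gradient (v k) X $ i) * \<eta> X)
              \<le> ((1 + 2 * \<bar>a\<bar>) * L * norm (gradient (v k) X $ i)) * C1"
            unfolding norm_mult using D_le C1 L by (intro mult_mono) auto
          also have "\<dots> = ((1 + 2 * \<bar>a\<bar>) * L * C1) * norm (gradient (v k) X $ i)"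
            by simp
          also have "\<dots> \<le> c * norm (gradient (v k) X $ i)"
            using c by (intro mult_right_mono) auto
          finally have "(norm (reg_power_deriv a \<epsilon> (v k X) (gradient (v k) X $ i) * \<eta> X))\<^sup>2
              \<le> (c * norm (gradient (v k) X $ i))\<^sup>2"
            by (intro power_mono) auto
          with cW(2)[of i] have A: "(norm (reg_power_deriv a \<epsilon> (v k X) (gradient (v k) X $ i) * \<eta> X))\<^sup>2 \<le> c\<^sup>2 * \<bar>W X\<bar>"
            by linarith
          have "norm (reg_power a \<epsilon> (v k X) * gradient \<eta> X $ i) \<le> (L * norm (v k X)) * C2"
            unfolding norm_mult
            using F_le C2 L order_trans[OF Finite_Cartesian_Product.norm_nth_le C2(2)] by (intro mult_mono) auto
          also have "\<dots> = (L * C2) * norm (v k X)"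
            by simp
          also have "\<dots> \<le> c * norm (v k X)"
            using c by (intro mult_right_mono) auto
          finally have "(norm (reg_power a \<epsilon> (v k X) * gradient \<eta> X $ i))\<^sup>2 \<le> (c * norm (v k X))\<^sup>2"
            by (intro power_mono) auto
          with cW(1) have B: "(norm (reg_power a \<epsilon> (v k X) * gradient \<eta> X $ i))\<^sup>2 \<le> c\<^sup>2 * \<bar>W X\<bar>"
            by linarith
          show ?thesis
            unfolding \<Psi>g using A B
              norm_add_power2_le[of "reg_power_deriv a \<epsilon> (v k X) (gradient (v k) X $ i) * \<eta> X"
                "reg_power a \<epsilon> (v k X) * gradient \<eta> X $ i"] by linarith
        qed
        have "(norm (gradient (\<Psi> k) X))\<^sup>2 \<le> (\<Sum>i\<in>(UNIV :: 'n set). 4 * (c\<^sup>2 * \<bar>W X\<bar>))"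
          unfolding norm_vec_square by (intro sum_mono 2)
        then have 3: "(norm (gradient (\<Psi> k) X))\<^sup>2 \<le> 4 * real CARD('n) * (c\<^sup>2 * \<bar>W X\<bar>)"
          by (simp add: mult_ac)
        have "0 \<le> c\<^sup>2 * \<bar>W X\<bar>" "0 \<le> 4 * real CARD('n) * (c\<^sup>2 * \<bar>W X\<bar>)"
          by simp_all
        with 1 3 show "(norm (\<Psi> k X))\<^sup>2 \<le> (4 * real CARD('n) + 1) * c\<^sup>2 * \<bar>W X\<bar> \<and>
            (norm (gradient (\<Psi> k) X))\<^sup>2 \<le> (4 * real CARD('n) + 1) * c\<^sup>2 * \<bar>W X\<bar>"
          unfolding mult.assoc distrib_right mult_1 by linarith
      qed
    next
      case False
      have "gradient (\<Psi> k) X = 0" for k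
        unfolding vec_eq_iff \<Psi>g using \<eta>z[OF False] \<eta>gz[OF False] by simp
      moreover have "\<Psi> k X = 0" for k
        using \<eta>z[OF False] by (simp add: \<Psi>_def)
      ultimately show ?thesis
        by simp
    qed
  qed
  moreover have "AE X in lborel. (\<lambda>k. \<Psi> k X) \<longlonglongrightarrow> reg_power a \<epsilon> (u X) * \<eta> X \<and>
      (\<lambda>k. gradient (\<Psi> k) X) \<longlonglongrightarrow> chain_grad a \<epsilon> \<eta> X"
    using lim
  proof eventually_elim
    case (elim X)
    show ?case
    proof (cases "X \<in> cball x R")
      case True
      then have vl: "(\<lambda>k. v k X) \<longlonglongrightarrow> u X" and gl: "\<And>i. (\<lambda>k. gradient (v k) X $ i) \<longlonglongrightarrow> G X $ i"
        using elim by auto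
      have Fl: "(\<lambda>k. reg_power a \<epsilon> (v k X)) \<longlonglongrightarrow> reg_power a \<epsilon> (u X)"
        by (rule continuous_on_tendsto_compose[OF continuous_reg_power[OF \<epsilon>(1)] vl]) auto
      have Dl: "(\<lambda>k. reg_power_deriv a \<epsilon> (v k X) (gradient (v k) X $ i)) \<longlonglongrightarrow> reg_power_deriv a \<epsilon> (u X) (G X $ i)" for i
        using continuous_on_tendsto_compose[OF continuous_reg_power_deriv[OF \<epsilon>(1)] tendsto_Pair[OF vl gl[of i]]]
        by simp
      have "(\<lambda>k. gradient (\<Psi> k) X) \<longlonglongrightarrow> chain_grad a \<epsilon> \<eta> X"
        unfolding chain_grad_def
      proof (rule vec_tendstoI)
        fix i
        show "(\<lambda>k. gradient (\<Psi> k) X $ i) \<longlonglongrightarrow> (\<chi> i. reg_power_deriv a \<epsilon> (u X) (G X $ i) * \<eta> X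
            + reg_power a \<epsilon> (u X) * gradient \<eta> X $ i) $ i"
          unfolding \<Psi>g vec_lambda_beta by (intro tendsto_intros Fl Dl)
      qed
      moreover have "(\<lambda>k. \<Psi> k X) \<longlonglongrightarrow> reg_power a \<epsilon> (u X) * \<eta> X"
        unfolding \<Psi>_def by (intro tendsto_intros Fl)
      ultimately show ?thesis
        by blast
    next
      case False
      have "gradient (\<Psi> k) X = 0" for k
        unfolding vec_eq_iff \<Psi>g using \<eta>z[OF False] \<eta>gz[OF False] by simp
      moreover have "chain_grad a \<epsilon> \<eta> X = 0"
        unfolding vec_eq_iff chain_grad_def using \<eta>z[OF False] \<eta>gz[OF False] by simp
      ultimately show ?thesis
        using \<eta>z[OF False] by (simp add: \<Psi>_def)
    qed
  qed
  moreover have "integrable lborel (\<lambda>X. (4 * real CARD('n) + 1) * c\<^sup>2 * \<bar>W X\<bar>)"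
    using W by simp
  moreover have "\<forall>k X. X \<notin> cball x R \<longrightarrow> \<Psi> k X = 0"
    using \<eta>z by (simp add: \<Psi>_def)
  ultimately show ?thesis
    using \<Psi> by (intro exI[of _ \<Psi>] exI[of _ "\<lambda>X. (4 * real CARD('n) + 1) * c\<^sup>2 * \<bar>W X\<bar>"]) (simp add: AE_conj_iff)
qed

text \<open>The \<open>C^1\<close> approximants satisfy the equation, and \<open>norm (H X)\<close>
  times the norm of their gradients is dominated by
  \<open>(norm (H X))\<^sup>2 + W X\<close>.\<close>

lemma chain_weak_equation:
  assumes "R < S" and \<eta>: "C_times (Suc 0) \<eta>" and \<eta>z: "\<And>X. X \<notin> cball x R \<Longrightarrow> \<eta> X = 0"
    and \<epsilon>: "0 < \<epsilon>" "\<epsilon> \<le> 1"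
  shows "(\<integral>X. cdot (H X) (cnj_vec (chain_grad a \<epsilon> \<eta> X)) \<partial>lborel) = 0"
    and "integrable lborel (\<lambda>X. cdot (H X) (cnj_vec (chain_grad a \<epsilon> \<eta> X)))"
proof -
  obtain \<Psi> W where \<Psi>: "\<And>k :: nat. C_times (Suc 0) (\<Psi> k)" and \<Psi>z: "\<And>k X. X \<notin> cball x R \<Longrightarrow> \<Psi> k X = 0"
    and W: "integrable lborel W"
    and lim: "AE X in lborel. (\<lambda>k. gradient (\<Psi> k) X) \<longlonglongrightarrow> chain_grad a \<epsilon> \<eta> X"
    and le: "AE X in lborel. \<forall>k. (norm (\<Psi> k X))\<^sup>2 \<le> W X \<and> (norm (gradient (\<Psi> k) X))\<^sup>2 \<le> W X"
    using chain_approximation[OF assms, of a] by blast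
  have cdot_meas: "(\<lambda>X. cdot (H X) (cnj_vec (f X))) \<in> borel_measurable lborel"
    if f: "f \<in> borel_measurable borel" for f :: "real^'n \<Rightarrow> complex^'n"
  proof -
    have [measurable]: "(\<lambda>X. f X $ i) \<in> borel_measurable borel" for i
      by (rule borel_measurable_vec_nth_complex[OF f])
    have "(\<lambda>X. cnj (f X $ i)) \<in> borel_measurable borel" for i
      by (rule borel_measurable_continuous_on[where f = cnj]) (intro continuous_intros, measurable)
    then show ?thesis
      unfolding cdot_def cnj_vec_def vec_lambda_beta by measurable
  qed
  have gm: "gradient (\<Psi> k) \<in> borel_measurable borel" for k
    by (rule borel_measurable_continuous_onI[OF continuous_gradient[OF \<Psi>]])
  have w: "integrable lborel (\<lambda>X. (norm (H X))\<^sup>2 + W X)"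
    using H_L2 W by simp
  have b: "AE X in lborel. norm (cdot (H X) (cnj_vec (gradient (\<Psi> k) X))) \<le> (norm (H X))\<^sup>2 + W X" for k
    using le
  proof eventually_elim
    case (elim X)
    have "norm (cdot (H X) (cnj_vec (gradient (\<Psi> k) X))) \<le> norm (H X) * norm (gradient (\<Psi> k) X)"
      by (rule norm_cdot_le)
    also have "\<dots> \<le> (norm (H X))\<^sup>2 + (norm (gradient (\<Psi> k) X))\<^sup>2"
      by (rule mult_le_sum_power2)
    finally show ?case
      using elim[rule_format, of k] by linarith
  qed
  have l: "AE X in lborel. (\<lambda>k. cdot (H X) (cnj_vec (gradient (\<Psi> k) X))) \<longlonglongrightarrow> cdot (H X) (cnj_vec (chain_grad a \<epsilon> \<eta> X))"
    using lim
  proof eventually_elim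
    case (elim X)
    then show ?case
      unfolding cdot_def cnj_vec_def vec_lambda_beta by (intro tendsto_intros tendsto_cnj tendsto_vec_nth)
  qed
  note dc = cdot_meas[OF chain_grad_meas[OF \<epsilon>(1) \<eta>]] cdot_meas[OF gm] w l b
  show "integrable lborel (\<lambda>X. cdot (H X) (cnj_vec (chain_grad a \<epsilon> \<eta> X)))"
    by (rule integrable_dominated_convergence[OF dc])
  have "(\<lambda>k. \<integral>X. cdot (H X) (cnj_vec (gradient (\<Psi> k) X)) \<partial>lborel)
      \<longlonglongrightarrow> (\<integral>X. cdot (H X) (cnj_vec (chain_grad a \<epsilon> \<eta> X)) \<partial>lborel)"
    by (rule integral_dominated_convergence[OF dc])
  moreover have "(\<integral>X. cdot (H X) (cnj_vec (gradient (\<Psi> k) X)) \<partial>lborel) = 0" for k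
    by (rule weak_equation[OF \<open>R < S\<close> \<Psi> \<Psi>z])
  ultimately show "(\<integral>X. cdot (H X) (cnj_vec (chain_grad a \<epsilon> \<eta> X)) \<partial>lborel) = 0"
    by (simp add: LIMSEQ_const_iff)
qed

text \<open>The product need not be \<open>C^1\<close>, so the inequality is inherited from its
  approximants; all three integrals converge by domination.\<close>

lemma chain_Nash:
  fixes a :: real
  assumes "R < S" and \<eta>: "C_times (Suc 0) \<eta>" and \<eta>z: "\<And>X. X \<notin> cball x R \<Longrightarrow> \<eta> X = 0"
    and \<epsilon>: "0 < \<epsilon>" "\<epsilon> \<le> 1"
  defines "f X \<equiv> reg_power a \<epsilon> (u X) * \<eta> X" and "V t \<equiv> measure lborel (ball (0 :: real^'n) t)"
  shows "integrable lborel (\<lambda>X. (norm (chain_grad a \<epsilon> \<eta> X))\<^sup>2)"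
    and "V t * (2 * (\<integral>X. (norm (f X))\<^sup>2 \<partial>lborel))
      \<le> 2 * (\<integral>X. norm (f X) \<partial>lborel)\<^sup>2 + V t * (t\<^sup>2 * (\<integral>X. (norm (chain_grad a \<epsilon> \<eta> X))\<^sup>2 \<partial>lborel))"
proof -
  obtain \<Psi> W where \<Psi>: "\<And>k :: nat. C_times (Suc 0) (\<Psi> k)" and \<Psi>z: "\<And>k X. X \<notin> cball x R \<Longrightarrow> \<Psi> k X = 0"
    and W: "integrable lborel W"
    and limf: "AE X in lborel. (\<lambda>k. \<Psi> k X) \<longlonglongrightarrow> f X"
    and lim: "AE X in lborel. (\<lambda>k. gradient (\<Psi> k) X) \<longlonglongrightarrow> chain_grad a \<epsilon> \<eta> X"
    and le: "AE X in lborel. \<forall>k. (norm (\<Psi> k X))\<^sup>2 \<le> W X \<and> (norm (gradient (\<Psi> k) X))\<^sup>2 \<le> W X"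
    using chain_approximation[OF assms(1-5), of a] unfolding f_def by blast
  have [measurable]: "gradient (\<Psi> k) \<in> borel_measurable borel" for k
    by (rule borel_measurable_continuous_onI[OF continuous_gradient[OF \<Psi>]])
  have [measurable]: "\<Psi> k \<in> borel_measurable borel" for k
    by (rule borel_measurable_continuous_onI[OF C_times_continuous[OF \<Psi>]])
  have [measurable]: "chain_grad a \<epsilon> \<eta> \<in> borel_measurable borel"
    by (rule chain_grad_meas[OF \<epsilon>(1) \<eta>])
  have [measurable]: "\<eta> \<in> borel_measurable borel"
    by (rule borel_measurable_continuous_onI[OF C_times_continuous[OF \<eta>]])
  have [measurable]: "(\<lambda>X. reg_power a \<epsilon> (u X)) \<in> borel_measurable borel"
    by (rule reg_power_u_meas[OF \<epsilon>(1)])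
  have [measurable]: "f \<in> borel_measurable borel"
    unfolding f_def[abs_def] by measurable
  have "emeasure lborel (cball x R) < \<infinity>"
    by (intro emeasure_compact_finite) auto
  \<comment> \<open>The majorant for the first powers: \<open>t \<le> 1 + t\<^sup>2\<close> on the
    ball, which has finite measure, and zero outside.\<close>
  then have W1: "integrable lborel (\<lambda>X. indicator (cball x R) X + W X)"
    using W by (intro Bochner_Integration.integrable_add integrable_real_indicator) auto
  have g: "AE X in lborel. (\<lambda>k. (norm (gradient (\<Psi> k) X))\<^sup>2) \<longlonglongrightarrow> (norm (chain_grad a \<epsilon> \<eta> X))\<^sup>2"
    using lim by eventually_elim (intro tendsto_intros)
  have gb: "AE X in lborel. norm ((norm (gradient (\<Psi> k) X))\<^sup>2) \<le> W X" for k
    using le by eventually_elim simp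
  show "integrable lborel (\<lambda>X. (norm (chain_grad a \<epsilon> \<eta> X))\<^sup>2)"
    by (rule integrable_dominated_convergence[OF _ _ W g gb]) measurable
  have 1: "(\<lambda>k. \<integral>X. (norm (gradient (\<Psi> k) X))\<^sup>2 \<partial>lborel) \<longlonglongrightarrow> (\<integral>X. (norm (chain_grad a \<epsilon> \<eta> X))\<^sup>2 \<partial>lborel)"
    by (rule integral_dominated_convergence[OF _ _ W g gb]) measurable
  have 2: "(\<lambda>k. \<integral>X. (norm (\<Psi> k X))\<^sup>2 \<partial>lborel) \<longlonglongrightarrow> (\<integral>X. (norm (f X))\<^sup>2 \<partial>lborel)"
  proof (rule integral_dominated_convergence[OF _ _ W])
    show "AE X in lborel. (\<lambda>k. (norm (\<Psi> k X))\<^sup>2) \<longlonglongrightarrow> (norm (f X))\<^sup>2"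
      using limf by eventually_elim (intro tendsto_intros)
    show "AE X in lborel. norm ((norm (\<Psi> k X))\<^sup>2) \<le> W X" for k
      using le by eventually_elim simp
  qed measurable
  have 3: "(\<lambda>k. \<integral>X. norm (\<Psi> k X) \<partial>lborel) \<longlonglongrightarrow> (\<integral>X. norm (f X) \<partial>lborel)"
  proof (rule integral_dominated_convergence[OF _ _ W1])
    show "AE X in lborel. (\<lambda>k. norm (\<Psi> k X)) \<longlonglongrightarrow> norm (f X)"
      using limf by eventually_elim (intro tendsto_intros)
    show "AE X in lborel. norm (norm (\<Psi> k X)) \<le> indicator (cball x R) X + W X" for k
      using le
    proof eventually_elim
      case (elim X)
      then have W: "(norm (\<Psi> k X))\<^sup>2 \<le> W X"
        by blast
      show ?case
      proof (cases "X \<in> cball x R")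
        case True
        have "norm (\<Psi> k X) \<le> 1 + (norm (\<Psi> k X))\<^sup>2"
          using mult_le_sum_power2[of 1 "norm (\<Psi> k X)"] by simp
        with W True show ?thesis
          by simp
      next
        case False
        with W show ?thesis
          by (simp add: \<Psi>z del: mem_cball)
      qed
    qed
  qed measurable
  show "V t * (2 * (\<integral>X. (norm (f X))\<^sup>2 \<partial>lborel))
      \<le> 2 * (\<integral>X. norm (f X) \<partial>lborel)\<^sup>2 + V t * (t\<^sup>2 * (\<integral>X. (norm (chain_grad a \<epsilon> \<eta> X))\<^sup>2 \<partial>lborel))"
  proof (rule LIMSEQ_le)
    show "(\<lambda>k. V t * (2 * (\<integral>X. (norm (\<Psi> k X))\<^sup>2 \<partial>lborel))) \<longlonglongrightarrow> V t * (2 * (\<integral>X. (norm (f X))\<^sup>2 \<partial>lborel))"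
      by (intro tendsto_intros 2)
    show "(\<lambda>k. 2 * (\<integral>X. norm (\<Psi> k X) \<partial>lborel)\<^sup>2 + V t * (t\<^sup>2 * (\<integral>X. (norm (gradient (\<Psi> k) X))\<^sup>2 \<partial>lborel)))
        \<longlonglongrightarrow> 2 * (\<integral>X. norm (f X) \<partial>lborel)\<^sup>2 + V t * (t\<^sup>2 * (\<integral>X. (norm (chain_grad a \<epsilon> \<eta> X))\<^sup>2 \<partial>lborel))"
      by (intro tendsto_intros 1 3)
    show "\<exists>N. \<forall>k\<ge>N. V t * (2 * (\<integral>X. (norm (\<Psi> k X))\<^sup>2 \<partial>lborel))
        \<le> 2 * (\<integral>X. norm (\<Psi> k X) \<partial>lborel)\<^sup>2 + V t * (t\<^sup>2 * (\<integral>X. (norm (gradient (\<Psi> k) X))\<^sup>2 \<partial>lborel))"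
      unfolding V_def by (intro exI[of _ 0] allI impI Nash_integral[OF \<Psi> \<Psi>z])
  qed
qed

lemma reg_powr_u_meas:
  assumes "0 < \<epsilon>"
  shows "(\<lambda>X. reg_powr a \<epsilon> ((norm (u X))\<^sup>2)) \<in> borel_measurable borel"
proof -
  have "continuous_on {0..} (reg_powr a \<epsilon>)"
    using reg_powr_has_derivative[OF assms] DERIV_isCont
    by (fast intro: continuous_at_imp_continuous_on)
  then have "continuous_on UNIV (\<lambda>z :: complex. reg_powr a \<epsilon> ((norm z)\<^sup>2))"
    by (rule continuous_on_compose2) (auto intro!: continuous_intros)
  from borel_measurable_continuous_on[OF this u_meas] show ?thesis .
qed

text \<open>Boundedness of the weight makes the integrals finite before anything is estimated, so
  absorption is legitimate. It leaves \<open>lam / 2\<close> on the left and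
  \<open>2 * M\<^sup>2 / lam\<close> on the right; their quotient is the stated constant.\<close>

lemma Caccioppoli_regularized:
  assumes "R < S" and \<zeta>: "C_times (Suc 0) (\<lambda>X. complex_of_real (\<zeta> X))" and \<zeta>z: "\<And>X. X \<notin> cball x R \<Longrightarrow> \<zeta> X = 0"
    and \<zeta>0: "\<And>X. 0 \<le> \<zeta> X" and \<epsilon>: "0 < \<epsilon>" "\<epsilon> \<le> 1" and \<tau>: "0 \<le> \<tau>" "\<tau> \<le> 1" "2 * a = \<tau> * (q - 2)"
  defines "\<psi> X \<equiv> reg_powr a \<epsilon> ((norm (u X))\<^sup>2)" and "d X \<equiv> norm (gradient (\<lambda>X. complex_of_real (\<zeta> X)) X)"
  shows "integrable lborel (\<lambda>X. \<psi> X * (norm (G X))\<^sup>2 * (\<zeta> X)\<^sup>2)"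
    and "integrable lborel (\<lambda>X. \<psi> X * (norm (u X))\<^sup>2 * (d X)\<^sup>2)"
    and "(\<integral>X. \<psi> X * (norm (G X))\<^sup>2 * (\<zeta> X)\<^sup>2 \<partial>lborel)
      \<le> 4 * M\<^sup>2 / lam\<^sup>2 * (\<integral>X. \<psi> X * (norm (u X))\<^sup>2 * (d X)\<^sup>2 \<partial>lborel)"
proof -
  let ?z = "\<lambda>X. complex_of_real (\<zeta> X)"
  have zc: "continuous_on UNIV ?z"
    by (rule C_times_continuous[OF \<zeta>])
  then have \<zeta>c: "continuous_on UNIV \<zeta>"
    using continuous_on_Re[OF zc] by simp
  have gc: "continuous_on UNIV (gradient ?z)"
    by (rule continuous_gradient[OF \<zeta>])
  have gz: "gradient ?z X = 0" if "X \<notin> cball x R" for X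
    by (rule gradient_zero_outside[of "cball x R" ?z]) (use \<zeta>z that in auto)
  have [measurable]: "\<zeta> \<in> borel_measurable borel" "gradient ?z \<in> borel_measurable borel"
    by (auto intro!: borel_measurable_continuous_onI \<zeta>c gc)
  have \<psi>m [measurable]: "\<psi> \<in> borel_measurable borel"
    unfolding \<psi>_def[abs_def] by (rule reg_powr_u_meas[OF \<epsilon>(1)])
  have dm [measurable]: "d \<in> borel_measurable borel"
    unfolding d_def[abs_def] by measurable
  have \<psi>0: "0 < \<psi> X" for X
    by (simp add: \<psi>_def reg_powr_pos)
  define L where "L = (2 / \<epsilon>) powr \<bar>a\<bar>"
  have \<psi>L: "\<psi> X \<le> L" for X
    unfolding \<psi>_def L_def using \<epsilon> by (intro reg_powr_le) auto
  obtain C1 where C1: "0 \<le> C1" "\<And>X. norm (\<zeta> X) \<le> C1"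
    using bounded_compact_support[OF \<zeta>c \<zeta>z] by blast
  obtain C2 where C2: "0 \<le> C2" "\<And>X. d X \<le> C2"
    using bounded_compact_support[OF gc gz] unfolding d_def by blast
  have d0: "0 \<le> d X" for X
    by (simp add: d_def)
  have bound: "\<psi> X * s * t\<^sup>2 \<le> L * C\<^sup>2 * s" if "0 \<le> s" "\<bar>t\<bar> \<le> C" for X s t C
  proof -
    have "t\<^sup>2 \<le> C\<^sup>2"
      using that by (simp add: abs_le_square_iff[symmetric])
    then have "(\<psi> X * s) * t\<^sup>2 \<le> (L * s) * C\<^sup>2"
      using \<psi>L \<psi>0[of X] that(1) order_trans[OF less_imp_le[OF \<psi>0] \<psi>L]
      by (intro mult_mono mult_right_mono) auto
    then show ?thesis
      by (simp add: mult_ac)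
  qed
  show I1: "integrable lborel (\<lambda>X. \<psi> X * (norm (G X))\<^sup>2 * (\<zeta> X)\<^sup>2)"
  proof (rule Bochner_Integration.integrable_bound)
    show "integrable lborel (\<lambda>X. L * C1\<^sup>2 * (norm (G X))\<^sup>2)"
      using G_L2 by simp
    show "AE X in lborel. norm (\<psi> X * (norm (G X))\<^sup>2 * (\<zeta> X)\<^sup>2) \<le> norm (L * C1\<^sup>2 * (norm (G X))\<^sup>2)"
    proof (intro AE_I2)
      fix X
      have "0 \<le> \<psi> X * (norm (G X))\<^sup>2 * (\<zeta> X)\<^sup>2"
        using \<psi>0[of X] by simp
      moreover have "\<psi> X * (norm (G X))\<^sup>2 * (\<zeta> X)\<^sup>2 \<le> L * C1\<^sup>2 * (norm (G X))\<^sup>2"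
        using C1(2)[of X] by (intro bound) auto
      ultimately show "norm (\<psi> X * (norm (G X))\<^sup>2 * (\<zeta> X)\<^sup>2) \<le> norm (L * C1\<^sup>2 * (norm (G X))\<^sup>2)"
        unfolding real_norm_def by linarith
    qed
  qed measurable
  show I2: "integrable lborel (\<lambda>X. \<psi> X * (norm (u X))\<^sup>2 * (d X)\<^sup>2)"
  proof (rule Bochner_Integration.integrable_bound)
    show "integrable lborel (\<lambda>X. L * C2\<^sup>2 * (norm (u X))\<^sup>2)"
      using u_L2 by simp
    show "AE X in lborel. norm (\<psi> X * (norm (u X))\<^sup>2 * (d X)\<^sup>2) \<le> norm (L * C2\<^sup>2 * (norm (u X))\<^sup>2)"
    proof (intro AE_I2)
      fix X
      have "0 \<le> \<psi> X * (norm (u X))\<^sup>2 * (d X)\<^sup>2"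
        using \<psi>0[of X] by simp
      moreover have "\<psi> X * (norm (u X))\<^sup>2 * (d X)\<^sup>2 \<le> L * C2\<^sup>2 * (norm (u X))\<^sup>2"
        using C2(2)[of X] d0[of X] by (intro bound) auto
      ultimately show "norm (\<psi> X * (norm (u X))\<^sup>2 * (d X)\<^sup>2) \<le> norm (L * C2\<^sup>2 * (norm (u X))\<^sup>2)"
        unfolding real_norm_def by linarith
    qed
  qed measurable
  let ?\<eta> = "\<lambda>X. ?z X * ?z X"
  have \<eta>: "C_times (Suc 0) ?\<eta>"
    by (rule C_times_mult[OF \<zeta> \<zeta>])
  have \<eta>z: "?\<eta> X = 0" if "X \<notin> cball x R" for X
    using \<zeta>z[OF that] by simp
  have diff: "?z differentiable (at X)" for X
    using \<zeta> by simp
  have \<eta>g: "gradient ?\<eta> X $ i = 2 * ?z X * gradient ?z X $ i" for X i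
    by (simp add: gradient_mult[OF diff diff])
  have eq0: "(\<integral>X. cdot (H X) (cnj_vec (chain_grad a \<epsilon> ?\<eta> X)) \<partial>lborel) = 0"
    by (rule chain_weak_equation(1)[OF \<open>R < S\<close> \<eta> \<eta>z \<epsilon>])
  have eqi: "integrable lborel (\<lambda>X. cdot (H X) (cnj_vec (chain_grad a \<epsilon> ?\<eta> X)))"
    by (rule chain_weak_equation(2)[OF \<open>R < S\<close> \<eta> \<eta>z \<epsilon>])
  \<comment> \<open>The whole estimate is pointwise: integrating this bound against an integrand of
    total integral zero finishes the proof.\<close>
  have lower: "AE X in lborel. lam / 2 * (\<psi> X * (norm (G X))\<^sup>2 * (\<zeta> X)\<^sup>2) - 2 * M\<^sup>2 / lam * (\<psi> X * (norm (u X))\<^sup>2 * (d X)\<^sup>2)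
      \<le> Re (cdot (H X) (cnj_vec (chain_grad a \<epsilon> ?\<eta> X)))"
    using ellipticity
  proof eventually_elim
    case (elim X)
    show ?case
    proof (cases "X \<in> cball x R")
      case False
      then have "\<zeta> X = 0" "d X = 0"
        using \<zeta>z gz by (simp_all add: d_def del: mem_cball)
      moreover have "chain_grad a \<epsilon> ?\<eta> X = 0"
        unfolding vec_eq_iff chain_grad_def vec_lambda_beta \<eta>g using \<open>\<zeta> X = 0\<close> by simp
      ultimately show ?thesis
        by (simp add: cdot_def cnj_vec_def)
    next
      case True
      then have "X \<in> cball x S"
        using \<open>R < S\<close> by simp
      with elim obtain A where A: "norm A \<le> M" "H X = A *v G X"
        "\<And>\<xi>. Re (cdot (A *v \<xi>) (cnj_vec (J q \<xi>))) \<ge> lam * (norm \<xi>)\<^sup>2"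
        by blast
      define s where "s = (norm (u X))\<^sup>2"
      \<comment> \<open>Apart from the scalar \<open>\<psi> X * (\<zeta> X)\<^sup>2\<close>, the
        derivative of the power of \<open>u\<close> is \<open>E\<close>. Its radial coefficient
        satisfies \<open>k * (norm (u X))\<^sup>2 = \<theta> * (q - 2)\<close> with \<theta> equal
        to \<tau> times \<open>reg_slope \<epsilon> s * s\<close>; this lies in [0, 1], so the
        interpolated ellipticity applies whatever the size of \<open>u X\<close>.\<close>
      define k where "k = 2 * a * reg_slope \<epsilon> s"
      define E where "E = (\<chi> i. G X $ i + (k * Re (cnj (u X) * G X $ i)) *\<^sub>R u X)"
      have sl: "0 \<le> reg_slope \<epsilon> s * s" "reg_slope \<epsilon> s * s \<le> 1"
        using reg_slope_mult[OF \<epsilon>(1), of s] by (simp_all add: s_def)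
      have "k * (norm (u X))\<^sup>2 = (2 * a) * (reg_slope \<epsilon> s * s)"
        by (simp add: k_def s_def)
      then have "k * (norm (u X))\<^sup>2 = (\<tau> * (reg_slope \<epsilon> s * s)) * (q - 2)"
        unfolding \<tau>(3) by simp
      moreover have "0 \<le> \<tau> * (reg_slope \<epsilon> s * s)" "\<tau> * (reg_slope \<epsilon> s * s) \<le> 1"
        using \<tau> sl by (simp_all add: mult_le_one)
      ultimately have ellE: "lam * (norm (G X))\<^sup>2 \<le> Re (cdot (H X) (cnj_vec E))"
        unfolding A(2) E_def using q lam A(3) by (intro q_ellipticity_interpolated) auto
      have V: "chain_grad a \<epsilon> ?\<eta> X $ i = complex_of_real (\<psi> X * (\<zeta> X)\<^sup>2) * E $ i
          + complex_of_real (2 * \<psi> X * \<zeta> X) * u X * gradient ?z X $ i" for i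
        unfolding chain_grad_def vec_lambda_beta \<eta>g reg_power_deriv_def reg_power_def E_def k_def \<psi>_def s_def
          scaleR_conv_of_real
        by (simp add: power2_eq_square mult_ac)
      have Re_of_real_mult: "Re (complex_of_real r * z) = r * Re z" for r z
        by simp
      have "cdot (H X) (cnj_vec (chain_grad a \<epsilon> ?\<eta> X)) = complex_of_real (\<psi> X * (\<zeta> X)\<^sup>2) * cdot (H X) (cnj_vec E)
          + complex_of_real (2 * \<psi> X * \<zeta> X) * (cnj (u X) * cdot (H X) (cnj_vec (gradient ?z X)))"
        unfolding cdot_def cnj_vec_def vec_lambda_beta V sum_distrib_left sum.distrib[symmetric]
        by (intro sum.cong refl) (simp add: algebra_simps)
      then have re: "Re (cdot (H X) (cnj_vec (chain_grad a \<epsilon> ?\<eta> X))) = \<psi> X * (\<zeta> X)\<^sup>2 * Re (cdot (H X) (cnj_vec E))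
          + 2 * \<psi> X * \<zeta> X * Re (cnj (u X) * cdot (H X) (cnj_vec (gradient ?z X)))"
        by (simp only: plus_complex.sel Re_of_real_mult)
      define g where "g = norm (G X)"
      have "norm (cnj (u X) * cdot (H X) (cnj_vec (gradient ?z X))) \<le> norm (u X) * (norm (H X) * d X)"
        unfolding norm_mult d_def complex_mod_cnj by (intro mult_left_mono norm_cdot_le) auto
      also have "norm (H X) \<le> M * g"
        unfolding A(2) g_def by (rule order_trans[OF norm_matrix_vector_mult_le mult_right_mono[OF A(1)]]) simp
      finally have "norm (cnj (u X) * cdot (H X) (cnj_vec (gradient ?z X))) \<le> norm (u X) * ((M * g) * d X)"
        using d0 by (simp add: mult_left_mono mult_right_mono)
      then have cr: "- (norm (u X) * (M * g * d X)) \<le> Re (cnj (u X) * cdot (H X) (cnj_vec (gradient ?z X)))"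
        using abs_Re_le_cmod[of "cnj (u X) * cdot (H X) (cnj_vec (gradient ?z X))"] by linarith
      \<comment> \<open>The cross term is absorbed by \<open>2 p r \<le> (lam / 2) p\<^sup>2 + (2 / lam) r\<^sup>2\<close>.\<close>
      define p where "p = \<zeta> X * g"
      define r where "r = M * norm (u X) * d X"
      have young: "2 * (p * r) \<le> lam / 2 * p\<^sup>2 + 2 / lam * r\<^sup>2"
      proof -
        have "0 \<le> (lam * p - 2 * r)\<^sup>2 / (2 * lam)"
          using lam by simp
        also have "\<dots> = lam / 2 * p\<^sup>2 + 2 / lam * r\<^sup>2 - 2 * (p * r)"
          using lam by (simp add: power2_eq_square field_simps)
        finally show ?thesis
          by simp
      qed
      have "\<psi> X * (\<zeta> X)\<^sup>2 * (lam * g\<^sup>2) + 2 * \<psi> X * \<zeta> X * (- (norm (u X) * (M * g * d X)))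
          \<le> Re (cdot (H X) (cnj_vec (chain_grad a \<epsilon> ?\<eta> X)))"
        unfolding re using ellE cr \<psi>0[of X] \<zeta>0[of X] unfolding g_def
        by (intro add_mono mult_left_mono) auto
      moreover have "\<psi> X * (lam / 2 * p\<^sup>2 - 2 / lam * r\<^sup>2) \<le> \<psi> X * (lam * p\<^sup>2 - 2 * (p * r))"
        using young \<psi>0[of X] by (intro mult_left_mono) auto
      moreover have "\<psi> X * (lam * p\<^sup>2 - 2 * (p * r))
          = \<psi> X * (\<zeta> X)\<^sup>2 * (lam * g\<^sup>2) + 2 * \<psi> X * \<zeta> X * (- (norm (u X) * (M * g * d X)))"
        by (simp add: p_def r_def power2_eq_square algebra_simps)
      moreover have "\<psi> X * (lam / 2 * p\<^sup>2 - 2 / lam * r\<^sup>2)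
          = lam / 2 * (\<psi> X * (norm (G X))\<^sup>2 * (\<zeta> X)\<^sup>2) - 2 * M\<^sup>2 / lam * (\<psi> X * (norm (u X))\<^sup>2 * (d X)\<^sup>2)"
        by (simp add: p_def r_def g_def power2_eq_square algebra_simps)
      ultimately show ?thesis
        by linarith
    qed
  qed
  have "(\<integral>X. lam / 2 * (\<psi> X * (norm (G X))\<^sup>2 * (\<zeta> X)\<^sup>2) - 2 * M\<^sup>2 / lam * (\<psi> X * (norm (u X))\<^sup>2 * (d X)\<^sup>2) \<partial>lborel)
      \<le> (\<integral>X. Re (cdot (H X) (cnj_vec (chain_grad a \<epsilon> ?\<eta> X))) \<partial>lborel)"
    by (rule integral_mono_AE) (use I1 I2 lower integrable_Re[OF eqi] in auto)
  also have "\<dots> = Re (\<integral>X. cdot (H X) (cnj_vec (chain_grad a \<epsilon> ?\<eta> X)) \<partial>lborel)"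
    by (rule integral_Re[OF eqi])
  also have "\<dots> = 0"
    by (simp only: eq0 zero_complex.sel)
  finally have "lam / 2 * (\<integral>X. \<psi> X * (norm (G X))\<^sup>2 * (\<zeta> X)\<^sup>2 \<partial>lborel)
      \<le> 2 * M\<^sup>2 / lam * (\<integral>X. \<psi> X * (norm (u X))\<^sup>2 * (d X)\<^sup>2 \<partial>lborel)"
    using I1 I2 by simp
  then have "2 / lam * (lam / 2 * (\<integral>X. \<psi> X * (norm (G X))\<^sup>2 * (\<zeta> X)\<^sup>2 \<partial>lborel))
      \<le> 2 / lam * (2 * M\<^sup>2 / lam * (\<integral>X. \<psi> X * (norm (u X))\<^sup>2 * (d X)\<^sup>2 \<partial>lborel))"
    using lam by (intro mult_left_mono) auto
  then show "(\<integral>X. \<psi> X * (norm (G X))\<^sup>2 * (\<zeta> X)\<^sup>2 \<partial>lborel)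
      \<le> 4 * M\<^sup>2 / lam\<^sup>2 * (\<integral>X. \<psi> X * (norm (u X))\<^sup>2 * (d X)\<^sup>2 \<partial>lborel)"
    using lam by (simp add: power2_eq_square)
qed

end

text \<open>Iterate along \<open>R - (R - \<rho>) / 2\<^sup>i\<close>.\<close>

lemma absorption:
  fixes \<phi> :: "real \<Rightarrow> real"
  assumes "\<rho> < R" "0 \<le> K" and bdd: "\<And>s. \<rho> \<le> s \<Longrightarrow> s \<le> R \<Longrightarrow> \<phi> s \<le> B"
    and step: "\<And>s t. \<rho> \<le> s \<Longrightarrow> s < t \<Longrightarrow> t \<le> R \<Longrightarrow> \<phi> s \<le> K / (t - s) ^ n + \<phi> t / 2 ^ (n + 1)"
  shows "\<phi> \<rho> \<le> 2 ^ (n + 1) * K / (R - \<rho>) ^ n"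
proof -
  define r where "r i = R - (R - \<rho>) / 2 ^ i" for i :: nat
  define D where "D = 2 ^ n * K / (R - \<rho>) ^ n"
  have pos: "0 < R - \<rho>"
    using assms by simp
  have D0: "0 \<le> D"
    using pos \<open>0 \<le> K\<close> by (simp add: D_def)
  have r: "\<rho> \<le> r i" "r i < r (Suc i)" "r i \<le> R" for i
  proof -
    have "(R - \<rho>) / 2 ^ i \<le> (R - \<rho>) / 1"
      using pos by (intro divide_left_mono) auto
    then show "\<rho> \<le> r i"
      by (simp add: r_def)
    show "r i < r (Suc i)" "r i \<le> R"
      using pos by (simp_all add: r_def field_simps)
  qed
  have diff: "r (Suc i) - r i = (R - \<rho>) / 2 ^ (i + 1)" for i
    by (simp add: r_def field_simps)
  \<comment> \<open>The step widths halve, so the first term grows by \<open>2 ^ n\<close> per step,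
    while the accumulated factor decays by \<open>2 ^ (n + 1)\<close>. What remains is geometric
    with ratio 1/2, and boundedness of \<phi> makes the last term vanish in the limit.\<close>
  have it: "\<phi> \<rho> \<le> D * (\<Sum>i<N. (1 / 2) ^ i) + \<phi> (r N) / 2 ^ ((n + 1) * N)" for N
  proof (induction N)
    case 0
    then show ?case
      by (simp add: r_def)
  next
    case (Suc N)
    have "\<phi> (r N) \<le> K / (r (Suc N) - r N) ^ n + \<phi> (r (Suc N)) / 2 ^ (n + 1)"
      by (intro step r)
    also have "K / (r (Suc N) - r N) ^ n = D * 2 ^ (n * N)"
    proof -
      have "(2 ^ (N + 1)) ^ n = (2 :: real) ^ n * 2 ^ (n * N)"
        by (simp add: power_mult_distrib power_mult[symmetric] mult.commute)
      then show ?thesis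
        unfolding diff power_divide D_def by simp
    qed
    finally have "\<phi> (r N) / 2 ^ ((n + 1) * N) \<le> (D * 2 ^ (n * N) + \<phi> (r (Suc N)) / 2 ^ (n + 1)) / 2 ^ ((n + 1) * N)"
      by (intro divide_right_mono) auto
    also have "\<dots> = D * (1 / 2) ^ N + \<phi> (r (Suc N)) / 2 ^ ((n + 1) * Suc N)"
    proof -
      have q1: "2 ^ ((n + 1) * N) = (2 :: real) ^ (n * N) * 2 ^ N"
        by (simp only: distrib_right mult_1 power_add)
      have q2: "2 ^ ((n + 1) * Suc N) = (2 :: real) ^ (n + 1) * 2 ^ ((n + 1) * N)"
        by (simp only: mult_Suc_right power_add)
      show ?thesis
        unfolding q2 q1 power_one_over add_divide_distrib by simp
    qed
    finally show ?case
      using Suc.IH by (simp add: distrib_left)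
  qed
  have geo: "(\<Sum>i<N. (1 / 2 :: real) ^ i) \<le> 2" for N
    by (simp add: geometric_sum)
  have B: "\<phi> (r N) / 2 ^ ((n + 1) * N) \<le> \<bar>B\<bar> * (1 / 2) ^ N" for N
  proof -
    have "\<phi> (r N) \<le> \<bar>B\<bar>"
      using bdd[OF r(1,3), of N] by linarith
    then have "\<phi> (r N) / 2 ^ ((n + 1) * N) \<le> \<bar>B\<bar> / 2 ^ ((n + 1) * N)"
      by (intro divide_right_mono) auto
    also have "\<dots> \<le> \<bar>B\<bar> / 2 ^ N"
      by (intro divide_left_mono power_increasing) auto
    finally show ?thesis
      by (simp only: power_one_over times_divide_eq_right mult_1_right)
  qed
  have bound: "\<phi> \<rho> \<le> D * 2 + \<bar>B\<bar> * (1 / 2) ^ N" for N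
    using it[of N] B[of N] mult_left_mono[OF geo D0, of N] by linarith
  have "(\<lambda>N. D * 2 + \<bar>B\<bar> * (1 / 2) ^ N) \<longlonglongrightarrow> D * 2 + \<bar>B\<bar> * 0"
    by (intro tendsto_intros LIMSEQ_power_zero) simp
  then have "\<phi> \<rho> \<le> D * 2 + \<bar>B\<bar> * 0"
    by (rule LIMSEQ_le_const) (use bound in auto)
  then show ?thesis
    by (simp add: D_def mult.commute mult.left_commute)
qed

section \<open>Reverse Hoelder inequality for regularized powers\<close>

text \<open>The factor \<open>2 * (1 + \<bar>a\<bar>)\<^sup>2\<close> comes from the derivative
  bound at exponent \<open>a / 2\<close>, the factor \<open>4 * M\<^sup>2 / lam\<^sup>2\<close> from
  the energy estimate, and the final 2 from the gradient of the cutoff.\<close>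

definition energy_const :: "real \<Rightarrow> real \<Rightarrow> real \<Rightarrow> real" where
  "energy_const M lam a = 2 * (1 + \<bar>a\<bar>)\<^sup>2 * (4 * M\<^sup>2 / lam\<^sup>2) + 2"

text \<open>The numerator is the loss in the absorption argument. The denominator is the volume of a
  ball whose radius is the given square root; that root makes the gradient term exactly
  \<open>1 / 2 ^ (n + 1)\<close>, the share that can be absorbed.\<close>

definition step_const :: "nat \<Rightarrow> real \<Rightarrow> real \<Rightarrow> real \<Rightarrow> real" where
  "step_const n M lam a = 2 ^ (n + 1) /
    (unit_ball_vol (real n) * sqrt (1 / (8 * energy_const M lam a * 2 ^ (n + 1))) ^ n)"

lemma energy_const_pos: "0 < energy_const M lam a"
  unfolding energy_const_def by (intro add_nonneg_pos mult_nonneg_nonneg divide_nonneg_nonneg) auto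

lemma step_const_pos: "0 < step_const n M lam a"
  unfolding step_const_def using energy_const_pos by (intro divide_pos_pos mult_pos_pos zero_less_power) auto

context local_solution
begin

abbreviation "sq_u X \<equiv> (norm (u X))\<^sup>2"

lemma integrable_indicator_mult_bounded:
  fixes f g :: "real^'n \<Rightarrow> real"
  assumes f: "f \<in> borel_measurable borel" and g: "integrable lborel g"
    and bound: "\<And>X. X \<in> cball x R \<Longrightarrow> \<bar>f X\<bar> \<le> g X"
  shows "integrable lborel (\<lambda>X. indicator (cball x R) X * f X)"
proof (rule Bochner_Integration.integrable_bound[OF g])
  have [measurable]: "cball x R \<in> sets borel"
    by (rule borel_closed) simp
  show "(\<lambda>X. indicator (cball x R) X * f X) \<in> borel_measurable lborel"
    using f by measurable
  show "AE X in lborel. norm (indicator (cball x R) X * f X) \<le> norm (g X)"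
  proof (intro AE_I2)
    fix X
    show "norm (indicator (cball x R) X * f X) \<le> norm (g X)"
      using bound[of X] by (cases "X \<in> cball x R") (auto simp: abs_mult simp del: mem_cball)
  qed
qed

lemma integrable_indicator_plus_sq_u:
  "integrable lborel (\<lambda>X. c * (indicator (cball x R) X + sq_u X))"
proof -
  have "emeasure lborel (cball x R) < \<infinity>"
    by (intro emeasure_compact_finite) auto
  then show ?thesis
    using u_L2 by (intro integrable_mult_right Bochner_Integration.integrable_add integrable_real_indicator) auto
qed

lemma integrable_reg_sq_u:
  assumes \<epsilon>: "0 < \<epsilon>" "\<epsilon> \<le> 1"
  shows "integrable lborel (\<lambda>X. indicator (cball x R) X * (reg_powr a \<epsilon> (sq_u X) * sq_u X))"
proof (rule integrable_indicator_mult_bounded)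
  have [measurable]: "(\<lambda>X. reg_powr a \<epsilon> (sq_u X)) \<in> borel_measurable borel"
    by (rule reg_powr_u_meas[OF \<epsilon>(1)])
  show "(\<lambda>X. reg_powr a \<epsilon> (sq_u X) * sq_u X) \<in> borel_measurable borel"
    by measurable
  show "integrable lborel (\<lambda>X. (2 / \<epsilon>) powr \<bar>a\<bar> * sq_u X)"
    using u_L2 by simp
  show "\<bar>reg_powr a \<epsilon> (sq_u X) * sq_u X\<bar> \<le> (2 / \<epsilon>) powr \<bar>a\<bar> * sq_u X" for X
    using \<epsilon> reg_powr_pos[of a \<epsilon> "sq_u X"] by (simp add: abs_mult reg_powr_le mult_right_mono)
qed

lemma integrable_reg_norm_u:
  assumes \<epsilon>: "0 < \<epsilon>" "\<epsilon> \<le> 1"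
  shows "integrable lborel (\<lambda>X. indicator (cball x R) X * (reg_powr a \<epsilon> (sq_u X) * norm (u X)))"
proof (rule integrable_indicator_mult_bounded)
  have [measurable]: "(\<lambda>X. reg_powr a \<epsilon> (sq_u X)) \<in> borel_measurable borel"
    by (rule reg_powr_u_meas[OF \<epsilon>(1)])
  show "(\<lambda>X. reg_powr a \<epsilon> (sq_u X) * norm (u X)) \<in> borel_measurable borel"
    by measurable
  show "integrable lborel (\<lambda>X. (2 / \<epsilon>) powr \<bar>a\<bar> * (indicator (cball x R) X + sq_u X))"
    by (rule integrable_indicator_plus_sq_u)
  show "\<bar>reg_powr a \<epsilon> (sq_u X) * norm (u X)\<bar> \<le> (2 / \<epsilon>) powr \<bar>a\<bar> * (indicator (cball x R) X + sq_u X)"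
    if "X \<in> cball x R" for X
  proof -
    have "norm (u X) \<le> indicator (cball x R) X + sq_u X"
      using mult_le_sum_power2[of 1 "norm (u X)"] that by simp
    then have "reg_powr a \<epsilon> (sq_u X) * norm (u X) \<le> (2 / \<epsilon>) powr \<bar>a\<bar> * (indicator (cball x R) X + sq_u X)"
      using \<epsilon> by (intro mult_mono reg_powr_le) auto
    then show ?thesis
      using reg_powr_pos[of a \<epsilon> "sq_u X"] by (simp add: abs_mult)
  qed
qed

lemma integral_reg_cutoff_le:
  assumes \<epsilon>: "0 < \<epsilon>" "\<epsilon> \<le> 1" and "s < t"
    and d: "\<And>X. 0 \<le> d X" "\<And>X. d X \<le> 4 / (t - s)" "\<And>X. X \<notin> cball x t \<Longrightarrow> d X = 0"
    and int: "integrable lborel (\<lambda>X. reg_powr a \<epsilon> (sq_u X) * sq_u X * (d X)\<^sup>2)"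
  shows "(\<integral>X. reg_powr a \<epsilon> (sq_u X) * sq_u X * (d X)\<^sup>2 \<partial>lborel)
    \<le> 16 / (t - s)\<^sup>2 * (\<integral>X. indicator (cball x t) X * (reg_powr a \<epsilon> (sq_u X) * sq_u X) \<partial>lborel)"
proof -
  have "(\<integral>X. reg_powr a \<epsilon> (sq_u X) * sq_u X * (d X)\<^sup>2 \<partial>lborel)
      \<le> (\<integral>X. 16 / (t - s)\<^sup>2 * (indicator (cball x t) X * (reg_powr a \<epsilon> (sq_u X) * sq_u X)) \<partial>lborel)"
  proof (rule integral_mono[OF int integrable_mult_right[OF integrable_reg_sq_u[OF \<epsilon>]]])
    fix X
    have "(d X)\<^sup>2 \<le> (4 / (t - s))\<^sup>2"
      using d by (intro power_mono) auto
    then have "(d X)\<^sup>2 \<le> 16 / (t - s)\<^sup>2"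
      by (simp add: power_divide)
    then have "reg_powr a \<epsilon> (sq_u X) * sq_u X * (d X)\<^sup>2 \<le> reg_powr a \<epsilon> (sq_u X) * sq_u X * (16 / (t - s)\<^sup>2)"
      using reg_powr_pos[of a \<epsilon> "sq_u X"] by (intro mult_left_mono) auto
    then show "reg_powr a \<epsilon> (sq_u X) * sq_u X * (d X)\<^sup>2
        \<le> 16 / (t - s)\<^sup>2 * (indicator (cball x t) X * (reg_powr a \<epsilon> (sq_u X) * sq_u X))"
      using d(3)[of X] by (cases "X \<in> cball x t") (simp_all add: mult_ac del: mem_cball)
  qed
  then show ?thesis
    by simp
qed

text \<open>The exponent is halved because the square of the weight at \<open>a / 2\<close> is the
  weight at \<open>a\<close>, which is the one controlled by the energy estimate. The 16 is the
  square of the 4 in the gradient bound of the cutoff.\<close>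

lemma chain_energy:
  assumes "\<rho> \<ge> 0" "\<rho> < R" "R < S" and \<epsilon>: "0 < \<epsilon>" "\<epsilon> \<le> 1" and \<tau>: "0 \<le> \<tau>" "\<tau> \<le> 1" "2 * a = \<tau> * (q - 2)"
    and \<zeta>: "C_times (Suc 0) (\<lambda>X. complex_of_real (\<zeta> X))" "\<And>X. 0 \<le> \<zeta> X" "\<And>X. X \<notin> cball x R \<Longrightarrow> \<zeta> X = 0"
    and \<zeta>d: "\<And>X. norm (gradient (\<lambda>X. complex_of_real (\<zeta> X)) X) \<le> 4 / (R - \<rho>)"
  shows "(\<integral>X. (norm (chain_grad (a / 2) \<epsilon> (\<lambda>X. complex_of_real (\<zeta> X)) X))\<^sup>2 \<partial>lborel)
    \<le> energy_const M lam a * (16 / (R - \<rho>)\<^sup>2 * (\<integral>X. indicator (cball x R) X * (reg_powr a \<epsilon> (sq_u X) * sq_u X) \<partial>lborel))"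
proof -
  let ?z = "\<lambda>X. complex_of_real (\<zeta> X)"
  define d where "d X = norm (gradient ?z X)" for X
  define \<psi> where "\<psi> X = reg_powr a \<epsilon> (sq_u X)" for X
  have z0: "?z X = 0" if "X \<notin> cball x R" for X
    using \<zeta>(3)[OF that] by simp
  have d0: "d X = 0" if "X \<notin> cball x R" for X
    unfolding d_def using gradient_zero_outside[of "cball x R" ?z X] z0 that by (simp del: mem_cball)
  have C1: "integrable lborel (\<lambda>X. \<psi> X * (norm (G X))\<^sup>2 * (\<zeta> X)\<^sup>2)"
    unfolding \<psi>_def by (rule Caccioppoli_regularized(1)[OF \<open>R < S\<close> \<zeta>(1,3,2) \<epsilon> \<tau>])
  have C2: "integrable lborel (\<lambda>X. \<psi> X * sq_u X * (d X)\<^sup>2)"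
    unfolding \<psi>_def d_def by (rule Caccioppoli_regularized(2)[OF \<open>R < S\<close> \<zeta>(1,3,2) \<epsilon> \<tau>])
  have C3: "(\<integral>X. \<psi> X * (norm (G X))\<^sup>2 * (\<zeta> X)\<^sup>2 \<partial>lborel)
      \<le> 4 * M\<^sup>2 / lam\<^sup>2 * (\<integral>X. \<psi> X * sq_u X * (d X)\<^sup>2 \<partial>lborel)"
    unfolding \<psi>_def d_def by (rule Caccioppoli_regularized(3)[OF \<open>R < S\<close> \<zeta>(1,3,2) \<epsilon> \<tau>])
  note C = C1 C2 C3
  have \<psi>2: "(reg_powr (a / 2) \<epsilon> (sq_u X))\<^sup>2 = \<psi> X" for X
    using reg_powr_square[of "a / 2" \<epsilon> "sq_u X"] by (simp add: \<psi>_def)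
  have pw: "(norm (chain_grad (a / 2) \<epsilon> ?z X))\<^sup>2
      \<le> 2 * (1 + \<bar>a\<bar>)\<^sup>2 * (\<psi> X * (norm (G X))\<^sup>2 * (\<zeta> X)\<^sup>2) + 2 * (\<psi> X * sq_u X * (d X)\<^sup>2)" for X
  proof -
    have "(norm (chain_grad (a / 2) \<epsilon> ?z X $ i))\<^sup>2
        \<le> 2 * (1 + \<bar>a\<bar>)\<^sup>2 * (\<psi> X * (norm (G X $ i))\<^sup>2 * (\<zeta> X)\<^sup>2) + 2 * (\<psi> X * sq_u X * (norm (gradient ?z X $ i))\<^sup>2)" for i
    proof -
      have "norm (reg_power_deriv (a / 2) \<epsilon> (u X) (G X $ i) * ?z X)
          \<le> ((1 + \<bar>a\<bar>) * (reg_powr (a / 2) \<epsilon> (sq_u X) * norm (G X $ i))) * \<zeta> X"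
        using norm_reg_power_deriv_le[OF \<epsilon>(1), of "a / 2" "u X" "G X $ i"] \<zeta>(2)[of X]
        by (simp add: norm_mult mult_right_mono)
      then have "(norm (reg_power_deriv (a / 2) \<epsilon> (u X) (G X $ i) * ?z X))\<^sup>2
          \<le> (((1 + \<bar>a\<bar>) * (reg_powr (a / 2) \<epsilon> (sq_u X) * norm (G X $ i))) * \<zeta> X)\<^sup>2"
        by (intro power_mono) auto
      also have "\<dots> = (1 + \<bar>a\<bar>)\<^sup>2 * (\<psi> X * (norm (G X $ i))\<^sup>2 * (\<zeta> X)\<^sup>2)"
        unfolding power_mult_distrib \<psi>2 by (simp only: mult.assoc)
      finally have 1: "(norm (reg_power_deriv (a / 2) \<epsilon> (u X) (G X $ i) * ?z X))\<^sup>2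
          \<le> (1 + \<bar>a\<bar>)\<^sup>2 * (\<psi> X * (norm (G X $ i))\<^sup>2 * (\<zeta> X)\<^sup>2)" .
      have 2: "(norm (reg_power (a / 2) \<epsilon> (u X) * gradient ?z X $ i))\<^sup>2 = \<psi> X * sq_u X * (norm (gradient ?z X $ i))\<^sup>2"
        unfolding norm_mult norm_reg_power power_mult_distrib \<psi>2 ..
      show ?thesis
        using 1 2 norm_add_power2_le[of "reg_power_deriv (a / 2) \<epsilon> (u X) (G X $ i) * ?z X"
            "reg_power (a / 2) \<epsilon> (u X) * gradient ?z X $ i"]
        unfolding chain_grad_def vec_lambda_beta by linarith
    qed
    then have "(\<Sum>i\<in>UNIV. (norm (chain_grad (a / 2) \<epsilon> ?z X $ i))\<^sup>2)
        \<le> (\<Sum>i\<in>UNIV. 2 * (1 + \<bar>a\<bar>)\<^sup>2 * (\<psi> X * (norm (G X $ i))\<^sup>2 * (\<zeta> X)\<^sup>2) + 2 * (\<psi> X * sq_u X * (norm (gradient ?z X $ i))\<^sup>2))"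
      by (rule sum_mono)
    also have "\<dots> = 2 * (1 + \<bar>a\<bar>)\<^sup>2 * (\<psi> X * (\<Sum>i\<in>UNIV. (norm (G X $ i))\<^sup>2) * (\<zeta> X)\<^sup>2)
        + 2 * (\<psi> X * sq_u X * (\<Sum>i\<in>UNIV. (norm (gradient ?z X $ i))\<^sup>2))"
      by (simp only: sum.distrib sum_distrib_left sum_distrib_right)
    finally show ?thesis
      unfolding norm_vec_square[of "chain_grad (a / 2) \<epsilon> ?z X"] norm_vec_square[of "G X"] d_def
        norm_vec_square[of "gradient ?z X"] .
  qed
  have "(\<integral>X. (norm (chain_grad (a / 2) \<epsilon> ?z X))\<^sup>2 \<partial>lborel)
      \<le> (\<integral>X. 2 * (1 + \<bar>a\<bar>)\<^sup>2 * (\<psi> X * (norm (G X))\<^sup>2 * (\<zeta> X)\<^sup>2) + 2 * (\<psi> X * sq_u X * (d X)\<^sup>2) \<partial>lborel)"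
  proof (rule integral_mono[OF _ _ pw])
    show "integrable lborel (\<lambda>X. (norm (chain_grad (a / 2) \<epsilon> ?z X))\<^sup>2)"
      by (rule chain_Nash(1)[OF \<open>R < S\<close> \<zeta>(1) z0 \<epsilon>])
  qed (use C(1,2) in auto)
  also have "\<dots> = 2 * (1 + \<bar>a\<bar>)\<^sup>2 * (\<integral>X. \<psi> X * (norm (G X))\<^sup>2 * (\<zeta> X)\<^sup>2 \<partial>lborel)
      + 2 * (\<integral>X. \<psi> X * sq_u X * (d X)\<^sup>2 \<partial>lborel)"
    using C(1,2) by simp
  also have "\<dots> \<le> 2 * (1 + \<bar>a\<bar>)\<^sup>2 * (4 * M\<^sup>2 / lam\<^sup>2 * (\<integral>X. \<psi> X * sq_u X * (d X)\<^sup>2 \<partial>lborel))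
      + 2 * (\<integral>X. \<psi> X * sq_u X * (d X)\<^sup>2 \<partial>lborel)"
    using C(3) by (intro add_mono mult_left_mono) auto
  also have "\<dots> = energy_const M lam a * (\<integral>X. \<psi> X * sq_u X * (d X)\<^sup>2 \<partial>lborel)"
    by (simp add: energy_const_def algebra_simps)
  also have "\<dots> \<le> energy_const M lam a * (16 / (R - \<rho>)\<^sup>2 * (\<integral>X. indicator (cball x R) X * (\<psi> X * sq_u X) \<partial>lborel))"
    unfolding \<psi>_def
  proof (rule mult_left_mono[OF integral_reg_cutoff_le[OF \<epsilon> \<open>\<rho> < R\<close>]])
    show "integrable lborel (\<lambda>X. reg_powr a \<epsilon> (sq_u X) * sq_u X * (d X)\<^sup>2)"
      using C(2) by (simp only: \<psi>_def)
    show "0 \<le> energy_const M lam a"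
      using energy_const_pos[of M lam a] by simp
  qed (use \<zeta>d d0 in \<open>auto simp: d_def simp del: mem_cball\<close>)
  finally show ?thesis
    by (simp only: \<psi>_def)
qed

text \<open>For radii \<open>s < t\<close> the Nash type inequality on the scale \<open>h\<close>,
  proportional to \<open>t - s\<close>, bounds \<open>\<phi> s\<close> by the \<open>L^1\<close>
  term plus a small multiple of \<open>\<phi> t\<close>, which is the hypothesis of the absorption
  lemma. No power of \<open>u\<close> beyond the square has to be integrable, since \<epsilon> is
  fixed.\<close>

lemma reverse_Hoelder_regularized:
  assumes "0 \<le> \<rho>" "\<rho> < R" "R < S" and \<epsilon>: "0 < \<epsilon>" "\<epsilon> \<le> 1"
    and \<tau>: "0 \<le> \<tau>" "\<tau> \<le> 1" "2 * a = \<tau> * (q - 2)"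
  shows "(\<integral>X. indicator (cball x \<rho>) X * (reg_powr a \<epsilon> (sq_u X) * sq_u X) \<partial>lborel)
    \<le> step_const CARD('n) M lam a / (R - \<rho>) ^ CARD('n)
      * (\<integral>X. indicator (cball x R) X * (reg_powr (a / 2) \<epsilon> (sq_u X) * norm (u X)) \<partial>lborel)\<^sup>2"
proof -
  let ?n = "CARD('n)"
  define \<phi> where "\<phi> t = (\<integral>X. indicator (cball x t) X * (reg_powr a \<epsilon> (sq_u X) * sq_u X) \<partial>lborel)" for t
  define J where "J = (\<integral>X. indicator (cball x R) X * (reg_powr (a / 2) \<epsilon> (sq_u X) * norm (u X)) \<partial>lborel)"
  define \<sigma> where "\<sigma> = sqrt (1 / (8 * energy_const M lam a * 2 ^ (?n + 1)))"
  define v where "v = unit_ball_vol (real ?n)"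
  have \<sigma>: "0 < \<sigma>" "8 * energy_const M lam a * \<sigma>\<^sup>2 = 1 / 2 ^ (?n + 1)"
    using energy_const_pos[of M lam a] by (simp_all add: \<sigma>_def)
  have v: "0 < v"
    by (simp add: v_def)
  have Vt: "measure lborel (ball (0 :: real^'n) t) = v * t ^ ?n" if "0 \<le> t" for t
    using content_ball[OF that, of "0 :: real^'n"] by (simp add: v_def)
  have \<psi>0: "0 \<le> reg_powr b \<epsilon> s" for b s
    using reg_powr_pos[of b \<epsilon> s] by simp
  \<comment> \<open>Supplies the a priori bound \<open>\<phi> s \<le> \<phi> R\<close> that
    absorption requires; the integrals are finite because the weight is bounded.\<close>
  have mono: "\<phi> s \<le> \<phi> t" if "s \<le> t" for s t
    unfolding \<phi>_def using that \<psi>0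
    by (intro integral_mono integrable_reg_sq_u \<epsilon> mult_right_mono) (auto simp: indicator_def)
  have "\<phi> \<rho> \<le> 2 ^ (?n + 1) * (J\<^sup>2 / (v * \<sigma> ^ ?n)) / (R - \<rho>) ^ ?n"
  proof (rule absorption[OF \<open>\<rho> < R\<close>])
    show "0 \<le> J\<^sup>2 / (v * \<sigma> ^ ?n)"
      using v \<sigma> by simp
    show "\<phi> s \<le> \<phi> R" if "s \<le> R" for s
      by (rule mono[OF that])
    fix s t
    assume st: "\<rho> \<le> s" "s < t" "t \<le> R"
    have "0 \<le> s" "t < S"
      using st assms by auto
    obtain \<zeta> :: "real^'n \<Rightarrow> real" where \<zeta>: "C_times (Suc 0) (\<lambda>X. complex_of_real (\<zeta> X))"
      "\<And>X. 0 \<le> \<zeta> X" "\<And>X. \<zeta> X \<le> 1" "\<And>X. X \<in> cball x s \<Longrightarrow> \<zeta> X = 1" "\<And>X. X \<notin> ball x t \<Longrightarrow> \<zeta> X = 0"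
      "\<And>X. norm (gradient (\<lambda>X. complex_of_real (\<zeta> X)) X) \<le> 4 / (t - s)"
      using cutoff_exists[OF \<open>0 \<le> s\<close> \<open>s < t\<close>, of x] by blast
    let ?z = "\<lambda>X. complex_of_real (\<zeta> X)"
    have \<zeta>z: "\<zeta> X = 0" if "X \<notin> cball x t" for X
      using that by (intro \<zeta>(5)) auto
    have z0: "?z X = 0" if "X \<notin> cball x t" for X
      using \<zeta>z[OF that] by simp

    \<comment> \<open>Proportionality to \<open>t - s\<close> cancels the square of the cutoff width
      in the energy bound, and \<sigma> then fixes the size of the absorbed term.\<close>
    define h where "h = \<sigma> * (t - s)"
    have h: "0 < h"
      using \<sigma> st by (simp add: h_def)
    let ?f = "\<lambda>X. reg_power (a / 2) \<epsilon> (u X) * ?z X"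
    let ?E = "\<integral>X. (norm (chain_grad (a / 2) \<epsilon> ?z X))\<^sup>2 \<partial>lborel"
    have f2: "(norm (?f X))\<^sup>2 = reg_powr a \<epsilon> (sq_u X) * sq_u X * (\<zeta> X)\<^sup>2" for X
      using reg_powr_square[of "a / 2" \<epsilon> "sq_u X"] by (simp add: norm_mult norm_reg_power power_mult_distrib)
    have f1: "norm (?f X) = reg_powr (a / 2) \<epsilon> (sq_u X) * norm (u X) * \<zeta> X" for X
      using \<zeta>(2)[of X] by (simp add: norm_mult norm_reg_power)
    have fm: "?f \<in> borel_measurable borel"
      by (intro borel_measurable_times reg_power_u_meas[OF \<epsilon>(1)]
          borel_measurable_continuous_onI[OF C_times_continuous[OF \<zeta>(1)]])
    have ft: "indicator (cball x t) X * (reg_powr a \<epsilon> (sq_u X) * sq_u X * (\<zeta> X)\<^sup>2) = (norm (?f X))\<^sup>2" for X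
      unfolding f2 using \<zeta>z[of X] by (cases "X \<in> cball x t") (simp_all del: mem_cball)
    have int2: "integrable lborel (\<lambda>X. (norm (?f X))\<^sup>2)"
    proof (rule Bochner_Integration.integrable_bound[OF integrable_reg_sq_u[OF \<epsilon>, of t a]])
      show "(\<lambda>X. (norm (?f X))\<^sup>2) \<in> borel_measurable lborel"
        using fm by (intro borel_measurable_power measurable_compose[OF _ borel_measurable_norm]) simp
      show "AE X in lborel. norm ((norm (?f X))\<^sup>2) \<le> norm (indicator (cball x t) X * (reg_powr a \<epsilon> (sq_u X) * sq_u X))"
      proof (intro AE_I2)
        fix X
        have "(\<zeta> X)\<^sup>2 \<le> 1"
          using \<zeta>(2,3)[of X] by (simp add: power_le_one)
        then have "reg_powr a \<epsilon> (sq_u X) * sq_u X * (\<zeta> X)\<^sup>2 \<le> reg_powr a \<epsilon> (sq_u X) * sq_u X * 1"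
          using \<psi>0 by (intro mult_left_mono) auto
        then show "norm ((norm (?f X))\<^sup>2) \<le> norm (indicator (cball x t) X * (reg_powr a \<epsilon> (sq_u X) * sq_u X))"
          unfolding ft[symmetric] using \<psi>0[of a "sq_u X"]
          by (cases "X \<in> cball x t") (simp_all add: abs_mult del: mem_cball)
      qed
    qed
    have "\<phi> s \<le> (\<integral>X. (norm (?f X))\<^sup>2 \<partial>lborel)"
      unfolding \<phi>_def
    proof (rule integral_mono[OF integrable_reg_sq_u[OF \<epsilon>] int2])
      fix X
      show "indicator (cball x s) X * (reg_powr a \<epsilon> (sq_u X) * sq_u X) \<le> (norm (?f X))\<^sup>2"
        unfolding f2 using \<zeta>(4)[of X] \<psi>0[of a "sq_u X"]
        by (cases "X \<in> cball x s") (simp_all del: mem_cball)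
    qed
    then have "v * h ^ ?n * (2 * \<phi> s) \<le> v * h ^ ?n * (2 * (\<integral>X. (norm (?f X))\<^sup>2 \<partial>lborel))"
      using v h by (intro mult_left_mono) auto
    also have "\<dots> \<le> 2 * (\<integral>X. norm (?f X) \<partial>lborel)\<^sup>2 + v * h ^ ?n * (h\<^sup>2 * ?E)"
    proof -
      have "measure lborel (ball (0 :: real^'n) h) * (2 * (\<integral>X. (norm (?f X))\<^sup>2 \<partial>lborel))
          \<le> 2 * (\<integral>X. norm (?f X) \<partial>lborel)\<^sup>2 + measure lborel (ball (0 :: real^'n) h) * (h\<^sup>2 * ?E)"
        by (rule chain_Nash(2)[OF \<open>t < S\<close> \<zeta>(1) z0 \<epsilon>])
      then show ?thesis
        using h by (simp only: Vt[OF less_imp_le])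
    qed
    \<comment> \<open>The \<open>L^1\<close> norm is taken over the largest ball, so that the
      constant in the absorption argument does not depend on \<open>s\<close> and
      \<open>t\<close>.\<close>
    also have "\<dots> \<le> 2 * J\<^sup>2 + v * h ^ ?n * (h\<^sup>2 * (energy_const M lam a * (16 / (t - s)\<^sup>2 * \<phi> t)))"
    proof (intro add_mono mult_left_mono power_mono)
      show "(\<integral>X. norm (?f X) \<partial>lborel) \<le> J"
        unfolding J_def
      proof (rule integral_mono_AE'[OF integrable_reg_norm_u[OF \<epsilon>]])
        show "AE X in lborel. norm (?f X) \<le> indicator (cball x R) X * (reg_powr (a / 2) \<epsilon> (sq_u X) * norm (u X))"
        proof (intro AE_I2)
          fix X
          have "reg_powr (a / 2) \<epsilon> (sq_u X) * norm (u X) * \<zeta> X \<le> reg_powr (a / 2) \<epsilon> (sq_u X) * norm (u X) * 1"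
            using \<psi>0 \<zeta>(3)[of X] by (intro mult_left_mono) auto
          moreover have "X \<in> cball x R" if "X \<in> cball x t"
            using that st by auto
          ultimately show "norm (?f X) \<le> indicator (cball x R) X * (reg_powr (a / 2) \<epsilon> (sq_u X) * norm (u X))"
            unfolding f1 using \<zeta>z[of X] \<psi>0[of "a / 2" "sq_u X"]
            by (cases "X \<in> cball x t") (simp_all add: indicator_def del: mem_cball)
        qed
      qed (auto intro!: AE_I2 mult_nonneg_nonneg \<psi>0)
      show "?E \<le> energy_const M lam a * (16 / (t - s)\<^sup>2 * \<phi> t)"
        unfolding \<phi>_def by (rule chain_energy[OF \<open>0 \<le> s\<close> \<open>s < t\<close> \<open>t < S\<close> \<epsilon> \<tau> \<zeta>(1,2) \<zeta>z \<zeta>(6)])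
    qed (use v h in auto)
    also have "\<dots> = 2 * J\<^sup>2 + v * h ^ ?n * (2 * ((8 * energy_const M lam a * \<sigma>\<^sup>2) * \<phi> t))"
    proof -
      have hh: "h\<^sup>2 * (16 / (t - s)\<^sup>2) = 16 * \<sigma>\<^sup>2"
        using st by (simp add: h_def power_mult_distrib)
      have "h\<^sup>2 * (energy_const M lam a * (16 / (t - s)\<^sup>2 * \<phi> t)) = (h\<^sup>2 * (16 / (t - s)\<^sup>2)) * (energy_const M lam a * \<phi> t)"
        by (simp only: mult_ac)
      then show ?thesis
        unfolding hh by simp
    qed
    finally have "v * h ^ ?n * (2 * \<phi> s) \<le> 2 * J\<^sup>2 + v * h ^ ?n * (2 * (1 / 2 ^ (?n + 1) * \<phi> t))"
      unfolding \<sigma>(2) .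
    moreover have "0 < v * h ^ ?n"
      using v h by simp
    moreover have "y \<le> j / A + z" if "A * (2 * y) \<le> 2 * j + A * (2 * z)" "0 < A" for y j A z :: real
      using that by (simp add: field_simps)
    ultimately have "\<phi> s \<le> J\<^sup>2 / (v * h ^ ?n) + 1 / 2 ^ (?n + 1) * \<phi> t"
      by blast
    also have "1 / 2 ^ (?n + 1) * \<phi> t = \<phi> t / 2 ^ (?n + 1)"
      by simp
    also have "J\<^sup>2 / (v * h ^ ?n) = J\<^sup>2 / (v * \<sigma> ^ ?n) / (t - s) ^ ?n"
      by (simp add: h_def power_mult_distrib)
    finally show "\<phi> s \<le> J\<^sup>2 / (v * \<sigma> ^ ?n) / (t - s) ^ ?n + \<phi> t / 2 ^ (?n + 1)" .
  qed
  also have "\<dots> = step_const ?n M lam a / (R - \<rho>) ^ ?n * J\<^sup>2"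
    unfolding step_const_def v_def[symmetric] \<sigma>_def[symmetric] by simp
  finally show ?thesis
    by (simp only: \<phi>_def J_def)
qed

end

section \<open>Removal of the regularization\<close>

lemma norm_powr_eq: "norm z powr p = ((norm (z :: complex))\<^sup>2) powr (p / 2)"
proof (cases "z = 0")
  case False
  then have "(norm z)\<^sup>2 = norm z powr 2"
    by (simp add: powr_numeral)
  then show ?thesis
    unfolding \<open>(norm z)\<^sup>2 = norm z powr 2\<close> powr_powr by simp
qed simp

lemma powr_le_one_plus_square:
  fixes t :: real
  assumes "0 \<le> t" "0 \<le> p" "p \<le> 2"
  shows "t powr p \<le> 1 + t\<^sup>2"
proof (cases "t \<le> 1")
  case True
  then have "t powr p \<le> 1 powr p"
    using assms by (intro powr_mono2) auto
  then have "t powr p \<le> 1"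
    by simp
  then show ?thesis
    using zero_le_power2[of t] by linarith
next
  case False
  then have "t powr p \<le> t powr 2"
    using assms by (intro powr_mono) auto
  with False show ?thesis
    by (simp add: powr_numeral)
qed

text \<open>A form of Jensen's inequality with a factor \<open>2\<close>, from
  \<open>y\<^sup>s \<le> m\<^sup>s + m\<^sup>s\<^sup>-\<^sup>1 y\<close> with \<open>m\<close> the mean value.\<close>

lemma integral_powr_le:
  fixes f :: "'a::euclidean_space \<Rightarrow> real"
  assumes "0 < R" and nonneg: "\<And>X. 0 \<le> f X" and s: "0 < s" "s \<le> 1"
    and f: "integrable lborel (\<lambda>X. indicator (cball x R) X * f X)"
    and fs: "integrable lborel (\<lambda>X. indicator (cball x R) X * f X powr s)"
  defines "V \<equiv> measure lborel (cball x R)"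
  shows "(\<integral>X. indicator (cball x R) X * f X powr s \<partial>lborel)
    \<le> 2 * V * ((\<integral>X. indicator (cball x R) X * f X \<partial>lborel) / V) powr s"
proof -
  define m where "m = (\<integral>X. indicator (cball x R) X * f X \<partial>lborel) / V"
  have V: "0 < V"
    unfolding V_def using \<open>0 < R\<close> by (simp add: content_cball)
  have "0 \<le> (\<integral>X. indicator (cball x R) X * f X \<partial>lborel)"
    by (intro integral_nonneg_AE AE_I2 mult_nonneg_nonneg nonneg) auto
  then have m0: "0 \<le> m"
    using V by (simp add: m_def)
  show ?thesis
  proof (cases "m = 0")
    case True
    then have "(\<integral>X. indicator (cball x R) X * f X \<partial>lborel) = 0"
      using V by (simp add: m_def)
    then have "AE X in lborel. indicator (cball x R) X * f X = 0"
      by (subst (asm) integral_nonneg_eq_0_iff_AE[OF f]) (auto intro!: AE_I2 mult_nonneg_nonneg nonneg)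
    then have "AE X in lborel. indicator (cball x R) X * f X powr s = 0"
      by eventually_elim auto
    then have "(\<integral>X. indicator (cball x R) X * f X powr s \<partial>lborel) = 0"
      by (rule integral_eq_zero_AE)
    then show ?thesis
      using V by simp
  next
    case False
    with m0 have m: "0 < m"
      by simp
    have "emeasure lborel (cball x R) < \<infinity>"
      by (intro emeasure_compact_finite) auto
    then have ind: "integrable lborel (indicator (cball x R) :: 'a \<Rightarrow> real)"
      by (intro integrable_real_indicator) auto
    have "(\<integral>X. indicator (cball x R) X * f X powr s \<partial>lborel)
        \<le> (\<integral>X. m powr s * indicator (cball x R) X + m powr (s - 1) * (indicator (cball x R) X * f X) \<partial>lborel)"
    proof (rule integral_mono[OF fs])
      show "integrable lborel (\<lambda>X. m powr s * indicator (cball x R) X + m powr (s - 1) * (indicator (cball x R) X * f X))"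
        using ind f by (intro Bochner_Integration.integrable_add integrable_mult_right) auto
      fix X
      \<comment> \<open>Below \<open>m\<close> the first term suffices by monotonicity; above it the
        power \<open>s - 1\<close>, which is at most 0, is decreasing, and the second term
        suffices.\<close>
      have "y powr s \<le> m powr s + m powr (s - 1) * y" if "0 \<le> y" for y
      proof (cases "y \<le> m")
        case True
        then have "y powr s \<le> m powr s"
          using that s by (intro powr_mono2) auto
        moreover have "0 \<le> m powr (s - 1) * y"
          using that by simp
        ultimately show ?thesis
          by linarith
      next
        case False
        then have y: "0 < y"
          using m by simp
        have "y powr s = y powr (s - 1) * y"
          using y by (simp add: powr_diff)
        also have "\<dots> \<le> m powr (s - 1) * y"
          using False m s y by (intro mult_right_mono powr_mono2') auto
        finally show ?thesis
          using powr_ge_zero[of m s] by linarith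
      qed
      from this[OF nonneg, of X]
      show "indicator (cball x R) X * f X powr s
          \<le> m powr s * indicator (cball x R) X + m powr (s - 1) * (indicator (cball x R) X * f X)"
        by (cases "X \<in> cball x R") (simp_all del: mem_cball)
    qed
    also have "\<dots> = m powr s * V + m powr (s - 1) * (m * V)"
      using ind f V by (simp add: m_def V_def)
    also have "m powr (s - 1) * (m * V) = m powr s * V"
      using m by (simp add: powr_diff)
    finally show ?thesis
      by (simp add: m_def)
  qed
qed

text \<open>Constant accumulated after \<open>j\<close> doublings. Every step squares the previous
  integral, hence the previous constant; \<open>(2 * real N) ^ n\<close> pays for shrinking the
  radius by \<open>r / (2 * N)\<close>.\<close>

primrec chain_const :: "nat \<Rightarrow> real \<Rightarrow> real \<Rightarrow> nat \<Rightarrow> real \<Rightarrow> nat \<Rightarrow> real" where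
  "chain_const n M lam N p 0 = 1"
| "chain_const n M lam N p (Suc j) =
    step_const n M lam ((p * 2 ^ Suc j - 2) / 2) * (2 * real N) ^ n * (chain_const n M lam N p j)\<^sup>2"

lemma chain_const_pos: "0 < N \<Longrightarrow> 0 < chain_const n M lam N p j"
  by (induction j) (auto intro!: mult_pos_pos step_const_pos)

context local_solution
begin

definition reg_seq :: "nat \<Rightarrow> real" where
  "reg_seq k = inverse (real (Suc k))"

lemma reg_seq: "0 < reg_seq k" "reg_seq k \<le> 1" "reg_seq \<longlonglongrightarrow> 0"
proof -
  show "0 < reg_seq k"
    by (simp add: reg_seq_def)
  show "reg_seq k \<le> 1"
    unfolding reg_seq_def by (rule inverse_le_1_iff[THEN iffD2]) auto
  show "reg_seq \<longlonglongrightarrow> 0"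
    unfolding reg_seq_def[abs_def] by (rule LIMSEQ_inverse_real_of_nat)
qed

lemma cball_meas [measurable]: "cball x R \<in> sets borel"
  by (rule borel_closed) simp

text \<open>At zeros of \<open>u\<close> both sides vanish thanks to the power of
  \<open>sq_u\<close>; elsewhere the weight converges on its own.\<close>

lemma reg_tendsto:
  assumes "0 < b"
  shows "(\<lambda>k. reg_powr a (reg_seq k) (sq_u X) * sq_u X powr b) \<longlonglongrightarrow> sq_u X powr (a + b)"
proof (cases "u X = 0")
  case False
  then have "(\<lambda>k. reg_powr a (reg_seq k) (sq_u X) * sq_u X powr b) \<longlonglongrightarrow> sq_u X powr a * sq_u X powr b"
    by (intro tendsto_mult tendsto_const reg_powr_tendsto reg_seq) auto
  with False show ?thesis
    by (simp add: powr_add)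
qed simp

lemma reg_integral_tendsto:
  assumes "0 < b"
    and int1: "integrable lborel (\<lambda>X. indicator (cball x R) X * sq_u X powr (a + b))"
    and int2: "integrable lborel (\<lambda>X. indicator (cball x R) X * sq_u X powr b)"
  shows "(\<lambda>k. \<integral>X. indicator (cball x R) X * (reg_powr a (reg_seq k) (sq_u X) * sq_u X powr b) \<partial>lborel)
    \<longlonglongrightarrow> (\<integral>X. indicator (cball x R) X * sq_u X powr (a + b) \<partial>lborel)"
proof (rule integral_dominated_convergence)
  show "integrable lborel (\<lambda>X. 2 powr \<bar>a\<bar> * (indicator (cball x R) X * sq_u X powr (a + b) + indicator (cball x R) X * sq_u X powr b))"
    by (intro integrable_mult_right Bochner_Integration.integrable_add int1 int2)
  have [measurable]: "(\<lambda>X. reg_powr a (reg_seq k) (sq_u X)) \<in> borel_measurable borel" for k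
    by (rule reg_powr_u_meas[OF reg_seq(1)])
  show "(\<lambda>X. indicator (cball x R) X * (reg_powr a (reg_seq k) (sq_u X) * sq_u X powr b)) \<in> borel_measurable lborel" for k
    by measurable
  show "(\<lambda>X. indicator (cball x R) X * sq_u X powr (a + b)) \<in> borel_measurable lborel"
    by measurable
  show "AE X in lborel. (\<lambda>k. indicator (cball x R) X * (reg_powr a (reg_seq k) (sq_u X) * sq_u X powr b))
      \<longlonglongrightarrow> indicator (cball x R) X * sq_u X powr (a + b)"
    by (intro AE_I2 tendsto_mult tendsto_const reg_tendsto[OF \<open>0 < b\<close>])
  show "AE X in lborel. norm (indicator (cball x R) X * (reg_powr a (reg_seq k) (sq_u X) * sq_u X powr b))
      \<le> 2 powr \<bar>a\<bar> * (indicator (cball x R) X * sq_u X powr (a + b) + indicator (cball x R) X * sq_u X powr b)" for k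
  proof (intro AE_I2)
    fix X
    have "reg_powr a (reg_seq k) (sq_u X) * sq_u X powr b \<le> 2 powr \<bar>a\<bar> * (sq_u X powr (a + b) + sq_u X powr b)"
      using \<open>0 < b\<close> reg_seq(1,2)[of k] by (intro reg_powr_mult_le) auto
    then show "norm (indicator (cball x R) X * (reg_powr a (reg_seq k) (sq_u X) * sq_u X powr b))
        \<le> 2 powr \<bar>a\<bar> * (indicator (cball x R) X * sq_u X powr (a + b) + indicator (cball x R) X * sq_u X powr b)"
      using reg_powr_pos[of a "reg_seq k" "sq_u X"]
      by (cases "X \<in> cball x R") (simp_all add: abs_mult del: mem_cball)
  qed
qed

lemma integrable_norm_powr:
  assumes "0 \<le> p" "p \<le> 2"
  shows "integrable lborel (\<lambda>X. indicator (cball x R) X * norm (u X) powr p)"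
proof (rule integrable_indicator_mult_bounded)
  show "(\<lambda>X. norm (u X) powr p) \<in> borel_measurable borel"
    by measurable
  show "integrable lborel (\<lambda>X. 1 * (indicator (cball x R) X + sq_u X))"
    by (rule integrable_indicator_plus_sq_u)
  show "\<bar>norm (u X) powr p\<bar> \<le> 1 * (indicator (cball x R) X + sq_u X)" if "X \<in> cball x R" for X
    using powr_le_one_plus_square[OF norm_ge_zero assms, of "u X"] that by (simp del: mem_cball)
qed

lemma sq_u_powr: "sq_u X powr b = norm (u X) powr (2 * b)"
  by (simp add: norm_powr_eq[of "u X" "2 * b"])

text \<open>The right side converges by dominated convergence, the left is handled by Fatou. The
  finiteness of the p-th power on the smaller ball is thus a conclusion, and it is what permits
  iterating the step.\<close>

lemma reverse_Hoelder_step: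
  assumes "0 \<le> \<rho>" "\<rho> < R" "R < S" and \<tau>: "0 \<le> \<tau>" "\<tau> \<le> 1" and p: "p = 2 + \<tau> * (q - 2)"
    and int: "integrable lborel (\<lambda>X. indicator (cball x R) X * norm (u X) powr (p / 2))"
  shows "integrable lborel (\<lambda>X. indicator (cball x \<rho>) X * norm (u X) powr p)"
    and "(\<integral>X. indicator (cball x \<rho>) X * norm (u X) powr p \<partial>lborel)
      \<le> step_const CARD('n) M lam ((p - 2) / 2) / (R - \<rho>) ^ CARD('n)
        * (\<integral>X. indicator (cball x R) X * norm (u X) powr (p / 2) \<partial>lborel)\<^sup>2"
proof -
  define a where "a = (p - 2) / 2"
  define c where "c = step_const CARD('n) M lam a / (R - \<rho>) ^ CARD('n)"
  define J where "J k = (\<integral>X. indicator (cball x R) X * (reg_powr (a / 2) (reg_seq k) (sq_u X) * norm (u X)) \<partial>lborel)" for k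
  define J0 where "J0 = (\<integral>X. indicator (cball x R) X * norm (u X) powr (p / 2) \<partial>lborel)"
  have c: "0 \<le> c"
    using step_const_pos[of "CARD('n)" M lam a] \<open>\<rho> < R\<close> by (simp add: c_def)
  have a: "2 * a = \<tau> * (q - 2)"
    by (simp add: a_def p)
  have e1: "norm (u X) = sq_u X powr (1 / 2)" "norm (u X) powr (p / 2) = sq_u X powr (a / 2 + 1 / 2)"
    "sq_u X = sq_u X powr 1" "norm (u X) powr p = sq_u X powr (a + 1)" for X
    by (simp_all add: sq_u_powr a_def field_simps)
  \<comment> \<open>The majorant consists of the power \<open>p / 2\<close>, integrable by
    assumption, and of \<open>norm (u X)\<close> itself, integrable because \<open>u\<close> is
    square integrable on a bounded set.\<close>
  have "J \<longlonglongrightarrow> J0"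
    unfolding J_def[abs_def] J0_def e1(2) using int[unfolded e1(2)] integrable_norm_powr[of 1 R]
    by (subst e1(1), intro reg_integral_tendsto) (simp_all add: sq_u_powr)
  then have lim: "(\<lambda>k. ennreal (c * (J k)\<^sup>2)) \<longlonglongrightarrow> ennreal (c * J0\<^sup>2)"
    by (intro tendsto_ennrealI tendsto_intros)
  let ?f = "\<lambda>k X. indicator (cball x \<rho>) X * (reg_powr a (reg_seq k) (sq_u X) * sq_u X)"
  have [measurable]: "(\<lambda>X. reg_powr a (reg_seq k) (sq_u X)) \<in> borel_measurable borel" for k
    by (rule reg_powr_u_meas[OF reg_seq(1)])
  have f0: "0 \<le> ?f k X" for k X
    using reg_powr_pos[of a "reg_seq k" "sq_u X"] by simp
  have pt: "(\<lambda>k. ennreal (?f k X)) \<longlonglongrightarrow> ennreal (indicator (cball x \<rho>) X * norm (u X) powr p)" for X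
  proof -
    have "(\<lambda>k. reg_powr a (reg_seq k) (sq_u X) * sq_u X powr 1) \<longlonglongrightarrow> sq_u X powr (a + 1)"
      by (rule reg_tendsto) simp
    then have "(\<lambda>k. reg_powr a (reg_seq k) (sq_u X) * sq_u X) \<longlonglongrightarrow> norm (u X) powr p"
      by (simp only: e1(3)[symmetric] e1(4)[symmetric])
    then show ?thesis
      by (intro tendsto_ennrealI tendsto_mult tendsto_const)
  qed
  have "(\<integral>\<^sup>+X. ennreal (indicator (cball x \<rho>) X * norm (u X) powr p) \<partial>lborel)
      = (\<integral>\<^sup>+X. liminf (\<lambda>k. ennreal (?f k X)) \<partial>lborel)"
    by (intro nn_integral_cong) (rule lim_imp_Liminf[OF _ pt, symmetric], simp)
  also have "\<dots> \<le> liminf (\<lambda>k. \<integral>\<^sup>+X. ennreal (?f k X) \<partial>lborel)"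
    by (rule nn_integral_liminf) measurable
  also have "\<dots> \<le> liminf (\<lambda>k. ennreal (c * (J k)\<^sup>2))"
  proof (intro Liminf_mono always_eventually allI)
    fix k
    have "(\<integral>\<^sup>+X. ennreal (?f k X) \<partial>lborel) = ennreal (\<integral>X. ?f k X \<partial>lborel)"
      using integrable_reg_sq_u[OF reg_seq(1,2)] f0 by (intro nn_integral_eq_integral) auto
    also have "\<dots> \<le> ennreal (c * (J k)\<^sup>2)"
      unfolding c_def J_def
      by (intro ennreal_leI reverse_Hoelder_regularized[OF assms(1-3) reg_seq(1,2) \<tau> a])
    finally show "(\<integral>\<^sup>+X. ennreal (?f k X) \<partial>lborel) \<le> ennreal (c * (J k)\<^sup>2)" .
  qed
  also have "\<dots> = ennreal (c * J0\<^sup>2)"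
    by (rule lim_imp_Liminf[OF _ lim]) simp
  finally have le: "(\<integral>\<^sup>+X. ennreal (indicator (cball x \<rho>) X * norm (u X) powr p) \<partial>lborel) \<le> ennreal (c * J0\<^sup>2)" .
  show i: "integrable lborel (\<lambda>X. indicator (cball x \<rho>) X * norm (u X) powr p)"
  proof (rule integrableI_nonneg)
    show "(\<integral>\<^sup>+X. ennreal (indicator (cball x \<rho>) X * norm (u X) powr p) \<partial>lborel) < \<infinity>"
      using le by (rule order.strict_trans1) simp
  qed auto
  have "ennreal (\<integral>X. indicator (cball x \<rho>) X * norm (u X) powr p \<partial>lborel) \<le> ennreal (c * J0\<^sup>2)"
    using le nn_integral_eq_integral[OF i] by simp
  then have "(\<integral>X. indicator (cball x \<rho>) X * norm (u X) powr p \<partial>lborel) \<le> c * J0\<^sup>2"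
    using c by (subst (asm) ennreal_le_iff) auto
  then show "(\<integral>X. indicator (cball x \<rho>) X * norm (u X) powr p \<partial>lborel)
      \<le> step_const CARD('n) M lam ((p - 2) / 2) / (R - \<rho>) ^ CARD('n)
        * (\<integral>X. indicator (cball x R) X * norm (u X) powr (p / 2) \<partial>lborel)\<^sup>2"
    by (simp only: c_def J0_def a_def)
qed

text \<open>The full exponent, \<open>\<tau> = 1\<close>. On the right, the powers q and 2 of
  \<open>norm (u X)\<close> form the majorant. On the left, points with \<open>u X = 0\<close>
  contribute zero by the convention for \<open>powr\<close>, so Fatou is only needed where the
  weights converge.\<close>

lemma Caccioppoli_limit:
  assumes "0 \<le> \<rho>" "\<rho> < R" "R < S"
    and int: "integrable lborel (\<lambda>X. indicator (cball x R) X * norm (u X) powr q)"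
  shows "(\<integral>\<^sup>+X. ennreal (indicator (cball x \<rho>) X * ((norm (G X))\<^sup>2 * norm (u X) powr (q - 2))) \<partial>lborel)
    \<le> ennreal (4 * M\<^sup>2 / lam\<^sup>2 * (16 / (R - \<rho>)\<^sup>2 * (\<integral>X. indicator (cball x R) X * norm (u X) powr q \<partial>lborel)))"
proof -
  define a where "a = (q - 2) / 2"
  have a: "0 \<le> (1 :: real)" "1 \<le> (1 :: real)" "2 * a = 1 * (q - 2)"
    by (simp_all add: a_def)
  define c where "c = 4 * M\<^sup>2 / lam\<^sup>2"
  have c: "0 \<le> c"
    by (simp add: c_def)
  define J where "J k = (\<integral>X. indicator (cball x R) X * (reg_powr a (reg_seq k) (sq_u X) * sq_u X) \<partial>lborel)" for k
  define J0 where "J0 = (\<integral>X. indicator (cball x R) X * norm (u X) powr q \<partial>lborel)"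
  have e1: "sq_u X = sq_u X powr 1" "norm (u X) powr q = sq_u X powr (a + 1)" for X
    by (simp_all add: sq_u_powr a_def field_simps)
  have "J \<longlonglongrightarrow> J0"
  proof -
    have "(\<lambda>k. \<integral>X. indicator (cball x R) X * (reg_powr a (reg_seq k) (sq_u X) * sq_u X powr 1) \<partial>lborel)
      \<longlonglongrightarrow> (\<integral>X. indicator (cball x R) X * sq_u X powr (a + 1) \<partial>lborel)"
      using int[unfolded e1(2)] integrable_norm_powr[of 2 R]
      by (intro reg_integral_tendsto) (simp_all only: sq_u_powr, simp_all)
    then show ?thesis
      by (simp only: e1(1)[symmetric] e1(2)[symmetric] J_def[abs_def] J0_def)
  qed
  then have lim: "(\<lambda>k. ennreal (c * (16 / (R - \<rho>)\<^sup>2 * J k))) \<longlonglongrightarrow> ennreal (c * (16 / (R - \<rho>)\<^sup>2 * J0))"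
    by (intro tendsto_ennrealI tendsto_mult tendsto_const)
  obtain \<zeta> :: "real^'n \<Rightarrow> real" where \<zeta>: "C_times (Suc 0) (\<lambda>X. complex_of_real (\<zeta> X))"
    "\<And>X. 0 \<le> \<zeta> X" "\<And>X. \<zeta> X \<le> 1" "\<And>X. X \<in> cball x \<rho> \<Longrightarrow> \<zeta> X = 1" "\<And>X. X \<notin> ball x R \<Longrightarrow> \<zeta> X = 0"
    "\<And>X. norm (gradient (\<lambda>X. complex_of_real (\<zeta> X)) X) \<le> 4 / (R - \<rho>)"
    using cutoff_exists[OF assms(1,2), of x] by blast
  let ?z = "\<lambda>X. complex_of_real (\<zeta> X)"
  have \<zeta>z: "\<zeta> X = 0" if "X \<notin> cball x R" for X
    using that by (intro \<zeta>(5)) auto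
  have d0: "norm (gradient ?z X) = 0" if "X \<notin> cball x R" for X
    using gradient_zero_outside[of "cball x R" ?z X] \<zeta>z that by (simp del: mem_cball)
  let ?f = "\<lambda>k X. reg_powr a (reg_seq k) (sq_u X) * (norm (G X))\<^sup>2 * (\<zeta> X)\<^sup>2"
  have fi: "integrable lborel (?f k)" for k
    by (rule Caccioppoli_regularized(1)[OF \<open>R < S\<close> \<zeta>(1) \<zeta>z \<zeta>(2) reg_seq(1,2) a])
  have f0: "0 \<le> ?f k X" for k X
    using reg_powr_pos[of a "reg_seq k" "sq_u X"] by simp
  have fle: "(\<integral>X. ?f k X \<partial>lborel) \<le> c * (16 / (R - \<rho>)\<^sup>2 * J k)" for k
  proof -
    have "(\<integral>X. ?f k X \<partial>lborel)
        \<le> c * (\<integral>X. reg_powr a (reg_seq k) (sq_u X) * sq_u X * (norm (gradient ?z X))\<^sup>2 \<partial>lborel)"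
      unfolding c_def by (rule Caccioppoli_regularized(3)[OF \<open>R < S\<close> \<zeta>(1) \<zeta>z \<zeta>(2) reg_seq(1,2) a])
    also have "\<dots> \<le> c * (16 / (R - \<rho>)\<^sup>2 * J k)"
      unfolding J_def
    proof (rule mult_left_mono[OF integral_reg_cutoff_le[OF reg_seq(1,2) \<open>\<rho> < R\<close>] c])
      show "integrable lborel (\<lambda>X. reg_powr a (reg_seq k) (sq_u X) * sq_u X * (norm (gradient ?z X))\<^sup>2)"
        by (rule Caccioppoli_regularized(2)[OF \<open>R < S\<close> \<zeta>(1) \<zeta>z \<zeta>(2) reg_seq(1,2) a])
    qed (use \<zeta>(6) d0 in \<open>auto simp del: mem_cball\<close>)
    finally show ?thesis .
  qed
  have "(\<integral>\<^sup>+X. ennreal (indicator (cball x \<rho>) X * ((norm (G X))\<^sup>2 * norm (u X) powr (q - 2))) \<partial>lborel)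
      \<le> (\<integral>\<^sup>+X. liminf (\<lambda>k. ennreal (?f k X)) \<partial>lborel)"
  proof (intro nn_integral_mono)
    fix X
    show "ennreal (indicator (cball x \<rho>) X * ((norm (G X))\<^sup>2 * norm (u X) powr (q - 2))) \<le> liminf (\<lambda>k. ennreal (?f k X))"
    proof (cases "X \<in> cball x \<rho> \<and> u X \<noteq> 0")
      case True
      have "(\<lambda>k. reg_powr a (reg_seq k) (sq_u X)) \<longlonglongrightarrow> sq_u X powr a"
        using True by (intro reg_powr_tendsto reg_seq) auto
      then have "(\<lambda>k. ennreal (?f k X)) \<longlonglongrightarrow> ennreal (sq_u X powr a * (norm (G X))\<^sup>2 * (\<zeta> X)\<^sup>2)"
        by (intro tendsto_ennrealI tendsto_mult tendsto_const)
      then have "liminf (\<lambda>k. ennreal (?f k X)) = ennreal (sq_u X powr a * (norm (G X))\<^sup>2 * (\<zeta> X)\<^sup>2)"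
        by (intro lim_imp_Liminf) simp_all
      also have "\<dots> = ennreal (indicator (cball x \<rho>) X * ((norm (G X))\<^sup>2 * norm (u X) powr (q - 2)))"
        using True \<zeta>(4)[of X] a(3) by (simp add: sq_u_powr mult.commute del: mem_cball)
      finally show ?thesis
        by simp
    next
      case False
      then have "indicator (cball x \<rho>) X * ((norm (G X))\<^sup>2 * norm (u X) powr (q - 2)) = 0"
        by (auto simp del: mem_cball)
      then show ?thesis
        by (simp only: ennreal_0 zero_le)
    qed
  qed
  also have "\<dots> \<le> liminf (\<lambda>k. \<integral>\<^sup>+X. ennreal (?f k X) \<partial>lborel)"
    by (intro nn_integral_liminf measurable_compose[OF borel_measurable_integrable[OF fi] measurable_ennreal])
  also have "\<dots> \<le> liminf (\<lambda>k. ennreal (c * (16 / (R - \<rho>)\<^sup>2 * J k)))"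
  proof (intro Liminf_mono always_eventually allI)
    fix k
    have "(\<integral>\<^sup>+X. ennreal (?f k X) \<partial>lborel) = ennreal (\<integral>X. ?f k X \<partial>lborel)"
      using fi f0 by (intro nn_integral_eq_integral) auto
    also have "\<dots> \<le> ennreal (c * (16 / (R - \<rho>)\<^sup>2 * J k))"
      by (intro ennreal_leI fle)
    finally show "(\<integral>\<^sup>+X. ennreal (?f k X) \<partial>lborel) \<le> ennreal (c * (16 / (R - \<rho>)\<^sup>2 * J k))" .
  qed
  also have "\<dots> = ennreal (c * (16 / (R - \<rho>)\<^sup>2 * J0))"
    by (rule lim_imp_Liminf[OF _ lim]) simp
  finally show ?thesis
    by (simp only: c_def J0_def)
qed

end

section \<open>The theorem\<close>

lemma enn_powr_divide:
  "0 \<le> y \<Longrightarrow> 0 < b \<Longrightarrow> enn_powr (ennreal y / ennreal b) a = ennreal ((y / b) powr a)"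
  by (simp add: divide_ennreal enn_powr_def)

lemma enn_powr_mono:
  assumes "0 < a" "y \<le> z"
  shows "enn_powr y a \<le> enn_powr z a"
proof (cases "z = \<infinity>")
  case False
  then have "z < top"
    by (simp add: less_top)
  with \<open>y \<le> z\<close> have "y < top"
    by (rule le_less_trans)
  have "enn2real y \<le> enn2real z"
    using \<open>y \<le> z\<close> \<open>z < top\<close> by (rule enn2real_mono)
  then show ?thesis
    using \<open>0 < a\<close> \<open>y < top\<close> False by (auto simp: enn_powr_def intro!: ennreal_leI powr_mono2)
qed (simp add: enn_powr_def)

text \<open>The local estimates bound integrals divided by \<open>r ^ CARD('n)\<close>, which makes
  their constants independent of scale. Taking the root of order \<open>p1\<close> turns the
  exponent \<open>p1 / p2\<close> into \<open>1 / p2\<close>; the remaining factors are the volumes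
  of the unit ball and of the ball of radius 2.\<close>

lemma mean_norm_le:
  fixes x :: "real^'n" and u :: "real^'n \<Rightarrow> complex"
  assumes "0 < r" and p: "0 < p1" "0 < p2" and "0 < C" and X: "0 \<le> X" and Y: "0 \<le> Y"
    and left: "(\<integral>\<^sup>+Z\<in>ball x r. ennreal (norm (u Z) powr p1) \<partial>lebesgue) \<le> ennreal X"
    and right: "ennreal Y \<le> (\<integral>\<^sup>+Z\<in>ball x (2 * r). ennreal (norm (u Z) powr p2) \<partial>lebesgue)"
    and XY: "X / r ^ CARD('n) \<le> C * (Y / r ^ CARD('n)) powr (p1 / p2)"
  defines "v \<equiv> unit_ball_vol (real CARD('n))"
  shows "mean_norm (ball x r) p1 u
    \<le> ennreal ((C / v) powr (1 / p1) * (v * 2 ^ CARD('n)) powr (1 / p2)) * mean_norm (ball x (2 * r)) p2 u"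
proof -
  let ?n = "CARD('n)"
  let ?c = "(C / v) powr (1 / p1) * (v * 2 ^ ?n) powr (1 / p2)"
  have v: "0 < v"
    by (simp add: v_def)
  have rn: "0 < r ^ ?n"
    using \<open>0 < r\<close> by simp
  have "mean_norm (ball x r) p1 u \<le> enn_powr (ennreal X / ennreal (v * r ^ ?n)) (1 / p1)"
    unfolding mean_norm_def using \<open>0 < r\<close> p left
    by (intro enn_powr_mono) (simp_all add: emeasure_ball v_def divide_right_mono_ennreal)
  also have "\<dots> = ennreal ((X / (v * r ^ ?n)) powr (1 / p1))"
    using X v rn by (intro enn_powr_divide mult_pos_pos)
  also have "\<dots> \<le> ennreal (?c * (Y / (v * (2 * r) ^ ?n)) powr (1 / p2))"
  proof (rule ennreal_leI)
    have "X / (v * r ^ ?n) = (X / r ^ ?n) / v"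
      by (simp add: field_simps)
    also have "\<dots> \<le> (C * (Y / r ^ ?n) powr (p1 / p2)) / v"
      using XY v by (intro divide_right_mono) auto
    also have "\<dots> = C / v * (Y / r ^ ?n) powr (p1 / p2)"
      by simp
    finally have "(X / (v * r ^ ?n)) powr (1 / p1) \<le> (C / v * (Y / r ^ ?n) powr (p1 / p2)) powr (1 / p1)"
      using X v rn p by (intro powr_mono2) auto
    also have "\<dots> = (C / v) powr (1 / p1) * (Y / r ^ ?n) powr (1 / p2)"
    proof -
      have e: "p1 / p2 * (1 / p1) = 1 / p2"
        using p by simp
      show ?thesis
        unfolding powr_mult powr_powr e ..
    qed
    also have "Y / r ^ ?n = (v * 2 ^ ?n) * (Y / (v * (2 * r) ^ ?n))"
      using v rn by (simp add: power_mult_distrib)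
    also have "\<dots> powr (1 / p2) = (v * 2 ^ ?n) powr (1 / p2) * (Y / (v * (2 * r) ^ ?n)) powr (1 / p2)"
      by (rule powr_mult)
    finally show "(X / (v * r ^ ?n)) powr (1 / p1) \<le> ?c * (Y / (v * (2 * r) ^ ?n)) powr (1 / p2)"
      by (simp only: mult.assoc)
  qed
  also have "\<dots> = ennreal ?c * enn_powr (ennreal Y / ennreal (v * (2 * r) ^ ?n)) (1 / p2)"
  proof -
    have "0 < v * (2 * r) ^ ?n"
      using v \<open>0 < r\<close> by simp
    from enn_powr_divide[OF Y this] show ?thesis
      by (subst ennreal_mult') simp_all
  qed
  also have "\<dots> \<le> ennreal ?c * mean_norm (ball x (2 * r)) p2 u"
    unfolding mean_norm_def using \<open>0 < r\<close> p right
    by (intro mult_left_mono enn_powr_mono) (simp_all add: emeasure_ball v_def divide_right_mono_ennreal)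
  finally show ?thesis .
qed

section \<open>Iteration over the exponents\<close>

context local_solution
begin

text \<open>The radii descend in \<open>N\<close> equal steps from \<open>3 / 2 * r\<close> to
  \<open>r\<close> while the exponent doubles. Division by \<open>r ^ CARD('n)\<close> is preserved:
  the squared integral carries this factor twice, once from the width of the step and once from the
  normalization on the left.\<close>

lemma reverse_Hoelder_chain:
  assumes "0 < r" "3 / 2 * r < S" and N: "0 < N" and q2: "2 < q" and p: "1 < p" "p \<le> 2" "q = p * 2 ^ N"
    and "j \<le> N"
  defines "\<rho> i \<equiv> r + r / (2 * real N) * (real N - real i)"
  shows "integrable lborel (\<lambda>X. indicator (cball x (\<rho> j)) X * norm (u X) powr (p * 2 ^ j)) \<and>
    (\<integral>X. indicator (cball x (\<rho> j)) X * norm (u X) powr (p * 2 ^ j) \<partial>lborel) / r ^ CARD('n)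
      \<le> chain_const CARD('n) M lam N p j
        * ((\<integral>X. indicator (cball x (\<rho> 0)) X * norm (u X) powr p \<partial>lborel) / r ^ CARD('n)) ^ (2 ^ j)"
  using \<open>j \<le> N\<close>
proof (induction j)
  case 0
  show ?case
    using integrable_norm_powr[of p "\<rho> 0"] p by simp
next
  case (Suc j)
  let ?n = "CARD('n)"
  let ?I = "\<lambda>i. \<integral>X. indicator (cball x (\<rho> i)) X * norm (u X) powr (p * 2 ^ i) \<partial>lborel"
  have IH1: "integrable lborel (\<lambda>X. indicator (cball x (\<rho> j)) X * norm (u X) powr (p * 2 ^ j))"
    and IH2: "?I j / r ^ ?n \<le> chain_const ?n M lam N p j * (?I 0 / r ^ ?n) ^ (2 ^ j)"
    using Suc by simp_all
  define \<delta> where "\<delta> = r / (2 * real N)"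
  have "\<rho> j - \<rho> (Suc j) = \<delta>"
    unfolding \<rho>_def \<delta>_def[symmetric] by (simp add: algebra_simps)
  then have diff: "\<rho> j - \<rho> (Suc j) = r / (2 * real N)"
    by (simp only: \<delta>_def)
  have "0 < r / (2 * real N)"
    using \<open>0 < r\<close> N by simp
  with diff have lt: "\<rho> (Suc j) < \<rho> j"
    by linarith
  have "0 \<le> r / (2 * real N) * (real N - real (Suc j))"
    using \<open>0 < r\<close> Suc.prems by (intro mult_nonneg_nonneg) auto
  then have nonneg: "0 \<le> \<rho> (Suc j)"
    using \<open>0 < r\<close> by (simp add: \<rho>_def)
  have "r / (2 * real N) * (real N - real j) \<le> r / (2 * real N) * real N"
    using \<open>0 < r\<close> by (intro mult_left_mono) auto
  also have "\<dots> = r / 2"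
    using N by simp
  finally have "\<rho> j < S"
    using \<open>3 / 2 * r < S\<close> by (simp add: \<rho>_def)
  define P where "P = p * 2 ^ Suc j"
  \<comment> \<open>Since \<open>p > 1\<close>, the exponent \<open>P\<close> after doubling lies
    between 2 and q, so it is reached by some \<tau> in [0, 1].\<close>
  define \<tau> where "\<tau> = (P - 2) / (q - 2)"
  have "P \<le> q"
    unfolding P_def p(3) using p(1) Suc.prems by (intro mult_left_mono power_increasing) auto
  moreover have "1 * 2 ^ 1 \<le> p * 2 ^ Suc j"
    using p(1) by (intro mult_mono power_increasing) auto
  ultimately have \<tau>: "0 \<le> \<tau>" "\<tau> \<le> 1" "P = 2 + \<tau> * (q - 2)"
    using q2 by (simp_all add: \<tau>_def P_def)
  have half: "P / 2 = p * 2 ^ j"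
    by (simp add: P_def)
  note st = reverse_Hoelder_step[OF nonneg lt \<open>\<rho> j < S\<close> \<tau>, unfolded half, OF IH1]
  have I0: "0 \<le> ?I j"
    by (intro integral_nonneg_AE AE_I2 mult_nonneg_nonneg) auto
  have "?I (Suc j) / r ^ ?n \<le> (step_const ?n M lam ((P - 2) / 2) / (\<rho> j - \<rho> (Suc j)) ^ ?n * (?I j)\<^sup>2) / r ^ ?n"
    using st(2) \<open>0 < r\<close> by (intro divide_right_mono) (simp_all add: P_def)
  also have "\<dots> = step_const ?n M lam ((P - 2) / 2) * (2 * real N) ^ ?n * (?I j / r ^ ?n)\<^sup>2"
    unfolding diff power_divide by (simp add: power2_eq_square)
  also have "\<dots> \<le> step_const ?n M lam ((P - 2) / 2) * (2 * real N) ^ ?n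
      * (chain_const ?n M lam N p j * (?I 0 / r ^ ?n) ^ (2 ^ j))\<^sup>2"
    using IH2 I0 \<open>0 < r\<close> less_imp_le[OF step_const_pos]
    by (intro mult_left_mono power_mono mult_nonneg_nonneg divide_nonneg_nonneg) auto
  also have "\<dots> = chain_const ?n M lam N p (Suc j) * (?I 0 / r ^ ?n) ^ (2 ^ Suc j)"
    by (simp add: P_def power_mult_distrib power_mult[symmetric] mult.assoc mult.commute[of _ 2])
  finally have "?I (Suc j) / r ^ ?n \<le> chain_const ?n M lam N p (Suc j) * (?I 0 / r ^ ?n) ^ (2 ^ Suc j)" .
  with st(1) show ?case
    by (simp only: P_def power_0 mult_1_right)
qed

text \<open>Scaled form of the Jensen type estimate: \<open>w * r ^ CARD('n)\<close> is the volume
  of the ball of radius \<open>3 / 2 * r\<close>, and its powers of \<open>r\<close> cancel.\<close>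

lemma normalized_integral_powr_le:
  assumes "0 < r" "0 < s" "s \<le> 1" and nonneg: "0 \<le> p"
    and i1: "integrable lborel (\<lambda>X. indicator (cball x (3 / 2 * r)) X * norm (u X) powr p)"
    and i2: "integrable lborel (\<lambda>X. indicator (cball x (3 / 2 * r)) X * norm (u X) powr (p * s))"
  defines "w \<equiv> unit_ball_vol (real CARD('n)) * (3 / 2) ^ CARD('n)"
  shows "(\<integral>X. indicator (cball x (3 / 2 * r)) X * norm (u X) powr (p * s) \<partial>lborel) / r ^ CARD('n)
    \<le> 2 * w / w powr s * ((\<integral>X. indicator (cball x (3 / 2 * r)) X * norm (u X) powr p \<partial>lborel) / r ^ CARD('n)) powr s"
proof -
  let ?n = "CARD('n)"
  let ?Y = "\<integral>X. indicator (cball x (3 / 2 * r)) X * norm (u X) powr p \<partial>lborel"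
  have w: "0 < w"
    by (simp add: w_def)
  have V: "measure lborel (cball x (3 / 2 * r)) = w * r ^ ?n"
    using content_cball[of "3 / 2 * r" x] \<open>0 < r\<close> by (simp add: w_def power_mult_distrib power_divide)
  have Y: "0 \<le> ?Y"
    by (intro integral_nonneg_AE AE_I2 mult_nonneg_nonneg) auto
  have "(\<integral>X. indicator (cball x (3 / 2 * r)) X * (norm (u X) powr p) powr s \<partial>lborel)
      \<le> 2 * measure lborel (cball x (3 / 2 * r)) * (?Y / measure lborel (cball x (3 / 2 * r))) powr s"
    using assms(1-3) i1 i2 by (intro integral_powr_le) (simp_all add: powr_powr)
  then have "(\<integral>X. indicator (cball x (3 / 2 * r)) X * norm (u X) powr (p * s) \<partial>lborel) / r ^ ?n
      \<le> (2 * (w * r ^ ?n) * (?Y / (w * r ^ ?n)) powr s) / r ^ ?n"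
    unfolding V powr_powr using \<open>0 < r\<close> by (intro divide_right_mono) auto
  also have "\<dots> = 2 * w * (?Y / r ^ ?n / w) powr s"
    using \<open>0 < r\<close> by (simp add: mult.commute)
  also have "(?Y / r ^ ?n / w) powr s = (?Y / r ^ ?n) powr s / w powr s"
    by (rule powr_divide)
  finally show ?thesis
    by simp
qed

text \<open>The chain leads from exponent p to q, and the Jensen type estimate from 2 down to p.
  Raising to the power \<open>2 ^ N\<close> turns \<open>p / 2\<close> into \<open>q / 2\<close>,
  which is the homogeneity required by the averages.\<close>

lemma reverse_Hoelder_above_2:
  assumes "0 < r" "3 / 2 * r < S" and N: "0 < N" and q2: "2 < q" and p: "1 < p" "p \<le> 2" "q = p * 2 ^ N"
  defines "w \<equiv> unit_ball_vol (real CARD('n)) * (3 / 2) ^ CARD('n)"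
  shows "integrable lborel (\<lambda>X. indicator (cball x r) X * norm (u X) powr q)"
    and "(\<integral>X. indicator (cball x r) X * norm (u X) powr q \<partial>lborel) / r ^ CARD('n)
      \<le> chain_const CARD('n) M lam N p N * (2 * w / w powr (p / 2)) ^ (2 ^ N)
        * ((\<integral>X. indicator (cball x (3 / 2 * r)) X * norm (u X) powr 2 \<partial>lborel) / r ^ CARD('n)) powr (q / 2)"
proof -
  let ?n = "CARD('n)"
  let ?Y = "\<integral>X. indicator (cball x (3 / 2 * r)) X * norm (u X) powr 2 \<partial>lborel"
  let ?I = "\<integral>X. indicator (cball x (3 / 2 * r)) X * norm (u X) powr p \<partial>lborel"
  have e: "r + r / (2 * real N) * (real N - real N) = r" "r + r / (2 * real N) * (real N - real 0) = 3 / 2 * r"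
    using N by (simp_all add: field_simps)
  note ch = reverse_Hoelder_chain[OF assms(1-3) q2 p order_refl, unfolded e p(3)[symmetric]]
  show "integrable lborel (\<lambda>X. indicator (cball x r) X * norm (u X) powr q)"
    using ch by blast
  have w: "0 < w"
    by (simp add: w_def)
  have Y: "0 \<le> ?Y / r ^ ?n" and I: "0 \<le> ?I / r ^ ?n"
    using \<open>0 < r\<close> by (intro divide_nonneg_nonneg integral_nonneg_AE AE_I2 mult_nonneg_nonneg; simp)+
  have "?I / r ^ ?n \<le> 2 * w / w powr (p / 2) * (?Y / r ^ ?n) powr (p / 2)"
    using normalized_integral_powr_le[of r "p / 2" 2] integrable_norm_powr[of p "3 / 2 * r"]
      integrable_norm_powr[of 2 "3 / 2 * r"] p \<open>0 < r\<close> by (simp add: w_def)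
  then have "(?I / r ^ ?n) ^ (2 ^ N) \<le> (2 * w / w powr (p / 2) * (?Y / r ^ ?n) powr (p / 2)) ^ (2 ^ N)"
    using I by (intro power_mono) auto
  also have "\<dots> = (2 * w / w powr (p / 2)) ^ (2 ^ N) * (?Y / r ^ ?n) powr (q / 2)"
  proof -
    have "(y powr (p / 2)) ^ (2 ^ N) = y powr (q / 2)" if "0 \<le> y" for y :: real
    proof (cases "y = 0")
      case False
      with that have "0 < y powr (p / 2)"
        by simp
      then have "(y powr (p / 2)) ^ (2 ^ N) = (y powr (p / 2)) powr real (2 ^ N)"
        by (simp only: powr_realpow)
      then show ?thesis
        by (simp add: powr_powr p(3))
    qed simp
    from this[OF Y] show ?thesis
      by (simp only: power_mult_distrib)
  qed
  finally have "chain_const ?n M lam N p N * (?I / r ^ ?n) ^ (2 ^ N)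
      \<le> chain_const ?n M lam N p N * ((2 * w / w powr (p / 2)) ^ (2 ^ N) * (?Y / r ^ ?n) powr (q / 2))"
    using less_imp_le[OF chain_const_pos[OF N]] by (rule mult_left_mono)
  with ch show "(\<integral>X. indicator (cball x r) X * norm (u X) powr q \<partial>lborel) / r ^ ?n
      \<le> chain_const ?n M lam N p N * (2 * w / w powr (p / 2)) ^ (2 ^ N) * (?Y / r ^ ?n) powr (q / 2)"
    unfolding mult.assoc by (meson order_trans)
qed

text \<open>A single step with \<open>\<tau> = 0\<close>, where the weight is constant, bounds the
  square by the first power; since q > 1, the first power is then compared with the power q by the
  Jensen type estimate with exponent \<open>1 / q\<close>.\<close>

lemma reverse_Hoelder_below_2:
  assumes "0 < r" "3 / 2 * r < S" and q2: "q < 2"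
  defines "w \<equiv> unit_ball_vol (real CARD('n)) * (3 / 2) ^ CARD('n)"
  shows "(\<integral>X. indicator (cball x r) X * norm (u X) powr 2 \<partial>lborel) / r ^ CARD('n)
      \<le> step_const CARD('n) M lam 0 * 2 ^ CARD('n) * (2 * w / w powr (1 / q))\<^sup>2
        * ((\<integral>X. indicator (cball x (3 / 2 * r)) X * norm (u X) powr q \<partial>lborel) / r ^ CARD('n)) powr (2 / q)"
proof -
  let ?n = "CARD('n)"
  let ?Y = "\<integral>X. indicator (cball x (3 / 2 * r)) X * norm (u X) powr q \<partial>lborel"
  let ?I = "\<integral>X. indicator (cball x (3 / 2 * r)) X * norm (u X) powr 1 \<partial>lborel"
  let ?X = "\<integral>X. indicator (cball x r) X * norm (u X) powr 2 \<partial>lborel"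
  have i: "integrable lborel (\<lambda>X. indicator (cball x (3 / 2 * r)) X * norm (u X) powr 1)"
    by (rule integrable_norm_powr) auto
  have Y: "0 \<le> ?Y / r ^ ?n" and I: "0 \<le> ?I / r ^ ?n"
    using \<open>0 < r\<close> by (intro divide_nonneg_nonneg integral_nonneg_AE AE_I2 mult_nonneg_nonneg; simp)+
  have i': "integrable lborel (\<lambda>X. indicator (cball x (3 / 2 * r)) X * norm (u X) powr (2 / 2))"
    using i by simp
  have "?X \<le> step_const ?n M lam ((2 - 2) / 2) / (3 / 2 * r - r) ^ ?n
      * (\<integral>X. indicator (cball x (3 / 2 * r)) X * norm (u X) powr (2 / 2) \<partial>lborel)\<^sup>2"
    by (rule reverse_Hoelder_step(2)[OF _ _ assms(2) order_refl zero_le_one _ i']) (use \<open>0 < r\<close> in auto)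
  moreover have "3 / 2 * r - r = r / 2" "(2 - 2) / 2 = (0 :: real)" "2 / 2 = (1 :: real)"
    by simp_all
  ultimately have "?X \<le> step_const ?n M lam 0 / (r / 2) ^ ?n * ?I\<^sup>2"
    by (simp only:)
  then have "?X / r ^ ?n \<le> (step_const ?n M lam 0 / (r / 2) ^ ?n * ?I\<^sup>2) / r ^ ?n"
    using \<open>0 < r\<close> by (intro divide_right_mono) simp_all
  also have "\<dots> = step_const ?n M lam 0 * 2 ^ ?n * (?I / r ^ ?n)\<^sup>2"
    unfolding power_divide by (simp add: power2_eq_square)
  also have "\<dots> \<le> step_const ?n M lam 0 * 2 ^ ?n * (2 * w / w powr (1 / q) * (?Y / r ^ ?n) powr (1 / q))\<^sup>2"
  proof (intro mult_left_mono power_mono I)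
    have "?I / r ^ ?n = (\<integral>X. indicator (cball x (3 / 2 * r)) X * norm (u X) powr (q * (1 / q)) \<partial>lborel) / r ^ ?n"
      using q by simp
    also have "\<dots> \<le> 2 * w / w powr (1 / q) * (?Y / r ^ ?n) powr (1 / q)"
      unfolding w_def using \<open>0 < r\<close> q q2 i
      by (intro normalized_integral_powr_le integrable_norm_powr) auto
    finally show "?I / r ^ ?n \<le> 2 * w / w powr (1 / q) * (?Y / r ^ ?n) powr (1 / q)" .
    show "0 \<le> step_const ?n M lam 0 * 2 ^ ?n"
      using less_imp_le[OF step_const_pos] by simp
  qed
  also have "\<dots> = step_const ?n M lam 0 * 2 ^ ?n * ((2 * w / w powr (1 / q))\<^sup>2 * (?Y / r ^ ?n) powr (2 / q))"
  proof -
    have "(y powr (1 / q))\<^sup>2 = y powr (2 / q)" for y :: real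
      by (simp add: power2_eq_square powr_add[symmetric])
    then show ?thesis
      by (simp only: power_mult_distrib)
  qed
  finally show ?thesis
    by (simp only: mult.assoc)
qed

end

section \<open>Transfer to the domain and choice of constants\<close>

text \<open>The theorem speaks of open balls and \<open>lebesgue\<close>, the local estimates of
  closed balls and \<open>lborel\<close>. This direction serves the left sides of the estimates, the
  companion below serves the right sides.\<close>

lemma local_nn_integral_le:
  fixes f f' :: "real^'n \<Rightarrow> real"
  assumes ae: "AE X in lebesgue. X \<in> cball x S \<longrightarrow> f' X = f X" and "r < S"
    and [measurable]: "f' \<in> borel_measurable borel"
  shows "(\<integral>\<^sup>+X\<in>ball x r. ennreal (f X) \<partial>lebesgue) \<le> (\<integral>\<^sup>+X. ennreal (indicator (cball x r) X * f' X) \<partial>lborel)"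
proof -
  have [measurable]: "cball x r \<in> sets borel"
    by (rule borel_closed) simp
  have "(\<integral>\<^sup>+X\<in>ball x r. ennreal (f X) \<partial>lebesgue) \<le> (\<integral>\<^sup>+X. ennreal (indicator (cball x r) X * f' X) \<partial>lebesgue)"
  proof (rule nn_integral_mono_AE)
    show "AE X in lebesgue. ennreal (f X) * indicator (ball x r) X \<le> ennreal (indicator (cball x r) X * f' X)"
      using ae by eventually_elim (use \<open>r < S\<close> in \<open>auto simp: indicator_def\<close>)
  qed
  also have "\<dots> = (\<integral>\<^sup>+X. ennreal (indicator (cball x r) X * f' X) \<partial>lborel)"
    by (rule nn_integral_completion)
  finally show ?thesis .
qed

lemma local_nn_integral_ge:
  fixes f f' :: "real^'n \<Rightarrow> real"
  assumes ae: "AE X in lebesgue. X \<in> cball x S \<longrightarrow> f' X = f X" and "R < S" "R < T"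
    and [measurable]: "f' \<in> borel_measurable borel"
  shows "(\<integral>\<^sup>+X. ennreal (indicator (cball x R) X * f' X) \<partial>lborel) \<le> (\<integral>\<^sup>+X\<in>ball x T. ennreal (f X) \<partial>lebesgue)"
proof -
  have [measurable]: "cball x R \<in> sets borel"
    by (rule borel_closed) simp
  have "(\<integral>\<^sup>+X. ennreal (indicator (cball x R) X * f' X) \<partial>lborel)
      = (\<integral>\<^sup>+X. ennreal (indicator (cball x R) X * f' X) \<partial>lebesgue)"
    by (rule nn_integral_completion[symmetric])
  also have "\<dots> \<le> (\<integral>\<^sup>+X\<in>ball x T. ennreal (f X) \<partial>lebesgue)"
  proof (rule nn_integral_mono_AE)
    show "AE X in lebesgue. ennreal (indicator (cball x R) X * f' X) \<le> ennreal (f X) * indicator (ball x T) X"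
      using ae by eventually_elim (use \<open>R < S\<close> \<open>R < T\<close> in \<open>auto simp: indicator_def\<close>)
  qed
  finally show ?thesis .
qed

theorem proposition1p14:
  fixes q lam0 M :: real
  assumes "1 < q" and "0 < lam0"
  shows "\<exists>C>0. \<forall>(\<Omega> :: (real^'n) set) (A :: real^'n \<Rightarrow> complex^'n^'n) (lamq :: real)
      (x :: real^'n) (r :: real) (u :: real^'n \<Rightarrow> complex).
    open \<Omega> \<and> connected \<Omega> \<and>
    q_elliptic \<Omega> A q lamq \<and> lam0 \<le> lamq \<and> Linf_norm \<Omega> A \<le> ennreal M \<and>
    0 < r \<and> ball x (2 * r) \<subseteq> \<Omega> \<and> weak_solution \<Omega> A u \<longrightarrow>
      (\<integral>\<^sup>+X\<in>ball x r. ennreal (grad_density \<Omega> q u X) \<partial>lebesgue)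
        \<le> ennreal (C / r\<^sup>2) * (\<integral>\<^sup>+X\<in>ball x (2 * r). ennreal (norm (u X) powr q) \<partial>lebesgue) \<and>
      (q > 2 \<longrightarrow> mean_norm (ball x r) q u \<le> ennreal C * mean_norm (ball x (2 * r)) 2 u) \<and>
      (q < 2 \<longrightarrow> mean_norm (ball x r) 2 u \<le> ennreal C * mean_norm (ball x (2 * r)) q u)"
proof -
  let ?n = "CARD('n)"
  define M' where "M' = max M 0"
  define v where "v = unit_ball_vol (real ?n)"
  define w where "w = v * (3 / 2) ^ ?n"
  have v: "0 < v" and w: "0 < w"
    by (simp_all add: v_def w_def)
  \<comment> \<open>\<open>N\<close> is the least number of halvings that brings q down to at most
    2; by minimality the result p exceeds 1. Both depend on q alone. The conditional form keeps them
    available as names when q is at most 2.\<close>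
  obtain N p where Np: "2 < q \<Longrightarrow> 0 < (N :: nat) \<and> 1 < p \<and> p \<le> 2 \<and> q = p * 2 ^ N"
  proof (cases "2 < q")
    case True
    define N where "N = (LEAST N. q / 2 ^ N \<le> 2)"
    obtain m :: nat where "q / 2 < 2 ^ m"
      using real_arch_pow[of 2 "q / 2"] by auto
    then have "q / 2 ^ m \<le> 2"
      by (simp add: field_simps)
    then have N1: "q / 2 ^ N \<le> 2"
      unfolding N_def by (rule LeastI)
    have N0: "0 < N"
      using N1 True by (cases N) auto
    then obtain k where k: "N = Suc k"
      by (cases N) auto
    have "\<not> q / 2 ^ k \<le> 2"
      using not_less_Least[of k "\<lambda>N. q / 2 ^ N \<le> 2"] k by (simp add: N_def)
    then have "1 < q / 2 ^ N"
      by (simp add: k field_simps)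
    with N0 N1 show ?thesis
      by (intro that[of N "q / 2 ^ N"]) simp
  qed (use that in blast)
  \<comment> \<open>256 is 4 from the energy estimate times 16 from the cutoff times 4 from its
    width \<open>r / 2\<close>.\<close>
  define C1 where "C1 = 256 * M'\<^sup>2 / lam0\<^sup>2"
  define C2 where "C2 = chain_const ?n M' lam0 N p N * (2 * w / w powr (p / 2)) ^ (2 ^ N)"
  define C3 where "C3 = step_const ?n M' lam0 0 * 2 ^ ?n * (2 * w / w powr (1 / q))\<^sup>2"
  define D where "D C p1 p2 = (C / v) powr (1 / p1) * (v * 2 ^ ?n) powr (1 / p2)" for C p1 p2
  \<comment> \<open>The 1 makes the constant positive, and all other summands are nonnegative, so
    \<open>C\<close> dominates each of them whichever case of q occurs.\<close>
  define C where "C = 1 + C1 + D C2 q 2 + D C3 2 q"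
  have C3: "0 < C3"
    unfolding C3_def using w by (intro mult_pos_pos step_const_pos zero_less_power divide_pos_pos) auto
  have D: "0 \<le> D c p1 p2" for c p1 p2
    by (simp add: D_def)
  have C1: "0 \<le> C1"
    by (simp add: C1_def)
  have C: "0 < C" "C1 \<le> C" "D C2 q 2 \<le> C" "D C3 2 q \<le> C"
    unfolding C_def using C1 D[of C2 q 2] D[of C3 2 q] by linarith+
  show ?thesis
  proof (intro exI[of _ C] conjI allI impI C(1); elim conjE)
    fix \<Omega> :: "(real^'n) set" and A lamq x r and u :: "real^'n \<Rightarrow> complex"
    assume h: "open \<Omega>" "q_elliptic \<Omega> A q lamq" "lam0 \<le> lamq" "Linf_norm \<Omega> A \<le> ennreal M"
      "0 < r" "ball x (2 * r) \<subseteq> \<Omega>" "weak_solution \<Omega> A u"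
    \<comment> \<open>Strictly between \<open>3 / 2 * r\<close> and \<open>2 * r\<close>: the closed
      ball stays inside the open double ball, and the estimates on radius \<open>3 / 2 * r\<close>
      still have room for mollification.\<close>
    define S where "S = 7 / 4 * r"
    have S: "3 / 2 * r < S" "r < S" "r < 3 / 2 * r" "3 / 2 * r < 2 * r"
      using \<open>0 < r\<close> by (simp_all add: S_def)
    have "cball x S \<subseteq> ball x (2 * r)"
      using \<open>0 < r\<close> by (auto simp: S_def)
    then have ball: "cball x S \<subseteq> \<Omega>"
      using h(6) by blast
    obtain u' G' H' where loc: "local_solution u' G' H' x S lam0 M' q"
      and ae: "AE X in lebesgue. X \<in> cball x S \<longrightarrow> u' X = u X \<and> G' X = weak_gradient \<Omega> u X"
      by (rule local_solution_exists[OF h(1-4) ball h(7) assms, folded M'_def]) (rule that)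
    interpret local_solution u' G' H' x S lam0 M' q
      by (rule loc)
    have ae_u: "AE X in lebesgue. X \<in> cball x S \<longrightarrow> norm (u' X) powr b = norm (u X) powr b" for b
      using ae by eventually_elim auto
    have m_u: "(\<lambda>X. norm (u' X) powr b) \<in> borel_measurable borel" for b
      by measurable
    have int_nonneg: "0 \<le> (\<integral>X. indicator (cball x t) X * norm (u' X) powr b \<partial>lborel)" for t b
      by (intro integral_nonneg_AE AE_I2 mult_nonneg_nonneg) auto
    have lower: "ennreal (\<integral>X. indicator (cball x (3 / 2 * r)) X * norm (u' X) powr b \<partial>lborel)
        \<le> (\<integral>\<^sup>+X\<in>ball x (2 * r). ennreal (norm (u X) powr b) \<partial>lebesgue)"
      if "integrable lborel (\<lambda>X. indicator (cball x (3 / 2 * r)) X * norm (u' X) powr b)" for b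
      using local_nn_integral_ge[OF ae_u S(1) S(4) m_u, of b] nn_integral_eq_integral[OF that] by simp
    have upper: "(\<integral>\<^sup>+X\<in>ball x r. ennreal (norm (u X) powr b) \<partial>lebesgue)
        \<le> ennreal (\<integral>X. indicator (cball x r) X * norm (u' X) powr b \<partial>lborel)"
      if "integrable lborel (\<lambda>X. indicator (cball x r) X * norm (u' X) powr b)" for b
      using local_nn_integral_le[OF ae_u S(2) m_u, of b] nn_integral_eq_integral[OF that] by simp
    show "(\<integral>\<^sup>+X\<in>ball x r. ennreal (grad_density \<Omega> q u X) \<partial>lebesgue)
        \<le> ennreal (C / r\<^sup>2) * (\<integral>\<^sup>+X\<in>ball x (2 * r). ennreal (norm (u X) powr q) \<partial>lebesgue)"
    \<comment> \<open>An infinite right side makes the estimate trivial. Otherwise its finiteness is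
      the integrability that the limit in \<epsilon> requires.\<close>
    proof (cases "(\<integral>\<^sup>+X\<in>ball x (2 * r). ennreal (norm (u X) powr q) \<partial>lebesgue) = \<infinity>")
      case True
      then show ?thesis
        using C(1) \<open>0 < r\<close> by (simp add: ennreal_mult_top)
    next
      case False
      let ?g = "\<lambda>X. indicator (cball x (3 / 2 * r)) X * norm (u' X) powr q"
      have i: "integrable lborel ?g"
      proof (rule integrableI_nonneg)
        have "(\<integral>\<^sup>+X. ennreal (?g X) \<partial>lborel) \<le> (\<integral>\<^sup>+X\<in>ball x (2 * r). ennreal (norm (u X) powr q) \<partial>lebesgue)"
          by (rule local_nn_integral_ge[OF ae_u S(1) S(4) m_u])
        also have "\<dots> < \<infinity>"
          using False by (simp add: less_top)
        finally show "(\<integral>\<^sup>+X. ennreal (?g X) \<partial>lborel) < \<infinity>" .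
      qed auto
      have "AE X in lebesgue. X \<in> cball x S \<longrightarrow>
          (norm (G' X))\<^sup>2 * norm (u' X) powr (q - 2) = grad_density \<Omega> q u X"
        using ae by eventually_elim (auto simp: grad_density_def)
      then have "(\<integral>\<^sup>+X\<in>ball x r. ennreal (grad_density \<Omega> q u X) \<partial>lebesgue)
          \<le> (\<integral>\<^sup>+X. ennreal (indicator (cball x r) X * ((norm (G' X))\<^sup>2 * norm (u' X) powr (q - 2))) \<partial>lborel)"
        by (rule local_nn_integral_le[OF _ S(2)]) measurable
      also have "\<dots> \<le> ennreal (4 * M'\<^sup>2 / lam0\<^sup>2 * (16 / (3 / 2 * r - r)\<^sup>2 * (\<integral>X. ?g X \<partial>lborel)))"
        using \<open>0 < r\<close> by (intro Caccioppoli_limit S i) simp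
      also have "4 * M'\<^sup>2 / lam0\<^sup>2 * (16 / (3 / 2 * r - r)\<^sup>2 * (\<integral>X. ?g X \<partial>lborel)) = C1 / r\<^sup>2 * (\<integral>X. ?g X \<partial>lborel)"
      proof -
        have sq: "(3 / 2 * r - r)\<^sup>2 = r\<^sup>2 / 4"
          by (simp add: power2_eq_square)
        show ?thesis
          unfolding sq C1_def by simp
      qed
      also have "ennreal (C1 / r\<^sup>2 * (\<integral>X. ?g X \<partial>lborel)) \<le> ennreal (C / r\<^sup>2 * (\<integral>X. ?g X \<partial>lborel))"
        using C(2) int_nonneg[of "3 / 2 * r" q] by (intro ennreal_leI mult_right_mono divide_right_mono) auto
      also have "\<dots> = ennreal (C / r\<^sup>2) * ennreal (\<integral>X. ?g X \<partial>lborel)"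
        using C(1) by (intro ennreal_mult') simp
      also have "\<dots> \<le> ennreal (C / r\<^sup>2) * (\<integral>\<^sup>+X\<in>ball x (2 * r). ennreal (norm (u X) powr q) \<partial>lebesgue)"
        by (intro mult_left_mono lower i) simp
      finally show ?thesis .
    qed
    show "mean_norm (ball x r) q u \<le> ennreal C * mean_norm (ball x (2 * r)) 2 u" if "q > 2"
    proof -
      have N: "0 < N" and p: "1 < p" "p \<le> 2" "q = p * 2 ^ N"
        using Np[OF that] by auto
      have C2: "0 < C2"
        unfolding C2_def using w by (intro mult_pos_pos chain_const_pos N zero_less_power divide_pos_pos) auto
      note RH = reverse_Hoelder_above_2[OF \<open>0 < r\<close> S(1) N that p, folded v_def, folded w_def, folded C2_def]
      have "mean_norm (ball x r) q u \<le> ennreal (D C2 q 2) * mean_norm (ball x (2 * r)) 2 u"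
        unfolding D_def v_def using \<open>0 < r\<close> \<open>1 < q\<close> C2
        by (intro mean_norm_le[OF _ _ _ _ int_nonneg int_nonneg upper[OF RH(1)] lower RH(2)] integrable_norm_powr) auto
      also have "\<dots> \<le> ennreal C * mean_norm (ball x (2 * r)) 2 u"
        by (intro mult_right_mono ennreal_leI C(3)) simp
      finally show ?thesis .
    qed
    show "mean_norm (ball x r) 2 u \<le> ennreal C * mean_norm (ball x (2 * r)) q u" if "q < 2"
    proof -
      note RH = reverse_Hoelder_below_2[OF \<open>0 < r\<close> S(1) that, folded v_def, folded w_def, folded C3_def]
      have "mean_norm (ball x r) 2 u \<le> ennreal (D C3 2 q) * mean_norm (ball x (2 * r)) q u"
        unfolding D_def v_def using \<open>0 < r\<close> \<open>1 < q\<close> C3 that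
        by (intro mean_norm_le[OF _ _ _ _ int_nonneg int_nonneg upper lower RH] integrable_norm_powr) auto
      also have "\<dots> \<le> ennreal C * mean_norm (ball x (2 * r)) q u"
        by (intro mult_right_mono ennreal_leI C(4)) simp
      finally show ?thesis .
    qed
  qed
qed

end
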